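(* Let $(M,g,J,\psi_{\mathbb C})$ be a closed, connected nearly Kähler six-manifold with an effective action of the two-torus $T^2$ preserving $g$, $J$, $\psi_\pm$, with generating vector fields $U,V$ and multi-moment map $\nu_M=\sigma(U,V)$. Let $s\neq0$ be a regular value of $\nu_M$, let $Q_s^3=\nu_M^{-1}(s)/T^2$ be the $T^2$-reduction of $M$ at level $s$, and let $\alpha_0,\alpha_1,\alpha_2$ and $h^2$ be as defined in the context. Define $f:=4h^2/(h^2-s^2)$. Then on $Q_s^3$ the forms $\alpha_0,\alpha_1,\alpha_2$ satisfy $$d\alpha_0=f\,\alpha_1\wedge\alpha_2,\qquad d\alpha_1\wedge\alpha_0=-\frac{df}{f}\wedge\alpha_1\wedge\alpha_0,\qquad d\alpha_2\wedge\alpha_0=-\frac{df}{f}\wedge\alpha_2\wedge\alpha_0 .$$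
   Context: Let $M$ be a closed (compact, without boundary), connected smooth six-manifold. An $\mathrm{SU}(3)$-structure on $M$ consists of a Riemannian metric $g$, an almost complex structure $J$ which is an isometry of each tangent space, and a complex volume form $\psi_{\mathbb C}=\psi_++i\psi_-$ of type $(3,0)$, with fundamental two-form $\sigma:=g(J\cdot,\cdot)$, such that at each point $p$ there is an orthonormal basis $\{F_k,JF_k\}_{k=1,2,3}$ of $T_pM$, with dual basis $\{f_k,Jf_k\}_{k=1,2,3}$ ($Jf_k$ denoting the element dual to $JF_k$), for which $\sigma=\sum_{k=1}^3 f_k\wedge Jf_k$ and $\psi_{\mathbb C}=(f_1+iJf_1)\wedge(f_2+iJf_2)\wedge(f_3+iJf_3)$. The structure is called nearly Kähler if $$d\sigma=3\psi_+,\qquad d\psi_-=-2\,\sigma\wedge\sigma .$$ The generating vector fields $U,V$ are those of the action induced by a basis of the Lie algebra $\mathfrak t^2$ of $T^2$; in particular $[U,V]=0$. The function $\nu_M=\sigma(U,V)$ is $T^2$-invariant and satisfies $d\nu_M=3\psi_+(U,V,\cdot)$. For a regular value $s$ (a value $s\in\nu_M(M)$ with $(d\nu_M)_p\ne0$ for all $p\in\nu_M^{-1}(s)$) the $T^2$-action on $\nu_M^{-1}(s)$ is free, and $Q_s^3=\nu_M^{-1}(s)/T^2$ is a smooth 3-manifold. Notation: $g_{UU}=g(U,U)$, $g_{UV}=g(U,V)$, $g_{VV}=g(V,V)$, $h^2=g_{UU}g_{VV}-g_{UV}^2$; $X^\flat=g(X,\cdot)$; $X\lrcorner\,\omega=\omega(X,\cdot,\dots)$,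 so that $V\lrcorner U\lrcorner\,\omega=\omega(U,V,\cdot,\dots)$. On $\nu_M^{-1}(s)$ one has $h^2-s^2=\lVert\psi_+(U,V,\cdot)\rVert_g^2>0$. On $\nu_M^{-1}(s)$ define $$\vartheta_1=h^{-2}\bigl(g_{VV}U^\flat-g_{UV}V^\flat\bigr),\qquad \vartheta_2=h^{-2}\bigl(g_{UU}V^\flat-g_{UV}U^\flat\bigr),$$ $$\alpha_0=V\lrcorner U\lrcorner\,\psi_-,\qquad \alpha_1=s\vartheta_1+V\lrcorner\,\sigma,\qquad \alpha_2=s\vartheta_2-U\lrcorner\,\sigma .$$ The one-forms $\alpha_0,\alpha_1,\alpha_2$ are basic ($T^2$-invariant and annihilated by contraction with $U$ and $V$), and $h^2$ is $T^2$-invariant, so they are pull-backs of one-forms and a function on $Q_s^3$, denoted by the same symbols. *)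

theory Defs
  imports "HOL-Analysis.Analysis" "HOL-Combinatorics.Permutations"
begin

section \<open>Smooth manifolds\<close>

text \<open>Continuous differentiability to order \<open>k\<close> and smoothness on an open subset of a Euclidean
  space. The definitions are only meant for open sets.\<close>

fun Ck_on :: "nat \<Rightarrow> 'a::euclidean_space set \<Rightarrow> ('a \<Rightarrow> 'b::real_normed_vector) \<Rightarrow> bool" where
  "Ck_on 0 S f \<longleftrightarrow> continuous_on S f"
| "Ck_on (Suc k) S f \<longleftrightarrow>
     (\<forall>x\<in>S. f differentiable (at x)) \<and> (\<forall>v. Ck_on k S (\<lambda>x. frechet_derivative f (at x) v))"

definition smooth_on :: "'a::euclidean_space set \<Rightarrow> ('a \<Rightarrow> 'b::real_normed_vector) \<Rightarrow> bool" where
  "smooth_on S f \<longleftrightarrow> (\<forall>k. Ck_on k S f)"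

text \<open>A chart is its domain together with its coordinate map. The atlas of a manifold need not be
  maximal. The dimension is that of the model space \<open>'e\<close>.\<close>

type_synonym ('a, 'e) chart = "'a set \<times> ('a \<Rightarrow> 'e)"

record ('a, 'e) mfd =
  mspace :: "'a topology"
  charts :: "('a, 'e) chart set"

abbreviation points :: "('a, 'e) mfd \<Rightarrow> 'a set" where
  "points M \<equiv> topspace (mspace M)"

abbreviation cdom :: "('a, 'e) chart \<Rightarrow> 'a set" where
  "cdom c \<equiv> fst c"

abbreviation cmap :: "('a, 'e) chart \<Rightarrow> 'a \<Rightarrow> 'e" where
  "cmap c \<equiv> snd c"

definition cinv :: "('a, 'e) chart \<Rightarrow> 'e \<Rightarrow> 'a" where
  "cinv c = inv_into (cdom c) (cmap c)"

definition charts_at :: "('a, 'e) mfd \<Rightarrow> 'a \<Rightarrow> ('a, 'e) chart set" where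
  "charts_at M p = {c \<in> charts M. p \<in> cdom c}"

definition smooth_manifold :: "('a, 'e::euclidean_space) mfd \<Rightarrow> bool" where
  "smooth_manifold M \<longleftrightarrow>
     Hausdorff_space (mspace M) \<and> second_countable (mspace M) \<and>
     (\<Union>c\<in>charts M. cdom c) = points M \<and>
     (\<forall>c\<in>charts M. openin (mspace M) (cdom c) \<and> open (cmap c ` cdom c) \<and>
        homeomorphic_map (subtopology (mspace M) (cdom c)) (top_of_set (cmap c ` cdom c)) (cmap c)) \<and>
     (\<forall>c\<in>charts M. \<forall>d\<in>charts M. smooth_on (cmap c ` (cdom c \<inter> cdom d)) (cmap d \<circ> cinv c))"

definition smooth_map ::
    "('a, 'e::euclidean_space) mfd \<Rightarrow> ('b, 'f::euclidean_space) mfd \<Rightarrow> ('a \<Rightarrow> 'b) \<Rightarrow> bool" where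
  "smooth_map M N F \<longleftrightarrow> continuous_map (mspace M) (mspace N) F \<and>
     (\<forall>c\<in>charts M. \<forall>d\<in>charts N.
        smooth_on (cmap c ` {p \<in> cdom c. F p \<in> cdom d}) (cmap d \<circ> F \<circ> cinv c))"


section \<open>Tangent vectors\<close>

text \<open>A tangent vector at \<open>p\<close> is the family of its coordinate vectors in the charts around \<open>p\<close>,
  which are related by the derivatives of the changes of coordinates. By convention, the family
  vanishes on everything that is not a chart around \<open>p\<close>. For a chart \<open>c\<close> around \<open>p\<close>,
  \<open>tvec M c p x\<close> is the tangent vector with coordinates \<open>x\<close> in \<open>c\<close>, so that \<open>tvec M c p\<close>
  and \<open>\<lambda>X. X c\<close> are mutually inverse bijections between the model space and the tangent space;
  they transport its vector space structure. For this structure, the operations on the tangent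
  space are the pointwise ones.\<close>

type_synonym ('a, 'e) tangent = "('a, 'e) chart \<Rightarrow> 'e"

definition tvec :: "('a, 'e::euclidean_space) mfd \<Rightarrow> ('a, 'e) chart \<Rightarrow> 'a \<Rightarrow> 'e \<Rightarrow> ('a, 'e) tangent"
  where
  "tvec M c p x = (\<lambda>d. if d \<in> charts_at M p
      then frechet_derivative (cmap d \<circ> cinv c) (at (cmap c p)) x else 0)"

definition tangent_space :: "('a, 'e::euclidean_space) mfd \<Rightarrow> 'a \<Rightarrow> ('a, 'e) tangent set" where
  "tangent_space M p = {X. \<forall>c\<in>charts_at M p. X = tvec M c p (X c)}"

text \<open>An arbitrarily chosen chart around \<open>p\<close>, used to write down chart-independent notions.\<close>

definition chart_at :: "('a, 'e) mfd \<Rightarrow> 'a \<Rightarrow> ('a, 'e) chart" where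
  "chart_at M p = (SOME c. c \<in> charts_at M p)"

definition differential ::
    "('a, 'e::euclidean_space) mfd \<Rightarrow> ('b, 'f::euclidean_space) mfd \<Rightarrow> ('a \<Rightarrow> 'b) \<Rightarrow>
     'a \<Rightarrow> ('a, 'e) tangent \<Rightarrow> ('b, 'f) tangent" where
  "differential M N F p X = (let c = chart_at M p in
     (\<lambda>d. if d \<in> charts_at N (F p)
       then frechet_derivative (cmap d \<circ> F \<circ> cinv c) (at (cmap c p)) (X c) else 0))"

definition immersion ::
    "('a, 'e::euclidean_space) mfd \<Rightarrow> ('b, 'f::euclidean_space) mfd \<Rightarrow> ('a \<Rightarrow> 'b) \<Rightarrow> bool" where
  "immersion M N F \<longleftrightarrow> smooth_map M N F \<and>
     (\<forall>p\<in>points M. inj_on (differential M N F p) (tangent_space M p))"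

definition submersion ::
    "('a, 'e::euclidean_space) mfd \<Rightarrow> ('b, 'f::euclidean_space) mfd \<Rightarrow> ('a \<Rightarrow> 'b) \<Rightarrow> bool" where
  "submersion M N F \<longleftrightarrow> smooth_map M N F \<and>
     (\<forall>p\<in>points M. differential M N F p ` tangent_space M p = tangent_space N (F p))"


section \<open>Differential forms\<close>

text \<open>A \<open>k\<close>-covector is a function on lists of tangent vectors, of which only the values on lists of
  \<open>k\<close> tangent vectors matter; accordingly, equality of forms is expressed by \<open>form_eq\<close>.
  Functions are treated as \<open>0\<close>-forms, evaluated on the empty list.\<close>

type_synonym ('a, 'e) form = "'a \<Rightarrow> ('a, 'e) tangent list \<Rightarrow> real"

definition alternating_covector ::
    "('a, 'e::euclidean_space) mfd \<Rightarrow> 'a \<Rightarrow> nat \<Rightarrow> (('a, 'e) tangent list \<Rightarrow> real) \<Rightarrow> bool" where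
  "alternating_covector M p k a \<longleftrightarrow> (\<forall>c\<in>charts_at M p. \<forall>xs. length xs = k \<longrightarrow>
     (\<forall>i<k. linear (\<lambda>x. a (map (tvec M c p) (xs[i := x])))) \<and>
     (\<forall>i j. i < j \<and> j < k \<and> xs ! i = xs ! j \<longrightarrow> a (map (tvec M c p) xs) = 0))"

text \<open>The coordinate expression of a form in a chart.\<close>

definition in_chart ::
    "('a, 'e::euclidean_space) mfd \<Rightarrow> ('a, 'e) chart \<Rightarrow> ('a, 'e) form \<Rightarrow> 'e \<Rightarrow> 'e list \<Rightarrow> real" where
  "in_chart M c \<omega> x xs = \<omega> (cinv c x) (map (tvec M c (cinv c x)) xs)"

definition smooth_form :: "('a, 'e::euclidean_space) mfd \<Rightarrow> nat \<Rightarrow> ('a, 'e) form \<Rightarrow> bool" where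
  "smooth_form M k \<omega> \<longleftrightarrow> (\<forall>p\<in>points M. alternating_covector M p k (\<omega> p)) \<and>
     (\<forall>c\<in>charts M. \<forall>xs. length xs = k \<longrightarrow>
        smooth_on (cmap c ` cdom c) (\<lambda>x. in_chart M c \<omega> x xs))"

definition form_eq ::
    "('a, 'e::euclidean_space) mfd \<Rightarrow> nat \<Rightarrow> ('a, 'e) form \<Rightarrow> ('a, 'e) form \<Rightarrow> bool" where
  "form_eq M k \<omega> \<eta> \<longleftrightarrow>
     (\<forall>p\<in>points M. \<forall>Xs. length Xs = k \<and> set Xs \<subseteq> tangent_space M p \<longrightarrow> \<omega> p Xs = \<eta> p Xs)"

definition fun_form :: "('a \<Rightarrow> real) \<Rightarrow> ('a, 'e) form" where
  "fun_form f = (\<lambda>p _. f p)"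

text \<open>Wedge product of a \<open>k\<close>- and an \<open>l\<close>-covector, normalised such that
  \<open>(a \<and> b)(X, Y) = a(X) b(Y) - a(Y) b(X)\<close> for \<open>k = l = 1\<close>.\<close>

definition wedge ::
    "nat \<Rightarrow> nat \<Rightarrow> ('t list \<Rightarrow> 'b::real_normed_field) \<Rightarrow> ('t list \<Rightarrow> 'b) \<Rightarrow> 't list \<Rightarrow> 'b" where
  "wedge k l a b Xs = (\<Sum>\<pi> | \<pi> permutes {..<k + l}.
      of_int (sign \<pi>) * a (map (\<lambda>i. Xs ! \<pi> i) [0..<k]) * b (map (\<lambda>i. Xs ! \<pi> i) [k..<k + l]))
      / (fact k * fact l)"

definition form_wedge ::
    "nat \<Rightarrow> nat \<Rightarrow> ('a, 'e) form \<Rightarrow> ('a, 'e) form \<Rightarrow> ('a, 'e) form" where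
  "form_wedge k l \<omega> \<eta> = (\<lambda>p. wedge k l (\<omega> p) (\<eta> p))"

text \<open>Exterior derivative. In a chart, the derivative of a \<open>k\<close>-form is
  \<open>d\<omega>(x\<^sub>0, \<dots>, x\<^sub>k) = (\<Sum>i\<le>k. (-1)^i \<partial>\<^bsub>x\<^sub>i\<^esub> \<omega>(x\<^sub>0, \<dots>, x\<^sub>i\<^sub>-\<^sub>1, x\<^sub>i\<^sub>+\<^sub>1, \<dots>, x\<^sub>k))\<close>
  for constant coordinate vectors \<open>x\<^sub>i\<close>.\<close>

definition ext_deriv :: "('a, 'e::euclidean_space) mfd \<Rightarrow> ('a, 'e) form \<Rightarrow> ('a, 'e) form" where
  "ext_deriv M \<omega> = (\<lambda>p Xs. let c = chart_at M p; xs = map (\<lambda>X. X c) Xs in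
     (\<Sum>i<length xs. (-1) ^ i *
        frechet_derivative (\<lambda>x. in_chart M c \<omega> x (take i xs @ drop (Suc i) xs))
          (at (cmap c p)) (xs ! i)))"

definition contract :: "('a \<Rightarrow> ('a, 'e) tangent) \<Rightarrow> ('a, 'e) form \<Rightarrow> ('a, 'e) form" where
  "contract X \<omega> = (\<lambda>p Xs. \<omega> p (X p # Xs))"

definition pullback ::
    "('a, 'e::euclidean_space) mfd \<Rightarrow> ('b, 'f::euclidean_space) mfd \<Rightarrow> ('a \<Rightarrow> 'b) \<Rightarrow>
     ('b, 'f) form \<Rightarrow> ('a, 'e) form" where
  "pullback M N F \<omega> = (\<lambda>p Xs. \<omega> (F p) (map (differential M N F p) Xs))"


section \<open>Nearly Kaehler structures\<close>

type_synonym ('a, 'e) bilinear_field = "'a \<Rightarrow> ('a, 'e) tangent \<Rightarrow> ('a, 'e) tangent \<Rightarrow> real"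
type_synonym ('a, 'e) endo_field = "'a \<Rightarrow> ('a, 'e) tangent \<Rightarrow> ('a, 'e) tangent"

definition riemannian_metric ::
    "('a, 'e::euclidean_space) mfd \<Rightarrow> ('a, 'e) bilinear_field \<Rightarrow> bool" where
  "riemannian_metric M g \<longleftrightarrow>
     (\<forall>p\<in>points M. \<forall>c\<in>charts_at M p. bilinear (\<lambda>x y. g p (tvec M c p x) (tvec M c p y))) \<and>
     (\<forall>p\<in>points M. \<forall>X\<in>tangent_space M p. \<forall>Y\<in>tangent_space M p. g p X Y = g p Y X) \<and>
     (\<forall>p\<in>points M. \<forall>X\<in>tangent_space M p. X \<noteq> (\<lambda>_. 0) \<longrightarrow> g p X X > 0) \<and>
     (\<forall>c\<in>charts M. \<forall>x y. smooth_on (cmap c ` cdom c)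
        (\<lambda>z. g (cinv c z) (tvec M c (cinv c z) x) (tvec M c (cinv c z) y)))"

definition almost_complex_structure ::
    "('a, 'e::euclidean_space) mfd \<Rightarrow> ('a, 'e) endo_field \<Rightarrow> bool" where
  "almost_complex_structure M J \<longleftrightarrow>
     (\<forall>p\<in>points M. \<forall>X\<in>tangent_space M p. J p X \<in> tangent_space M p \<and> J p (J p X) = - X) \<and>
     (\<forall>p\<in>points M. \<forall>c\<in>charts_at M p. linear (\<lambda>x. J p (tvec M c p x) c)) \<and>
     (\<forall>c\<in>charts M. \<forall>x. smooth_on (cmap c ` cdom c)
        (\<lambda>z. J (cinv c z) (tvec M c (cinv c z) x) c))"

definition fundamental_form ::
    "('a, 'e) bilinear_field \<Rightarrow> ('a, 'e) endo_field \<Rightarrow> ('a, 'e) form" where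
  "fundamental_form g J = (\<lambda>p Xs. g p (J p (Xs ! 0)) (Xs ! 1))"

text \<open>The frame \<open>F\<^sub>1, JF\<^sub>1, F\<^sub>2, JF\<^sub>2, F\<^sub>3, JF\<^sub>3\<close> with dual basis \<open>f\<^sub>1, f'\<^sub>1, f\<^sub>2, f'\<^sub>2, f\<^sub>3, f'\<^sub>3\<close>.
  Since the model space is six-dimensional, the six orthonormal vectors form a basis. The last
  clause implies that the complex volume form is of type (3,0).\<close>

definition su3_frame ::
    "('a, real^6) mfd \<Rightarrow> ('a, real^6) bilinear_field \<Rightarrow> ('a, real^6) endo_field \<Rightarrow>
     ('a, real^6) form \<Rightarrow> ('a, real^6) form \<Rightarrow> 'a \<Rightarrow>
     (nat \<Rightarrow> ('a, real^6) tangent) \<Rightarrow> (nat \<Rightarrow> ('a, real^6) tangent list \<Rightarrow> real) \<Rightarrow>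
     (nat \<Rightarrow> ('a, real^6) tangent list \<Rightarrow> real) \<Rightarrow> bool" where
  "su3_frame M g J psi_re psi_im p F f f' \<longleftrightarrow>
     (\<forall>i\<in>{1..3}. F i \<in> tangent_space M p \<and>
        alternating_covector M p 1 (f i) \<and> alternating_covector M p 1 (f' i)) \<and>
     (\<forall>i\<in>{1..3}. \<forall>j\<in>{1..3}.
        g p (F i) (F j) = of_bool (i = j) \<and> g p (J p (F i)) (J p (F j)) = of_bool (i = j) \<and>
        g p (F i) (J p (F j)) = 0) \<and>
     (\<forall>i\<in>{1..3}. \<forall>j\<in>{1..3}.
        f i [F j] = of_bool (i = j) \<and> f i [J p (F j)] = 0 \<and>
        f' i [F j] = 0 \<and> f' i [J p (F j)] = of_bool (i = j)) \<and>
     (\<forall>X\<in>tangent_space M p. \<forall>Y\<in>tangent_space M p.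
        fundamental_form g J p [X, Y] = (\<Sum>k\<in>{1..3}. wedge 1 1 (f k) (f' k) [X, Y])) \<and>
     (\<forall>X\<in>tangent_space M p. \<forall>Y\<in>tangent_space M p. \<forall>Z\<in>tangent_space M p.
        let z = (\<lambda>k Xs. Complex (f k Xs) (f' k Xs)) in
        Complex (psi_re p [X, Y, Z]) (psi_im p [X, Y, Z]) =
          wedge 2 1 (wedge 1 1 (z 1) (z 2)) (z 3) [X, Y, Z])"

definition su3_structure ::
    "('a, real^6) mfd \<Rightarrow> ('a, real^6) bilinear_field \<Rightarrow> ('a, real^6) endo_field \<Rightarrow>
     ('a, real^6) form \<Rightarrow> ('a, real^6) form \<Rightarrow> bool" where
  "su3_structure M g J psi_re psi_im \<longleftrightarrow>
     riemannian_metric M g \<and> almost_complex_structure M J \<and>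
     (\<forall>p\<in>points M. \<forall>X\<in>tangent_space M p. \<forall>Y\<in>tangent_space M p.
        g p (J p X) (J p Y) = g p X Y) \<and>
     smooth_form M 3 psi_re \<and> smooth_form M 3 psi_im \<and>
     (\<forall>p\<in>points M. \<exists>F f f'. su3_frame M g J psi_re psi_im p F f f')"

definition nearly_kaehler ::
    "('a, real^6) mfd \<Rightarrow> ('a, real^6) bilinear_field \<Rightarrow> ('a, real^6) endo_field \<Rightarrow>
     ('a, real^6) form \<Rightarrow> ('a, real^6) form \<Rightarrow> bool" where
  "nearly_kaehler M g J psi_re psi_im \<longleftrightarrow> su3_structure M g J psi_re psi_im \<and>
     (let \<sigma> = fundamental_form g J in
        form_eq M 3 (ext_deriv M \<sigma>) (\<lambda>p Xs. 3 * psi_re p Xs) \<and>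
        form_eq M 4 (ext_deriv M psi_im) (\<lambda>p Xs. - 2 * form_wedge 2 2 \<sigma> \<sigma> p Xs))"


section \<open>Actions of the two-torus\<close>

text \<open>The two-torus as the product of two unit circles; its Lie algebra is identified with
  \<open>real \<times> real\<close>.\<close>

definition torus2 :: "(complex \<times> complex) set" where
  "torus2 = {z. cmod z = 1} \<times> {w. cmod w = 1}"

definition torus_exp :: "real \<times> real \<Rightarrow> complex \<times> complex" where
  "torus_exp \<xi> = (cis (fst \<xi>), cis (snd \<xi>))"

text \<open>The product of the Lie algebra with \<open>M\<close>. As \<open>torus_exp\<close> is a surjective local
  diffeomorphism onto the torus, smoothness of an action can be expressed on this product.\<close>

definition algebra_times ::
    "('a, 'e::euclidean_space) mfd \<Rightarrow> ((real \<times> real) \<times> 'a, (real \<times> real) \<times> 'e) mfd" where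
  "algebra_times M = \<lparr>mspace = prod_topology euclidean (mspace M),
     charts = (\<lambda>c. (UNIV \<times> cdom c, \<lambda>(\<xi>, p). (\<xi>, cmap c p))) ` charts M\<rparr>"

definition torus_action ::
    "('a, 'e::euclidean_space) mfd \<Rightarrow> (complex \<times> complex \<Rightarrow> 'a \<Rightarrow> 'a) \<Rightarrow> bool" where
  "torus_action M \<rho> \<longleftrightarrow>
     (\<forall>p\<in>points M. \<rho> (1, 1) p = p) \<and>
     (\<forall>t\<in>torus2. \<forall>u\<in>torus2. \<forall>p\<in>points M. \<rho> (fst t * fst u, snd t * snd u) p = \<rho> t (\<rho> u p)) \<and>
     smooth_map (algebra_times M) M (\<lambda>(\<xi>, p). \<rho> (torus_exp \<xi>) p)"

definition effective_action ::
    "('a, 'e::euclidean_space) mfd \<Rightarrow> (complex \<times> complex \<Rightarrow> 'a \<Rightarrow> 'a) \<Rightarrow> bool" where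
  "effective_action M \<rho> \<longleftrightarrow> (\<forall>t\<in>torus2. (\<forall>p\<in>points M. \<rho> t p = p) \<longrightarrow> t = (1, 1))"

definition generator ::
    "('a, 'e::euclidean_space) mfd \<Rightarrow> (complex \<times> complex \<Rightarrow> 'a \<Rightarrow> 'a) \<Rightarrow> real \<times> real \<Rightarrow>
     'a \<Rightarrow> ('a, 'e) tangent" where
  "generator M \<rho> \<xi> p = (\<lambda>c. if c \<in> charts_at M p
      then vector_derivative (\<lambda>t. cmap c (\<rho> (torus_exp (t *\<^sub>R \<xi>)) p)) (at 0) else 0)"

definition preserves_structure ::
    "('a, real^6) mfd \<Rightarrow> ('a, real^6) bilinear_field \<Rightarrow> ('a, real^6) endo_field \<Rightarrow>
     ('a, real^6) form \<Rightarrow> ('a, real^6) form \<Rightarrow> (complex \<times> complex \<Rightarrow> 'a \<Rightarrow> 'a) \<Rightarrow> bool" where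
  "preserves_structure M g J psi_re psi_im \<rho> \<longleftrightarrow> (\<forall>t\<in>torus2.
     (\<forall>p\<in>points M. \<forall>X\<in>tangent_space M p. \<forall>Y\<in>tangent_space M p.
        g (\<rho> t p) (differential M M (\<rho> t) p X) (differential M M (\<rho> t) p Y) = g p X Y) \<and>
     (\<forall>p\<in>points M. \<forall>X\<in>tangent_space M p.
        J (\<rho> t p) (differential M M (\<rho> t) p X) = differential M M (\<rho> t) p (J p X)) \<and>
     form_eq M 3 (pullback M M (\<rho> t) psi_re) psi_re \<and>
     form_eq M 3 (pullback M M (\<rho> t) psi_im) psi_im)"

definition orbit :: "(complex \<times> complex \<Rightarrow> 'a \<Rightarrow> 'a) \<Rightarrow> 'a \<Rightarrow> 'a set" where
  "orbit \<rho> p = (\<lambda>t. \<rho> t p) ` torus2"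


section \<open>The multi-moment map and its reductions\<close>

definition multi_moment_map ::
    "('a, 'e) form \<Rightarrow> ('a \<Rightarrow> ('a, 'e) tangent) \<Rightarrow> ('a \<Rightarrow> ('a, 'e) tangent) \<Rightarrow> 'a \<Rightarrow> real" where
  "multi_moment_map \<sigma> U V p = \<sigma> p [U p, V p]"

definition regular_value :: "('a, 'e::euclidean_space) mfd \<Rightarrow> ('a \<Rightarrow> real) \<Rightarrow> real \<Rightarrow> bool" where
  "regular_value M \<nu> s \<longleftrightarrow> s \<in> \<nu> ` points M \<and>
     (\<forall>p\<in>points M. \<nu> p = s \<longrightarrow> (\<exists>X\<in>tangent_space M p. ext_deriv M (fun_form \<nu>) p [X] \<noteq> 0))"

text \<open>The level set as an embedded submanifold; its smooth structure is determined by this.\<close>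

definition level_manifold ::
    "('a, 'e::euclidean_space) mfd \<Rightarrow> ('a \<Rightarrow> real) \<Rightarrow> real \<Rightarrow> ('a, 'f::euclidean_space) mfd \<Rightarrow> bool"
  where
  "level_manifold M \<nu> s N \<longleftrightarrow> smooth_manifold N \<and>
     mspace N = subtopology (mspace M) {p. \<nu> p = s} \<and> immersion N M (\<lambda>p. p)"

text \<open>The orbit space with the quotient topology and the smooth structure for which the projection
  is a submersion; this, too, determines the smooth structure.\<close>

definition quotient_manifold ::
    "('a, 'e::euclidean_space) mfd \<Rightarrow> (complex \<times> complex \<Rightarrow> 'a \<Rightarrow> 'a) \<Rightarrow>
     ('a set, 'f::euclidean_space) mfd \<Rightarrow> bool" where
  "quotient_manifold N \<rho> Q \<longleftrightarrow> smooth_manifold Q \<and>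
     quotient_map (mspace N) (mspace Q) (orbit \<rho>) \<and> submersion N Q (orbit \<rho>)"

text \<open>\<open>\<omega>\<close> is the smooth form on the quotient whose pull-back to \<open>N\<close> is the restriction to \<open>N\<close> of the
  form \<open>\<alpha>\<close> on the ambient manifold \<open>M\<close>.\<close>

definition descends_to ::
    "('a, 'e::euclidean_space) mfd \<Rightarrow> ('a, 'f::euclidean_space) mfd \<Rightarrow>
     (complex \<times> complex \<Rightarrow> 'a \<Rightarrow> 'a) \<Rightarrow> ('a set, 'h::euclidean_space) mfd \<Rightarrow> nat \<Rightarrow>
     ('a, 'e) form \<Rightarrow> ('a set, 'h) form \<Rightarrow> bool" where
  "descends_to M N \<rho> Q k \<alpha> \<omega> \<longleftrightarrow> smooth_form Q k \<omega> \<and>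
     form_eq N k (pullback N Q (orbit \<rho>) \<omega>) (pullback N M (\<lambda>p. p) \<alpha>)"

definition flat :: "('a, 'e) bilinear_field \<Rightarrow> ('a \<Rightarrow> ('a, 'e) tangent) \<Rightarrow> ('a, 'e) form" where
  "flat g X = (\<lambda>p Xs. g p (X p) (Xs ! 0))"

definition hsq ::
    "('a, 'e) bilinear_field \<Rightarrow> ('a \<Rightarrow> ('a, 'e) tangent) \<Rightarrow> ('a \<Rightarrow> ('a, 'e) tangent) \<Rightarrow> 'a \<Rightarrow> real"
  where
  "hsq g U V p = g p (U p) (U p) * g p (V p) (V p) - (g p (U p) (V p))\<^sup>2"

definition theta1 ::
    "('a, 'e) bilinear_field \<Rightarrow> ('a \<Rightarrow> ('a, 'e) tangent) \<Rightarrow> ('a \<Rightarrow> ('a, 'e) tangent) \<Rightarrow> ('a, 'e) form"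
  where
  "theta1 g U V = (\<lambda>p Xs.
     (g p (V p) (V p) * flat g U p Xs - g p (U p) (V p) * flat g V p Xs) / hsq g U V p)"

definition theta2 ::
    "('a, 'e) bilinear_field \<Rightarrow> ('a \<Rightarrow> ('a, 'e) tangent) \<Rightarrow> ('a \<Rightarrow> ('a, 'e) tangent) \<Rightarrow> ('a, 'e) form"
  where
  "theta2 g U V = (\<lambda>p Xs.
     (g p (U p) (U p) * flat g V p Xs - g p (U p) (V p) * flat g U p Xs) / hsq g U V p)"

definition alpha0 ::
    "('a, 'e) form \<Rightarrow> ('a \<Rightarrow> ('a, 'e) tangent) \<Rightarrow> ('a \<Rightarrow> ('a, 'e) tangent) \<Rightarrow> ('a, 'e) form" where
  "alpha0 psi_im U V = contract V (contract U psi_im)"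

definition alpha1 ::
    "('a, 'e) bilinear_field \<Rightarrow> ('a, 'e) endo_field \<Rightarrow> ('a \<Rightarrow> ('a, 'e) tangent) \<Rightarrow>
     ('a \<Rightarrow> ('a, 'e) tangent) \<Rightarrow> real \<Rightarrow> ('a, 'e) form" where
  "alpha1 g J U V s = (\<lambda>p Xs. s * theta1 g U V p Xs + contract V (fundamental_form g J) p Xs)"

definition alpha2 ::
    "('a, 'e) bilinear_field \<Rightarrow> ('a, 'e) endo_field \<Rightarrow> ('a \<Rightarrow> ('a, 'e) tangent) \<Rightarrow>
     ('a \<Rightarrow> ('a, 'e) tangent) \<Rightarrow> real \<Rightarrow> ('a, 'e) form" where
  "alpha2 g J U V s = (\<lambda>p Xs. s * theta2 g U V p Xs - contract U (fundamental_form g J) p Xs)"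

end

theory Submission
  imports Defs
begin

text \<open>
  Cartan's formula and the invariance of the structure under the torus turn the nearly Kaehler
  equations into \<open>d(V \<lrcorner> \<sigma>) = -3 V \<lrcorner> \<psi>\<^sub>+\<close>,
  \<open>d\<alpha>\<^sub>0 = -2 V \<lrcorner> U \<lrcorner> \<sigma>\<^sup>2\<close> and \<open>d(V \<lrcorner> \<psi>\<^sub>-) = 2 V \<lrcorner> \<sigma>\<^sup>2\<close>. Linear algebra in \<open>C\<^sup>3\<close> shows
  that on the kernel of \<open>d\<nu> = 3 \<psi>\<^sub>+(U, V, \<cdot>)\<close> one has
  \<open>s \<sigma> = (U \<lrcorner> \<sigma>) \<and> (V \<lrcorner> \<sigma>) - (f/4) \<alpha>\<^sub>1 \<and> \<alpha>\<^sub>2\<close>, \<open>(V \<lrcorner> \<psi>\<^sub>+) \<and> \<alpha>\<^sub>0 = 0\<close> and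
  \<open>V \<lrcorner> \<psi>\<^sub>- + (\<theta>\<^sub>1 + k \<alpha>\<^sub>1) \<and> \<alpha>\<^sub>0 = 0\<close> with \<open>k = s/(h\<^sup>2 - s\<^sup>2)\<close>, so \<open>f = 4(1 + s k)\<close>. The first identity
  gives \<open>d\<alpha>\<^sub>0\<close>. The last one holds along the whole level set; its exterior derivative there,
  combined with \<open>d\<alpha>\<^sub>1 \<and> \<alpha>\<^sub>0 = s d\<theta>\<^sub>1 \<and> \<alpha>\<^sub>0\<close>, gives the equation for \<open>\<alpha>\<^sub>1\<close>. Replacing
  \<open>(U, V)\<close> by \<open>(V, -U)\<close> preserves \<open>\<nu>\<close>, \<open>h\<^sup>2\<close> and \<open>\<alpha>\<^sub>0\<close> and turns \<open>\<alpha>\<^sub>1\<close> into \<open>\<alpha>\<^sub>2\<close>.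
\<close>

section \<open>Calculus in coordinates\<close>

text \<open>On vectors tangent to the level set \<open>\<psi>\<^sub>+(U, V, \<cdot>)\<close>
  vanishes, so the complex volume form contracted with U and V is i times \<alpha>0. A Cramer
  expansion writes its contraction with V alone as a complex one-form wedge i \<alpha>0; the real
  and imaginary parts are the two identities for V \<lrcorner> \<psi>. The denominator h^2 - s^2 is
  the Hermitian Gram determinant of U and V. The derivative of the last identity closes up by a
  cancellation: as V \<lrcorner> \<sigma> = \<alpha>1 - s \<theta>1, both 2 V \<lrcorner> \<sigma>^2
  and (\<theta>1 + k \<alpha>1) \<and> d\<alpha>0 equal f \<theta>1 \<and> \<alpha>1 \<and>
  \<alpha>2 there, the former after division by s. What remains is d(\<theta>1 + k \<alpha>1) \<and>
  \<alpha>0 = 0, from which d\<theta>1 is eliminated. The identities hold only on vectors tangent to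
  the level set, so they must be pulled back to it before they are differentiated; forms on M and on
  the quotient are likewise compared through their pull-backs to the level set.\<close>

abbreviation D :: "('a::real_normed_vector \<Rightarrow> 'b::real_normed_vector) \<Rightarrow> 'a \<Rightarrow> 'a \<Rightarrow> 'b" where
  "D f x \<equiv> frechet_derivative f (at x)"

lemma D_works: "f differentiable (at x) \<Longrightarrow> (f has_derivative D f x) (at x)"
  by (simp add: frechet_derivative_works)

lemma D_eqI: "(f has_derivative f') (at x) \<Longrightarrow> D f x = f'"
  by (simp add: frechet_derivative_at[symmetric])

lemma smooth_on_differentiable: "smooth_on S f \<Longrightarrow> x \<in> S \<Longrightarrow> f differentiable (at x)"
  unfolding smooth_on_def by (metis Ck_on.simps(2))

lemma smooth_on_D: "smooth_on S f \<Longrightarrow> smooth_on S (\<lambda>x. D f x v)"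
  unfolding smooth_on_def by (metis Ck_on.simps(2))

lemma smooth_on_continuous_on: "smooth_on S f \<Longrightarrow> continuous_on S f"
  unfolding smooth_on_def by (metis Ck_on.simps(1))

section \<open>Symmetry of second derivatives\<close>

lemma second_difference:
  fixes f :: "'a::euclidean_space \<Rightarrow> real"
  assumes ball: "ball x r \<subseteq> S" and f: "\<And>z. z \<in> S \<Longrightarrow> f differentiable (at z)"
    and f2: "\<And>z. z \<in> S \<Longrightarrow> (\<lambda>z. D f z v) differentiable (at z)"
    and t: "t > 0" "t * (norm v + norm w) < r"
  shows "\<exists>y \<in> ball x r. f (x + t *\<^sub>R v + t *\<^sub>R w) - f (x + t *\<^sub>R v) - f (x + t *\<^sub>R w) + f x
    = t * (t * D (\<lambda>z. D f z v) y w)"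
proof -
  have inb: "x + a *\<^sub>R v + b *\<^sub>R w \<in> ball x r" if "0 \<le> a" "a \<le> t" "0 \<le> b" "b \<le> t" for a b
  proof -
    have "norm (a *\<^sub>R v + b *\<^sub>R w) \<le> a * norm v + b * norm w"
      using norm_triangle_ineq[of "a *\<^sub>R v" "b *\<^sub>R w"] that by simp
    also have "\<dots> \<le> t * norm v + t * norm w"
      using that by (intro add_mono mult_right_mono) auto
    finally have "norm (a *\<^sub>R v + b *\<^sub>R w) < r" using t by (simp add: algebra_simps)
    then have "norm (x - (x + a *\<^sub>R v + b *\<^sub>R w)) < r"
      by (metis add.assoc add_diff_cancel_left' norm_minus_commute)
    then show ?thesis by (simp add: dist_norm)
  qed
  have inS: "x + a *\<^sub>R v + b *\<^sub>R w \<in> S" if "0 \<le> a" "a \<le> t" "0 \<le> b" "b \<le> t" for a b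
    using inb[OF that] ball by auto
  have der: "((\<lambda>a. f (x + a *\<^sub>R v + b *\<^sub>R w)) has_real_derivative D f (x + a *\<^sub>R v + b *\<^sub>R w) v) (at a)"
    if "0 \<le> a" "a \<le> t" "0 \<le> b" "b \<le> t" for a b
  proof -
    have "((\<lambda>a. f (x + a *\<^sub>R v + b *\<^sub>R w)) has_derivative
        (\<lambda>h. D f (x + a *\<^sub>R v + b *\<^sub>R w) (h *\<^sub>R v))) (at a)"
      by (rule has_derivative_compose[where g = f])
        (auto intro!: derivative_eq_intros D_works f inS that)
    then show ?thesis
      unfolding has_field_derivative_def
      by (rule has_derivative_eq_rhs)
        (auto simp: linear_scale[OF has_derivative_linear[OF D_works[OF f[OF inS[OF that]]]]])
  qed
  \<comment> \<open>The mean value theorem is applied in direction \<open>v\<close> to the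
    difference of \<open>f\<close> across the step \<open>t\<close> in direction \<open>w\<close>;
    the second application below moves in direction \<open>w\<close>. The term
    \<open>0 *\<^sub>R w\<close> is left unsimplified so that \<open>der\<close> matches with
    \<open>b = 0\<close>.\<close>
  have "\<exists>a>0. a < t \<and> (f (x + t *\<^sub>R v + t *\<^sub>R w) - f (x + t *\<^sub>R v + 0 *\<^sub>R w))
      - (f (x + 0 *\<^sub>R v + t *\<^sub>R w) - f (x + 0 *\<^sub>R v + 0 *\<^sub>R w))
      = (t - 0) * (D f (x + a *\<^sub>R v + t *\<^sub>R w) v - D f (x + a *\<^sub>R v + 0 *\<^sub>R w) v)"
    by (rule MVT2[where f = "\<lambda>a. f (x + a *\<^sub>R v + t *\<^sub>R w) - f (x + a *\<^sub>R v + 0 *\<^sub>R w)"])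
      (use t in \<open>auto intro!: derivative_intros der simp del: scaleR_zero_left\<close>)
  then obtain a where a: "0 < a" "a < t"
    and eq: "f (x + t *\<^sub>R v + t *\<^sub>R w) - f (x + t *\<^sub>R v) - f (x + t *\<^sub>R w) + f x
      = t * (D f (x + a *\<^sub>R v + t *\<^sub>R w) v - D f (x + a *\<^sub>R v + 0 *\<^sub>R w) v)"
    by (auto simp: algebra_simps)
  have der2: "((\<lambda>b. D f (x + a *\<^sub>R v + b *\<^sub>R w) v) has_real_derivative
      D (\<lambda>z. D f z v) (x + a *\<^sub>R v + b *\<^sub>R w) w) (at b)"
    if "0 \<le> b" "b \<le> t" for b
  proof -
    have in': "x + a *\<^sub>R v + b *\<^sub>R w \<in> S" using inS a that by simp
    have "((\<lambda>b. D f (x + a *\<^sub>R v + b *\<^sub>R w) v) has_derivative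
        (\<lambda>h. D (\<lambda>z. D f z v) (x + a *\<^sub>R v + b *\<^sub>R w) (h *\<^sub>R w))) (at b)"
      by (rule has_derivative_compose[where g = "\<lambda>z. D f z v"])
        (auto intro!: derivative_eq_intros D_works f2 in')
    then show ?thesis
      unfolding has_field_derivative_def
      by (rule has_derivative_eq_rhs)
        (auto simp: linear_scale[OF has_derivative_linear[OF D_works[OF f2[OF in']]]])
  qed
  have "\<exists>b>0. b < t \<and> D f (x + a *\<^sub>R v + t *\<^sub>R w) v - D f (x + a *\<^sub>R v + 0 *\<^sub>R w) v
      = (t - 0) * D (\<lambda>z. D f z v) (x + a *\<^sub>R v + b *\<^sub>R w) w"
    by (rule MVT2[where f = "\<lambda>b. D f (x + a *\<^sub>R v + b *\<^sub>R w) v"]) (use t der2 in auto)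
  then obtain b where "0 < b" "b < t" "D f (x + a *\<^sub>R v + t *\<^sub>R w) v - D f (x + a *\<^sub>R v + 0 *\<^sub>R w) v
      = t * D (\<lambda>z. D f z v) (x + a *\<^sub>R v + b *\<^sub>R w) w"
    by auto
  then show ?thesis
    using eq inb[of a b] a by (intro bexI[of _ "x + a *\<^sub>R v + b *\<^sub>R w"]) auto
qed

text \<open>Both iterated derivatives are approximated by the same second difference, which is
  symmetric in \<open>v\<close> and \<open>w\<close>: \<open>second_difference\<close> gives points
  arbitrarily near \<open>x\<close> with \<open>A y1 = B y2\<close>, and continuity of
  \<open>A\<close> and \<open>B\<close> excludes a gap between their values at
  \<open>x\<close>.\<close>

lemma symmetric_D_real:
  fixes f :: "'a::euclidean_space \<Rightarrow> real"
  assumes "smooth_on S f" "open S" "x \<in> S"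
  shows "D (\<lambda>z. D f z v) x w = D (\<lambda>z. D f z w) x v"
proof (rule ccontr)
  define A where "A = (\<lambda>y. D (\<lambda>z. D f z v) y w)"
  define B where "B = (\<lambda>y. D (\<lambda>z. D f z w) y v)"
  define e where "e = \<bar>A x - B x\<bar> / 2"
  assume "\<not> ?thesis"
  then have "e > 0" by (simp add: A_def B_def e_def)
  have "continuous_on S A" "continuous_on S B"
    unfolding A_def B_def by (intro smooth_on_continuous_on smooth_on_D assms)+
  then have "isCont A x" "isCont B x"
    using assms by (auto simp: continuous_on_eq_continuous_at)
  then obtain r1 r2 where r: "r1 > 0" "r2 > 0" "\<And>y. dist y x < r1 \<Longrightarrow> dist (A y) (A x) < e"
    "\<And>y. dist y x < r2 \<Longrightarrow> dist (B y) (B x) < e"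
    using \<open>e > 0\<close> unfolding continuous_at_eps_delta by metis
  obtain r3 where r3: "r3 > 0" "ball x r3 \<subseteq> S"
    using assms open_contains_ball by blast
  define r where "r = min r3 (min r1 r2)"
  have "r > 0" "ball x r \<subseteq> S" using r r3 by (auto simp: r_def)
  \<comment> \<open>The summand 1 keeps the denominator positive when \<open>v\<close> and
    \<open>w\<close> both vanish and makes the bound on \<open>t * (norm v + norm w)\<close>
    strict.\<close>
  define t where "t = r / (norm v + norm w + 1)"
  have t: "t > 0" "t * (norm v + norm w) < r"
    using \<open>r > 0\<close> by (auto simp: t_def field_simps add_pos_nonneg add_nonneg_pos)
  have tt: "t * (norm w + norm v) < r" using t by (simp add: add.commute)
  have f: "\<And>z. z \<in> S \<Longrightarrow> f differentiable (at z)"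
    "\<And>v z. z \<in> S \<Longrightarrow> (\<lambda>z. D f z v) differentiable (at z)"
    using assms smooth_on_D smooth_on_differentiable by blast+
  obtain y1 where y1: "y1 \<in> ball x r"
    "f (x + t *\<^sub>R v + t *\<^sub>R w) - f (x + t *\<^sub>R v) - f (x + t *\<^sub>R w) + f x = t * (t * A y1)"
    unfolding A_def
    using second_difference[OF \<open>ball x r \<subseteq> S\<close> f t] by auto
  obtain y2 where y2: "y2 \<in> ball x r"
    "f (x + t *\<^sub>R w + t *\<^sub>R v) - f (x + t *\<^sub>R w) - f (x + t *\<^sub>R v) + f x = t * (t * B y2)"
    unfolding B_def
    using second_difference[OF \<open>ball x r \<subseteq> S\<close> f t(1) tt] by auto
  have "t * (t * A y1) = t * (t * B y2)"
    using y1(2) y2(2) by (simp add: algebra_simps)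
  then have "A y1 = B y2" using t by simp
  moreover have "dist (A y1) (A x) < e" "dist (B y2) (B x) < e"
    using y1(1) y2(1) by (auto simp: r_def dist_commute[of x] intro!: r(3,4))
  ultimately show False by (auto simp: e_def dist_real_def abs_if split: if_splits)
qed

lemma D_inner:
  "f differentiable (at z) \<Longrightarrow> D (\<lambda>z. f z \<bullet> b) z v = D f z v \<bullet> b"
  by (subst D_eqI[OF has_derivative_inner_left[OF D_works]]) auto

text \<open>Because \<open>S\<close> is open, \<open>f\<close> and \<open>g\<close> agree near each
  of its points and so have the same full derivative \<open>at x\<close>, to which the induction
  passes. This allows a map to be replaced by a formula that holds only on \<open>S\<close>.\<close>

lemma Ck_on_cong:
  assumes "open S" "Ck_on k S f" "\<And>x. x \<in> S \<Longrightarrow> f x = g x"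
  shows "Ck_on k S g"
  using assms(2,3)
proof (induction k arbitrary: f g)
  case 0
  then show ?case by (metis Ck_on.simps(1) continuous_on_cong)
next
  case (Suc k)
  have "g differentiable (at x) \<and> D f x = D g x" if "x \<in> S" for x
  proof -
    have "(g has_derivative D f x) (at x)"
      using Suc.prems that
      by (intro has_derivative_transform_within_open[OF D_works assms(1) that]) auto
    then show ?thesis
      using D_eqI differentiableI by metis
  qed
  then show ?case using Suc.prems Suc.IH[of "\<lambda>x. D f x v" "\<lambda>x. D g x v" for v]
    by auto
qed

lemma smooth_on_inner:
  assumes "smooth_on S f" "open S"
  shows "smooth_on S (\<lambda>z. f z \<bullet> b)"
proof -
  have "Ck_on k S (\<lambda>z. f z \<bullet> b)" if "smooth_on S f" for k f
    using that
  proof (induction k arbitrary: f)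
    case 0
    then show ?case
      using smooth_on_continuous_on continuous_on_inner continuous_on_const by fastforce
  next
    case (Suc k)
    have "Ck_on k S (\<lambda>x. D f x v \<bullet> b)" for v
      by (rule Suc.IH[OF smooth_on_D[OF Suc.prems]])
    then have "Ck_on k S (\<lambda>x. D (\<lambda>z. f z \<bullet> b) x v)" for v
      by (rule Ck_on_cong[OF assms(2)])
        (simp add: D_inner smooth_on_differentiable[OF Suc.prems])
    moreover have "(\<lambda>z. f z \<bullet> b) differentiable (at x)" if "x \<in> S" for x
      using has_derivative_inner_left[OF D_works[OF smooth_on_differentiable[OF Suc.prems that]]]
        differentiableI by blast
    ultimately show ?case by simp
  qed
  with assms show ?thesis by (simp add: smooth_on_def)
qed

lemma symmetric_D:
  fixes f :: "'a::euclidean_space \<Rightarrow> 'b::euclidean_space"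
  assumes "smooth_on S f" "open S" "x \<in> S"
  shows "D (\<lambda>z. D f z v) x w = D (\<lambda>z. D f z w) x v"
proof (rule euclidean_eqI)
  fix b :: 'b
  have *: "D (\<lambda>z. D f z v) x w \<bullet> b = D (\<lambda>z. D (\<lambda>z. f z \<bullet> b) z v) x w" for v w
  proof -
    have "((\<lambda>z. D f z v \<bullet> b) has_derivative (\<lambda>w. D (\<lambda>z. D f z v) x w \<bullet> b)) (at x)"
      by (rule has_derivative_inner_left[OF D_works[OF smooth_on_differentiable[OF smooth_on_D[OF assms(1)] assms(3)]]])
    then have "((\<lambda>z. D (\<lambda>z. f z \<bullet> b) z v) has_derivative (\<lambda>w. D (\<lambda>z. D f z v) x w \<bullet> b)) (at x)"
      by (rule has_derivative_transform_within_open[OF _ assms(2,3)])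
        (simp add: D_inner smooth_on_differentiable[OF assms(1)])
    then show ?thesis using D_eqI by metis
  qed
  show "D (\<lambda>z. D f z v) x w \<bullet> b = D (\<lambda>z. D f z w) x v \<bullet> b"
    unfolding *[of v w] *[of w v] using assms by (blast intro: symmetric_D_real smooth_on_inner)
qed

text \<open>Differentiability is assumed only for fixed arguments of the form; expanding the moving
  argument in the finite basis reduces the claim to the product rule. Linearity is asked for only
  near \<open>z0\<close>, since coordinate expressions are meaningful only on the image of a
  chart.\<close>

lemma linear_slot_has_derivative:
  fixes \<omega> :: "'a::real_normed_vector \<Rightarrow> 'b::euclidean_space \<Rightarrow> 'c::real_normed_vector"
  assumes ev: "\<forall>\<^sub>F z in nhds z0. linear (\<omega> z)"
    and d: "\<And>x. ((\<lambda>z. \<omega> z x) has_derivative \<omega>' x) (at z0)"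
    and X: "(X has_derivative X') (at z0)"
  shows "((\<lambda>z. \<omega> z (X z)) has_derivative (\<lambda>h. \<omega>' (X z0) h + \<omega> z0 (X' h))) (at z0)"
proof -
  have lin: "linear (\<omega> z0)" using ev by (rule eventually_nhds_x_imp_x)
  have sum: "\<omega> z x = (\<Sum>b\<in>Basis. (x \<bullet> b) *\<^sub>R \<omega> z b)" if "linear (\<omega> z)" for z x
    using linear_sum[OF that, of "\<lambda>b. (x \<bullet> b) *\<^sub>R b" Basis]
    by (simp add: euclidean_representation linear_scale[OF that])
  \<comment> \<open>The maps \<open>\<omega>' x\<close> for different \<open>x\<close> are a priori
    unrelated; uniqueness of derivatives makes them linear in \<open>x\<close>.\<close>
  have "((\<lambda>z. \<omega> z x) has_derivative (\<lambda>h. \<Sum>b\<in>Basis. (x \<bullet> b) *\<^sub>R \<omega>' b h)) (at z0)" for x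
  proof -
    have "((\<lambda>z. \<Sum>b\<in>Basis. (x \<bullet> b) *\<^sub>R \<omega> z b) has_derivative
        (\<lambda>h. \<Sum>b\<in>Basis. (x \<bullet> b) *\<^sub>R \<omega>' b h)) (at z0)"
      by (intro has_derivative_sum has_derivative_scaleR_right d)
    moreover have "\<forall>\<^sub>F z in at z0. (\<Sum>b\<in>Basis. (x \<bullet> b) *\<^sub>R \<omega> z b) = \<omega> z x"
      using ev unfolding eventually_at_filter by (rule eventually_mono) (simp add: sum[symmetric])
    ultimately show ?thesis
      by (rule has_derivative_transform_eventually) (simp_all add: sum[OF lin, of x])
  qed
  then have \<omega>': "\<omega>' x = (\<lambda>h. \<Sum>b\<in>Basis. (x \<bullet> b) *\<^sub>R \<omega>' b h)" for x
    using has_derivative_unique d by blast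
  have "((\<lambda>z. \<Sum>b\<in>Basis. (X z \<bullet> b) *\<^sub>R \<omega> z b) has_derivative
      (\<lambda>h. \<Sum>b\<in>Basis. (X z0 \<bullet> b) *\<^sub>R \<omega>' b h + (X' h \<bullet> b) *\<^sub>R \<omega> z0 b)) (at z0)"
    by (intro has_derivative_sum has_derivative_scaleR has_derivative_inner_left d X)
  moreover have "(\<Sum>b\<in>Basis. (X z0 \<bullet> b) *\<^sub>R \<omega>' b h + (X' h \<bullet> b) *\<^sub>R \<omega> z0 b)
      = \<omega>' (X z0) h + \<omega> z0 (X' h)" for h
    using fun_cong[OF \<omega>'[of "X z0"], of h] sum[OF lin, of "X' h"] by (simp add: sum.distrib)
  ultimately have "((\<lambda>z. \<Sum>b\<in>Basis. (X z \<bullet> b) *\<^sub>R \<omega> z b) has_derivative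
      (\<lambda>h. \<omega>' (X z0) h + \<omega> z0 (X' h))) (at z0)" by simp
  then show ?thesis
  proof (rule has_derivative_transform_eventually)
    show "\<forall>\<^sub>F z in at z0. (\<Sum>b\<in>Basis. (X z \<bullet> b) *\<^sub>R \<omega> z b) = \<omega> z (X z)"
      using ev unfolding eventually_at_filter by (rule eventually_mono) (simp add: sum[symmetric])
  qed (rule sum[OF lin, symmetric], simp)
qed

text \<open>These predicates describe germs of forms: \<open>in_chart\<close> is known to be linear
  only over the image of the chart, so the algebraic conditions are required near the point, and
  differentiability only at the point where one exterior derivative is taken.\<close>

definition form1_at :: "'a::euclidean_space \<Rightarrow> ('a \<Rightarrow> 'a \<Rightarrow> real) \<Rightarrow> bool" where
  "form1_at z0 \<omega> \<longleftrightarrow> (\<forall>\<^sub>F z in nhds z0. linear (\<omega> z)) \<and> (\<forall>x. (\<lambda>z. \<omega> z x) differentiable (at z0))"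

definition form2_at :: "'a::euclidean_space \<Rightarrow> ('a \<Rightarrow> 'a \<Rightarrow> 'a \<Rightarrow> real) \<Rightarrow> bool" where
  "form2_at z0 \<omega> \<longleftrightarrow>
     (\<forall>\<^sub>F z in nhds z0. (\<forall>y. linear (\<lambda>x. \<omega> z x y)) \<and> (\<forall>x. linear (\<omega> z x)) \<and> (\<forall>x. \<omega> z x x = 0)) \<and>
     (\<forall>x y. (\<lambda>z. \<omega> z x y) differentiable (at z0))"

definition form3_at :: "'a::euclidean_space \<Rightarrow> ('a \<Rightarrow> 'a \<Rightarrow> 'a \<Rightarrow> 'a \<Rightarrow> real) \<Rightarrow> bool" where
  "form3_at z0 \<omega> \<longleftrightarrow>
     (\<forall>\<^sub>F z in nhds z0. (\<forall>y w. linear (\<lambda>x. \<omega> z x y w)) \<and> (\<forall>x w. linear (\<lambda>y. \<omega> z x y w)) \<and>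
        (\<forall>x y. linear (\<omega> z x y)) \<and>
        (\<forall>x y. \<omega> z x x y = 0 \<and> \<omega> z x y y = 0 \<and> \<omega> z x y x = 0)) \<and>
     (\<forall>x y w. (\<lambda>z. \<omega> z x y w) differentiable (at z0))"

definition ed1 :: "('a::euclidean_space \<Rightarrow> 'a \<Rightarrow> real) \<Rightarrow> 'a \<Rightarrow> 'a \<Rightarrow> 'a \<Rightarrow> real" where
  "ed1 \<omega> z x y = D (\<lambda>z. \<omega> z y) z x - D (\<lambda>z. \<omega> z x) z y"

definition ed2 :: "('a::euclidean_space \<Rightarrow> 'a \<Rightarrow> 'a \<Rightarrow> real) \<Rightarrow> 'a \<Rightarrow> 'a \<Rightarrow> 'a \<Rightarrow> 'a \<Rightarrow> real" where
  "ed2 \<omega> z x y w = D (\<lambda>z. \<omega> z y w) z x - D (\<lambda>z. \<omega> z x w) z y + D (\<lambda>z. \<omega> z x y) z w"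

definition ed3 :: "('a::euclidean_space \<Rightarrow> 'a \<Rightarrow> 'a \<Rightarrow> 'a \<Rightarrow> real) \<Rightarrow>
    'a \<Rightarrow> 'a \<Rightarrow> 'a \<Rightarrow> 'a \<Rightarrow> 'a \<Rightarrow> real" where
  "ed3 \<omega> z x y w t = D (\<lambda>z. \<omega> z y w t) z x - D (\<lambda>z. \<omega> z x w t) z y
     + D (\<lambda>z. \<omega> z x y t) z w - D (\<lambda>z. \<omega> z x y w) z t"

lemma antisymmetric_from_alternating:
  fixes B :: "'a::real_vector \<Rightarrow> 'a \<Rightarrow> real"
  assumes "\<And>y. linear (\<lambda>x. B x y)" "\<And>x. linear (B x)" "\<And>x. B x x = 0"
  shows "B x y = - B y x"
proof -
  have "B (x + y) (x + y) = B x x + B x y + B y x + B y y"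
    by (simp add: linear_add[OF assms(1)] linear_add[OF assms(2)])
  then show ?thesis by (simp add: assms(3))
qed

lemma eventually_nhds_compose:
  assumes "\<forall>\<^sub>F z in nhds (\<phi> w0). P z" "(\<phi> has_derivative \<phi>') (at w0)"
  shows "\<forall>\<^sub>F w in nhds w0. P (\<phi> w)"
proof -
  have "isCont \<phi> w0" using assms(2) has_derivative_continuous by blast
  then have "filterlim \<phi> (nhds (\<phi> w0)) (nhds w0)"
    by (simp add: isCont_def tendsto_at_iff_tendsto_nhds)
  then show ?thesis using assms(1) by (simp add: filterlim_iff)
qed

section \<open>Derivatives of forms evaluated along moving points and vectors\<close>

lemma form1_compose:
  fixes \<phi> :: "'w::real_normed_vector \<Rightarrow> 'a::euclidean_space"
  assumes \<omega>: "form1_at (\<phi> w0) \<omega>" and \<phi>: "(\<phi> has_derivative \<phi>') (at w0)"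
    and X: "(X has_derivative X') (at w0)"
  shows "((\<lambda>w. \<omega> (\<phi> w) (X w)) has_derivative
    (\<lambda>h. D (\<lambda>z. \<omega> z (X w0)) (\<phi> w0) (\<phi>' h) + \<omega> (\<phi> w0) (X' h))) (at w0)"
proof (rule linear_slot_has_derivative[OF _ _ X])
  show "\<forall>\<^sub>F w in nhds w0. linear (\<omega> (\<phi> w))"
    by (rule eventually_nhds_compose[OF _ \<phi>, where P = "\<lambda>z. linear (\<omega> z)"])
      (use \<omega> in \<open>simp add: form1_at_def\<close>)
  show "((\<lambda>w. \<omega> (\<phi> w) x) has_derivative (\<lambda>h. D (\<lambda>z. \<omega> z x) (\<phi> w0) (\<phi>' h))) (at w0)" for x
    using \<omega> by (intro has_derivative_compose[OF \<phi> D_works]) (auto simp: form1_at_def)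
qed

lemma form2_compose:
  fixes \<phi> :: "'w::real_normed_vector \<Rightarrow> 'a::euclidean_space"
  assumes \<omega>: "form2_at (\<phi> w0) \<omega>" and \<phi>: "(\<phi> has_derivative \<phi>') (at w0)"
    and X: "(X has_derivative X') (at w0)" and Y: "(Y has_derivative Y') (at w0)"
  shows "((\<lambda>w. \<omega> (\<phi> w) (X w) (Y w)) has_derivative
    (\<lambda>h. D (\<lambda>z. \<omega> z (X w0) (Y w0)) (\<phi> w0) (\<phi>' h) + \<omega> (\<phi> w0) (X' h) (Y w0)
      + \<omega> (\<phi> w0) (X w0) (Y' h))) (at w0)"
proof (rule linear_slot_has_derivative[OF _ _ Y])
  have ev: "\<forall>\<^sub>F z in nhds (\<phi> w0). (\<forall>y. linear (\<lambda>x. \<omega> z x y)) \<and> (\<forall>x. linear (\<omega> z x))"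
    using \<omega> by (auto simp: form2_at_def elim: eventually_mono)
  note ev' = eventually_nhds_compose[OF ev \<phi>]
  show "\<forall>\<^sub>F w in nhds w0. linear (\<omega> (\<phi> w) (X w))"
    using ev' by (auto elim: eventually_mono)
  show "((\<lambda>w. \<omega> (\<phi> w) (X w) y) has_derivative
      (\<lambda>h. D (\<lambda>z. \<omega> z (X w0) y) (\<phi> w0) (\<phi>' h) + \<omega> (\<phi> w0) (X' h) y)) (at w0)" for y
  proof (rule linear_slot_has_derivative[OF _ _ X, where \<omega> = "\<lambda>w x. \<omega> (\<phi> w) x y"])
    show "\<forall>\<^sub>F w in nhds w0. linear (\<lambda>x. \<omega> (\<phi> w) x y)"
      using ev' by (auto elim: eventually_mono)
    show "((\<lambda>w. \<omega> (\<phi> w) x y) has_derivative (\<lambda>h. D (\<lambda>z. \<omega> z x y) (\<phi> w0) (\<phi>' h))) (at w0)" for x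
      using \<omega> by (intro has_derivative_compose[OF \<phi> D_works]) (auto simp: form2_at_def)
  qed
qed

lemma form3_compose:
  fixes \<phi> :: "'w::real_normed_vector \<Rightarrow> 'a::euclidean_space"
  assumes \<omega>: "form3_at (\<phi> w0) \<omega>" and \<phi>: "(\<phi> has_derivative \<phi>') (at w0)"
    and X: "(X has_derivative X') (at w0)" and Y: "(Y has_derivative Y') (at w0)"
    and Z: "(Z has_derivative Z') (at w0)"
  shows "((\<lambda>w. \<omega> (\<phi> w) (X w) (Y w) (Z w)) has_derivative
    (\<lambda>h. D (\<lambda>z. \<omega> z (X w0) (Y w0) (Z w0)) (\<phi> w0) (\<phi>' h) + \<omega> (\<phi> w0) (X' h) (Y w0) (Z w0)
      + \<omega> (\<phi> w0) (X w0) (Y' h) (Z w0) + \<omega> (\<phi> w0) (X w0) (Y w0) (Z' h))) (at w0)"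
proof (rule linear_slot_has_derivative[OF _ _ Z])
  have ev: "\<forall>\<^sub>F z in nhds (\<phi> w0). (\<forall>y w. linear (\<lambda>x. \<omega> z x y w)) \<and>
      (\<forall>x w. linear (\<lambda>y. \<omega> z x y w)) \<and> (\<forall>x y. linear (\<omega> z x y))"
    using \<omega> by (auto simp: form3_at_def elim: eventually_mono)
  note ev' = eventually_nhds_compose[OF ev \<phi>]
  show "\<forall>\<^sub>F w in nhds w0. linear (\<omega> (\<phi> w) (X w) (Y w))"
    using ev' by (auto elim: eventually_mono)
  show "((\<lambda>w. \<omega> (\<phi> w) (X w) (Y w) t) has_derivative
      (\<lambda>h. D (\<lambda>z. \<omega> z (X w0) (Y w0) t) (\<phi> w0) (\<phi>' h) + \<omega> (\<phi> w0) (X' h) (Y w0) t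
        + \<omega> (\<phi> w0) (X w0) (Y' h) t)) (at w0)" for t
  proof (rule linear_slot_has_derivative[OF _ _ Y, where \<omega> = "\<lambda>w y. \<omega> (\<phi> w) (X w) y t"])
    show "\<forall>\<^sub>F w in nhds w0. linear (\<lambda>y. \<omega> (\<phi> w) (X w) y t)"
      using ev' by (auto elim: eventually_mono)
    show "((\<lambda>w. \<omega> (\<phi> w) (X w) y t) has_derivative
        (\<lambda>h. D (\<lambda>z. \<omega> z (X w0) y t) (\<phi> w0) (\<phi>' h) + \<omega> (\<phi> w0) (X' h) y t)) (at w0)" for y
    proof (rule linear_slot_has_derivative[OF _ _ X, where \<omega> = "\<lambda>w x. \<omega> (\<phi> w) x y t"])
      show "\<forall>\<^sub>F w in nhds w0. linear (\<lambda>x. \<omega> (\<phi> w) x y t)"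
        using ev' by (auto elim: eventually_mono)
      show "((\<lambda>w. \<omega> (\<phi> w) x y t) has_derivative (\<lambda>h. D (\<lambda>z. \<omega> z x y t) (\<phi> w0) (\<phi>' h))) (at w0)"
        for x
        using \<omega> by (intro has_derivative_compose[OF \<phi> D_works]) (auto simp: form3_at_def)
    qed
  qed
qed

lemmas form1_D = form1_compose[where \<phi> = "\<lambda>z. z", OF _ has_derivative_ident]
lemmas form2_D = form2_compose[where \<phi> = "\<lambda>z. z", OF _ has_derivative_ident]
lemmas form3_D = form3_compose[where \<phi> = "\<lambda>z. z", OF _ has_derivative_ident]

lemma form2_atD:
  assumes "form2_at z0 \<omega>"
  shows "linear (\<lambda>x. \<omega> z0 x y)" "linear (\<omega> z0 x)" "\<omega> z0 x x = 0" "\<omega> z0 x y = - \<omega> z0 y x"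
proof -
  have *: "(\<forall>y. linear (\<lambda>x. \<omega> z0 x y)) \<and> (\<forall>x. linear (\<omega> z0 x)) \<and> (\<forall>x. \<omega> z0 x x = 0)"
    using assms eventually_nhds_x_imp_x unfolding form2_at_def by fast
  then show "linear (\<lambda>x. \<omega> z0 x y)" "linear (\<omega> z0 x)" "\<omega> z0 x x = 0" by auto
  show "\<omega> z0 x y = - \<omega> z0 y x" by (rule antisymmetric_from_alternating) (use * in auto)
qed

lemma form3_atD:
  assumes "form3_at z0 \<omega>"
  shows "linear (\<lambda>x. \<omega> z0 x y w)" "linear (\<lambda>y. \<omega> z0 x y w)" "linear (\<omega> z0 x y)"
    "\<omega> z0 x y w = - \<omega> z0 y x w" "\<omega> z0 x y w = - \<omega> z0 x w y"
    "\<omega> z0 x x y = 0" "\<omega> z0 x y y = 0" "\<omega> z0 x y x = 0"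
proof -
  have *: "(\<forall>y w. linear (\<lambda>x. \<omega> z0 x y w)) \<and> (\<forall>x w. linear (\<lambda>y. \<omega> z0 x y w)) \<and>
        (\<forall>x y. linear (\<omega> z0 x y)) \<and>
        (\<forall>x y. \<omega> z0 x x y = 0 \<and> \<omega> z0 x y y = 0 \<and> \<omega> z0 x y x = 0)"
    using assms eventually_nhds_x_imp_x unfolding form3_at_def by fast
  then show "linear (\<lambda>x. \<omega> z0 x y w)" "linear (\<lambda>y. \<omega> z0 x y w)" "linear (\<omega> z0 x y)"
    "\<omega> z0 x x y = 0" "\<omega> z0 x y y = 0" "\<omega> z0 x y x = 0" by auto
  show "\<omega> z0 x y w = - \<omega> z0 y x w"
    by (rule antisymmetric_from_alternating[where B = "\<lambda>x y. \<omega> z0 x y w"]) (use * in auto)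
  show "\<omega> z0 x y w = - \<omega> z0 x w y"
    by (rule antisymmetric_from_alternating) (use * in auto)
qed

lemma form1_at_contract:
  assumes "form2_at z0 \<omega>" "X differentiable (at z0)"
  shows "form1_at z0 (\<lambda>z. \<omega> z (X z))"
  unfolding form1_at_def
proof safe
  show "\<forall>\<^sub>F z in nhds z0. linear (\<omega> z (X z))"
    using assms(1) by (auto simp: form2_at_def elim: eventually_mono)
  show "(\<lambda>z. \<omega> z (X z) y) differentiable (at z0)" for y
    by (rule differentiableI, rule form2_D[OF assms(1) D_works[OF assms(2)] has_derivative_const])
qed

lemma form2_at_contract:
  assumes "form3_at z0 \<omega>" "X differentiable (at z0)"
  shows "form2_at z0 (\<lambda>z. \<omega> z (X z))"
  unfolding form2_at_def
proof safe
  show "\<forall>\<^sub>F z in nhds z0. (\<forall>y. linear (\<lambda>x. \<omega> z (X z) x y)) \<and> (\<forall>x. linear (\<omega> z (X z) x)) \<and>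
      (\<forall>x. \<omega> z (X z) x x = 0)"
    using assms(1) by (auto simp: form3_at_def elim: eventually_mono)
  show "(\<lambda>z. \<omega> z (X z) x y) differentiable (at z0)" for x y
    by (rule differentiableI, rule form3_D[OF assms(1) D_works[OF assms(2)]
          has_derivative_const has_derivative_const])
qed

lemma form1_at_add:
  assumes "form1_at z0 a" "form1_at z0 b"
  shows "form1_at z0 (\<lambda>z x. a z x + b z x)"
proof -
  have "\<forall>\<^sub>F z in nhds z0. linear (a z)" "\<forall>\<^sub>F z in nhds z0. linear (b z)"
    using assms by (auto simp: form1_at_def)
  then have "\<forall>\<^sub>F z in nhds z0. linear (\<lambda>x. a z x + b z x)"
    by (rule eventually_elim2) (rule linear_compose_add)
  then show ?thesis using assms unfolding form1_at_def by (auto intro: differentiable_add)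
qed

lemma form1_at_scale:
  assumes "k differentiable (at z0)" "form1_at z0 a"
  shows "form1_at z0 (\<lambda>z x. k z * a z x)"
proof -
  have "linear (\<lambda>x. k z * a z x)" if "linear (a z)" for z
    using linear_compose_scale_right[OF that] by simp
  then show ?thesis
    using assms unfolding form1_at_def by (auto intro: differentiable_mult elim: eventually_mono)
qed

lemma form1_atD: "form1_at z0 a \<Longrightarrow> (\<lambda>z. a z x) differentiable (at z0)" "form1_at z0 a \<Longrightarrow> linear (a z0)"
  unfolding form1_at_def by (auto dest: eventually_nhds_x_imp_x)

lemma form2_at_wedge:
  assumes "form1_at z0 a" "form1_at z0 b"
  shows "form2_at z0 (\<lambda>z x y. a z x * b z y - a z y * b z x)"
  unfolding form2_at_def
proof safe
  have *: "linear (\<lambda>x. a z x * b z y - a z y * b z x)" "linear (\<lambda>y. a z x * b z y - a z y * b z x)"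
    if "linear (a z)" "linear (b z)" for z x y
    using linear_add[OF that(1)] linear_add[OF that(2)] linear_scale[OF that(1)] linear_scale[OF that(2)]
    by (auto intro!: linearI simp: algebra_simps)
  have "\<forall>\<^sub>F z in nhds z0. linear (a z)" "\<forall>\<^sub>F z in nhds z0. linear (b z)"
    using assms by (auto simp: form1_at_def)
  then show "\<forall>\<^sub>F z in nhds z0. (\<forall>y. linear (\<lambda>x. a z x * b z y - a z y * b z x)) \<and>
      (\<forall>x. linear (\<lambda>y. a z x * b z y - a z y * b z x)) \<and> (\<forall>x. a z x * b z x - a z x * b z x = 0)"
    by (rule eventually_elim2) (auto intro: *)
  show "(\<lambda>z. a z x * b z y - a z y * b z x) differentiable (at z0)" for x y
    by (intro differentiable_diff differentiable_mult form1_atD assms)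
qed

lemma form2_at_add:
  assumes "form2_at z0 a" "form2_at z0 b"
  shows "form2_at z0 (\<lambda>z x y. a z x y + b z x y)"
proof -
  have "\<forall>\<^sub>F z in nhds z0. (\<forall>y. linear (\<lambda>x. a z x y)) \<and> (\<forall>x. linear (a z x)) \<and> (\<forall>x. a z x x = 0)"
    "\<forall>\<^sub>F z in nhds z0. (\<forall>y. linear (\<lambda>x. b z x y)) \<and> (\<forall>x. linear (b z x)) \<and> (\<forall>x. b z x x = 0)"
    using assms by (auto simp: form2_at_def)
  then have "\<forall>\<^sub>F z in nhds z0. (\<forall>y. linear (\<lambda>x. a z x y + b z x y)) \<and>
      (\<forall>x. linear (\<lambda>y. a z x y + b z x y)) \<and> (\<forall>x. a z x x + b z x x = 0)"
    by (rule eventually_elim2) (auto intro: linear_compose_add)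
  then show ?thesis using assms unfolding form2_at_def by (auto intro: differentiable_add)
qed

section \<open>Sum and product rules for the coordinate exterior derivative\<close>

lemma D_add:
  fixes a b :: "'a::euclidean_space \<Rightarrow> real"
  assumes "a differentiable (at z)" "b differentiable (at z)"
  shows "D (\<lambda>z. a z + b z) z h = D a z h + D b z h"
  by (rule fun_cong[OF D_eqI[OF has_derivative_add[OF D_works[OF assms(1)] D_works[OF assms(2)]]]])

lemma D_diff:
  fixes a b :: "'a::euclidean_space \<Rightarrow> real"
  assumes "a differentiable (at z)" "b differentiable (at z)"
  shows "D (\<lambda>z. a z - b z) z h = D a z h - D b z h"
  by (rule fun_cong[OF D_eqI[OF has_derivative_diff[OF D_works[OF assms(1)] D_works[OF assms(2)]]]])

lemma D_mult:
  fixes a b :: "'a::euclidean_space \<Rightarrow> real"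
  assumes "a differentiable (at z)" "b differentiable (at z)"
  shows "D (\<lambda>z. a z * b z) z h = a z * D b z h + D a z h * b z"
  by (rule fun_cong[OF D_eqI[OF has_derivative_mult[OF D_works[OF assms(1)] D_works[OF assms(2)]]]])

lemma ed1_add:
  assumes "form1_at z0 a" "form1_at z0 b"
  shows "ed1 (\<lambda>z x. a z x + b z x) z0 x y = ed1 a z0 x y + ed1 b z0 x y"
  unfolding ed1_def D_add[OF form1_atD(1)[OF assms(1)] form1_atD(1)[OF assms(2)]] by linarith

lemma ed1_scale:
  assumes "k differentiable (at z0)" "form1_at z0 a"
  shows "ed1 (\<lambda>z x. k z * a z x) z0 x y = D k z0 x * a z0 y - D k z0 y * a z0 x + k z0 * ed1 a z0 x y"
  unfolding ed1_def D_mult[OF assms(1) form1_atD(1)[OF assms(2)]] by algebra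

lemma ed2_add:
  assumes "form2_at z0 a" "form2_at z0 b"
  shows "ed2 (\<lambda>z x y. a z x y + b z x y) z0 x y w = ed2 a z0 x y w + ed2 b z0 x y w"
proof -
  have "(\<lambda>z. a z x y) differentiable (at z0)" "(\<lambda>z. b z x y) differentiable (at z0)" for x y
    using assms by (auto simp: form2_at_def)
  then show ?thesis by (simp add: ed2_def D_add)
qed

lemma ed2_wedge:
  assumes "form1_at z0 a" "form1_at z0 b"
  shows "ed2 (\<lambda>z x y. a z x * b z y - a z y * b z x) z0 x y w =
    (ed1 a z0 x y * b z0 w - ed1 a z0 x w * b z0 y + ed1 a z0 y w * b z0 x)
    - (a z0 x * ed1 b z0 y w - a z0 y * ed1 b z0 x w + a z0 w * ed1 b z0 x y)"
proof -
  have e: "D (\<lambda>z. a z x * b z y - a z y * b z x) z0 w = (a z0 x * D (\<lambda>z. b z y) z0 w + D (\<lambda>z. a z x) z0 w * b z0 y)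
      - (a z0 y * D (\<lambda>z. b z x) z0 w + D (\<lambda>z. a z y) z0 w * b z0 x)" for x y w
    by (simp only: D_diff D_mult differentiable_mult form1_atD(1)[OF assms(1)] form1_atD(1)[OF assms(2)])
  show ?thesis unfolding ed2_def ed1_def e by algebra
qed

text \<open>Pulling back commutes with the exterior derivative because second derivatives are symmetric.\<close>

lemma ed1_pullback:
  fixes \<phi> :: "'w::euclidean_space \<Rightarrow> 'a::euclidean_space"
  assumes \<phi>: "smooth_on T \<phi>" "open T" "w0 \<in> T" and \<omega>: "form1_at (\<phi> w0) \<omega>"
  shows "ed1 (\<lambda>w x. \<omega> (\<phi> w) (D \<phi> w x)) w0 x y = ed1 \<omega> (\<phi> w0) (D \<phi> w0 x) (D \<phi> w0 y)"
proof -
  have d: "(\<phi> has_derivative D \<phi> w0) (at w0)"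
    by (intro D_works smooth_on_differentiable[OF \<phi>(1,3)])
  have d2: "((\<lambda>w. D \<phi> w x) has_derivative D (\<lambda>w. D \<phi> w x) w0) (at w0)" for x
    by (intro D_works smooth_on_differentiable[OF smooth_on_D[OF \<phi>(1)] \<phi>(3)])
  have e: "D (\<lambda>w. \<omega> (\<phi> w) (D \<phi> w x)) w0 h =
      D (\<lambda>z. \<omega> z (D \<phi> w0 x)) (\<phi> w0) (D \<phi> w0 h) + \<omega> (\<phi> w0) (D (\<lambda>w. D \<phi> w x) w0 h)" for x h
    by (rule fun_cong[OF D_eqI[OF form1_compose[OF \<omega> d d2]]])
  show ?thesis
    unfolding ed1_def e symmetric_D[OF \<phi>, of y x] by linarith
qed

lemma ed2_pullback:
  fixes \<phi> :: "'w::euclidean_space \<Rightarrow> 'a::euclidean_space"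
  assumes \<phi>: "smooth_on T \<phi>" "open T" "w0 \<in> T" and \<omega>: "form2_at (\<phi> w0) \<omega>"
  shows "ed2 (\<lambda>w x y. \<omega> (\<phi> w) (D \<phi> w x) (D \<phi> w y)) w0 x y t
    = ed2 \<omega> (\<phi> w0) (D \<phi> w0 x) (D \<phi> w0 y) (D \<phi> w0 t)"
proof -
  have d: "(\<phi> has_derivative D \<phi> w0) (at w0)"
    by (intro D_works smooth_on_differentiable[OF \<phi>(1,3)])
  have d2: "((\<lambda>w. D \<phi> w x) has_derivative D (\<lambda>w. D \<phi> w x) w0) (at w0)" for x
    by (intro D_works smooth_on_differentiable[OF smooth_on_D[OF \<phi>(1)] \<phi>(3)])
  have e: "D (\<lambda>w. \<omega> (\<phi> w) (D \<phi> w x) (D \<phi> w y)) w0 h = D (\<lambda>z. \<omega> z (D \<phi> w0 x) (D \<phi> w0 y)) (\<phi> w0) (D \<phi> w0 h)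
      + \<omega> (\<phi> w0) (D (\<lambda>w. D \<phi> w x) w0 h) (D \<phi> w0 y) + \<omega> (\<phi> w0) (D \<phi> w0 x) (D (\<lambda>w. D \<phi> w y) w0 h)" for x y h
    by (rule fun_cong[OF D_eqI[OF form2_compose[OF \<omega> d d2 d2]]])
  show ?thesis
    using form2_atD(4)[OF \<omega>, of "D (\<lambda>z. D \<phi> z x) w0 y" "D \<phi> w0 t"]
      form2_atD(4)[OF \<omega>, of "D (\<lambda>z. D \<phi> z x) w0 t" "D \<phi> w0 y"]
      form2_atD(4)[OF \<omega>, of "D (\<lambda>z. D \<phi> z y) w0 t" "D \<phi> w0 x"]
    unfolding ed2_def e symmetric_D[OF \<phi>, of y x] symmetric_D[OF \<phi>, of t x] symmetric_D[OF \<phi>, of t y]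
    by linarith
qed

text \<open>Cartan's formula in coordinates, for a form whose Lie derivative along \<open>v\<close> vanishes.\<close>

lemma ed1_contract_invariant:
  assumes \<sigma>: "form2_at z0 \<sigma>" and v: "(v has_derivative v') (at z0)"
    and L: "\<And>x y. D (\<lambda>z. \<sigma> z x y) z0 (v z0) + \<sigma> z0 (v' x) y + \<sigma> z0 x (v' y) = 0"
  shows "ed1 (\<lambda>z. \<sigma> z (v z)) z0 x y = - ed2 \<sigma> z0 (v z0) x y"
proof -
  have "ed1 (\<lambda>z. \<sigma> z (v z)) z0 x y = D (\<lambda>z. \<sigma> z (v z0) y) z0 x + \<sigma> z0 (v' x) y
      - (D (\<lambda>z. \<sigma> z (v z0) x) z0 y + \<sigma> z0 (v' y) x)"
    by (simp add: ed1_def D_eqI[OF form2_D[OF \<sigma> v has_derivative_const]]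
        linear_0[OF form2_atD(2)[OF \<sigma>]])
  then show ?thesis
    using L[of x y] form2_atD(4)[OF \<sigma>, of x "v' y"] unfolding ed2_def by linarith
qed

lemma ed2_contract_invariant:
  assumes \<psi>: "form3_at z0 \<psi>" and v: "(v has_derivative v') (at z0)"
    and L: "\<And>x y w. D (\<lambda>z. \<psi> z x y w) z0 (v z0) + \<psi> z0 (v' x) y w + \<psi> z0 x (v' y) w
      + \<psi> z0 x y (v' w) = 0"
  shows "ed2 (\<lambda>z. \<psi> z (v z)) z0 x y w = - ed3 \<psi> z0 (v z0) x y w"
proof -
  have e: "D (\<lambda>z. \<psi> z (v z) x y) z0 w = D (\<lambda>z. \<psi> z (v z0) x y) z0 w + \<psi> z0 (v' w) x y" for x y w
    by (simp add: D_eqI[OF form3_D[OF \<psi> v has_derivative_const has_derivative_const]]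
        linear_0[OF form3_atD(2)[OF \<psi>]] linear_0[OF form3_atD(3)[OF \<psi>]])
  show ?thesis
    using L[of x y w] form3_atD(4)[OF \<psi>, of x "v' y" w] form3_atD(4)[OF \<psi>, of "v' w" x y]
      form3_atD(5)[OF \<psi>, of x "v' w" y]
    unfolding ed2_def ed3_def e by linarith
qed

text \<open>Cartan's formula used twice, once for each field: the equation \<open>uv\<close>, which
  says that the bracket vanishes, makes the Lie derivative along one field commute with contraction
  by the other. In the computation the terms with \<open>u' (v z0)\<close> and
  \<open>v' (u z0)\<close> cancel. The same mechanism gives
  \<open>ed1_contract2_invariant\<close>.\<close>

lemma D_contract_invariant:
  assumes \<sigma>: "form2_at z0 \<sigma>" and u: "(u has_derivative u') (at z0)" and v: "(v has_derivative v') (at z0)"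
    and Lu: "\<And>x y. D (\<lambda>z. \<sigma> z x y) z0 (u z0) + \<sigma> z0 (u' x) y + \<sigma> z0 x (u' y) = 0"
    and Lv: "\<And>x y. D (\<lambda>z. \<sigma> z x y) z0 (v z0) + \<sigma> z0 (v' x) y + \<sigma> z0 x (v' y) = 0"
    and uv: "u' (v z0) = v' (u z0)"
  shows "D (\<lambda>z. \<sigma> z (u z) (v z)) z0 x = ed2 \<sigma> z0 (u z0) (v z0) x"
proof -
  have "D (\<lambda>z. \<sigma> z (u z) (v z)) z0 x =
      D (\<lambda>z. \<sigma> z (u z0) (v z0)) z0 x + \<sigma> z0 (u' x) (v z0) + \<sigma> z0 (u z0) (v' x)"
    by (rule fun_cong[OF D_eqI[OF form2_D[OF \<sigma> u v]]])
  then show ?thesis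
    using Lu[of "v z0" x, unfolded uv] Lv[of "u z0" x] form2_atD(4)[OF \<sigma>, of "v z0" "u' x"]
    unfolding ed2_def by linarith
qed

lemma ed1_contract2_invariant:
  assumes \<psi>: "form3_at z0 \<psi>" and u: "(u has_derivative u') (at z0)" and v: "(v has_derivative v') (at z0)"
    and Lu: "\<And>x y w. D (\<lambda>z. \<psi> z x y w) z0 (u z0) + \<psi> z0 (u' x) y w + \<psi> z0 x (u' y) w
      + \<psi> z0 x y (u' w) = 0"
    and Lv: "\<And>x y w. D (\<lambda>z. \<psi> z x y w) z0 (v z0) + \<psi> z0 (v' x) y w + \<psi> z0 x (v' y) w
      + \<psi> z0 x y (v' w) = 0"
    and uv: "u' (v z0) = v' (u z0)"
  shows "ed1 (\<lambda>z. \<psi> z (u z) (v z)) z0 x y = ed3 \<psi> z0 (u z0) (v z0) x y"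
proof -
  have e: "D (\<lambda>z. \<psi> z (u z) (v z) y) z0 x = D (\<lambda>z. \<psi> z (u z0) (v z0) y) z0 x
      + \<psi> z0 (u' x) (v z0) y + \<psi> z0 (u z0) (v' x) y" for x y
    by (simp add: D_eqI[OF form3_D[OF \<psi> u v has_derivative_const]] linear_0[OF form3_atD(3)[OF \<psi>]])
  show ?thesis
    using Lu[of "v z0" x y, unfolded uv] Lv[of "u z0" x y]
      form3_atD(4)[OF \<psi>, of "v z0" "u' x" y] form3_atD(5)[OF \<psi>, of "v z0" x "u' y"]
      form3_atD(4)[OF \<psi>, of "v z0" "u' y" x] form3_atD(5)[OF \<psi>, of "u z0" x "v' y"]
    unfolding ed1_def ed3_def e by linarith
qed

section \<open>Linear algebra of an SU(3)-structure\<close>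

text \<open>With \<open>z1\<close>, \<open>z2\<close>, \<open>z3\<close> the complex coordinates f_k
  + i Jf_k of an adapted frame, \<open>herm\<close> is the Hermitian metric and \<open>cdet\<close>
  below is the complex volume form. Arbitrary functions on any type are allowed, so the following
  lemmas are polynomial identities in their values.\<close>

definition herm :: "('t \<Rightarrow> complex) \<Rightarrow> ('t \<Rightarrow> complex) \<Rightarrow> ('t \<Rightarrow> complex) \<Rightarrow> 't \<Rightarrow> 't \<Rightarrow> complex" where
  "herm z1 z2 z3 x y = z1 x * cnj (z1 y) + z2 x * cnj (z2 y) + z3 x * cnj (z3 y)"

definition cdet :: "('t \<Rightarrow> complex) \<Rightarrow> ('t \<Rightarrow> complex) \<Rightarrow> ('t \<Rightarrow> complex) \<Rightarrow> 't \<Rightarrow> 't \<Rightarrow> 't \<Rightarrow> complex" where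
  "cdet z1 z2 z3 x y w = z1 x * (z2 y * z3 w - z3 y * z2 w) - z2 x * (z1 y * z3 w - z3 y * z1 w)
     + z3 x * (z1 y * z2 w - z2 y * z1 w)"

text \<open>Multiplicativity of the determinant: the coordinate matrix of \<open>u\<close>,
  \<open>v\<close>, \<open>x\<close> times the conjugate transpose of that of \<open>u\<close>,
  \<open>v\<close>, \<open>y\<close> has the Hermitian products as entries. The right-hand side is
  the expansion along the last row.\<close>

lemma cdet_gram:
  fixes z1 z2 z3 :: "'t \<Rightarrow> complex"
  defines "H \<equiv> herm z1 z2 z3"
  shows "cdet z1 z2 z3 u v x * cnj (cdet z1 z2 z3 u v y) =
    H x y * (H u u * H v v - H u v * H v u) - H x v * (H u u * H v y - H u y * H v u)
      + H x u * (H u v * H v y - H u y * H v v)"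
proof -
  define A :: "complex^3^3" where "A = vector [vector [z1 u, z2 u, z3 u], vector [z1 v, z2 v, z3 v],
    vector [z1 x, z2 x, z3 x]]"
  define B :: "complex^3^3" where "B = vector [vector [cnj (z1 u), cnj (z1 v), cnj (z1 y)],
    vector [cnj (z2 u), cnj (z2 v), cnj (z2 y)], vector [cnj (z3 u), cnj (z3 v), cnj (z3 y)]]"
  have "A ** B = vector [vector [H u u, H u v, H u y], vector [H v u, H v v, H v y],
      vector [H x u, H x v, H x y]]"
    by (simp add: vec_eq_iff forall_3 matrix_matrix_mult_def sum_3 A_def B_def H_def herm_def)
  then have "det (A ** B) = H x y * (H u u * H v v - H u v * H v u)
      - H x v * (H u u * H v y - H u y * H v u) + H x u * (H u v * H v y - H u y * H v v)"
    by (simp add: det_3 algebra_simps)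
  moreover have "det A = cdet z1 z2 z3 u v x" "det B = cnj (cdet z1 z2 z3 u v y)"
    by (simp_all add: det_3 A_def B_def cdet_def algebra_simps)
  ultimately show ?thesis by (simp add: det_mul)
qed

text \<open>Four vectors of C^3 satisfy Cramer's relation det(v,x,y) u - det(u,x,y) v + det(u,v,y) x
  - det(u,v,x) y = 0. The identity results from applying a linear functional \<open>n\<close> that
  vanishes on \<open>v\<close>.\<close>

lemma cdet_expansion:
  fixes z1 z2 z3 :: "'t \<Rightarrow> complex"
  defines "H \<equiv> herm z1 z2 z3"
  shows "(H u u * H v v - H u v * H v u) * cdet z1 z2 z3 v x y =
    (H v v * H y u - H v u * H y v) * cdet z1 z2 z3 u v x
    - (H v v * H x u - H v u * H x v) * cdet z1 z2 z3 u v y"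
proof -
  \<comment> \<open>\<open>m1\<close>, \<open>m2\<close>, \<open>m3\<close> are the components of
    the conjugate of the cross product of \<open>u\<close> and \<open>v\<close>, and
    \<open>n x\<close> pairs them with the cross product of \<open>x\<close> and \<open>v\<close>;
    by Lagrange's identity this is a two by two minor of Hermitian products.\<close>
  define m1 where "m1 = cnj (z2 u) * cnj (z3 v) - cnj (z3 u) * cnj (z2 v)"
  define m2 where "m2 = cnj (z3 u) * cnj (z1 v) - cnj (z1 u) * cnj (z3 v)"
  define m3 where "m3 = cnj (z1 u) * cnj (z2 v) - cnj (z2 u) * cnj (z1 v)"
  define n where "n = (\<lambda>x. m1 * (z2 x * z3 v - z3 x * z2 v) + m2 * (z3 x * z1 v - z1 x * z3 v)
    + m3 * (z1 x * z2 v - z2 x * z1 v))"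
  have "H v v * H x u - H v u * H x v = n x" for x
    by (simp add: H_def herm_def n_def m1_def m2_def m3_def algebra_simps)
  moreover from this[of u] have "H u u * H v v - H u v * H v u = n u" by (simp add: mult.commute)
  moreover have "n u * cdet z1 z2 z3 v x y = n y * cdet z1 z2 z3 u v x - n x * cdet z1 z2 z3 u v y"
    by (simp add: n_def cdet_def algebra_simps)
  ultimately show ?thesis by simp
qed

text \<open>The minus sign reflects that \<open>herm\<close> is antilinear in its second argument, whereas
  \<open>\<sigma> = g(J\<cdot>, \<cdot>)\<close>.\<close>

definition su3_model :: "('t \<Rightarrow> 't \<Rightarrow> real) \<Rightarrow> ('t \<Rightarrow> 't \<Rightarrow> real) \<Rightarrow> ('t \<Rightarrow> 't \<Rightarrow> 't \<Rightarrow> real) \<Rightarrow>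
    ('t \<Rightarrow> 't \<Rightarrow> 't \<Rightarrow> real) \<Rightarrow> bool" where
  "su3_model G S P Q \<longleftrightarrow> (\<exists>z1 z2 z3. \<forall>x y. herm z1 z2 z3 x y = Complex (G x y) (- S x y) \<and>
     (\<forall>w. cdet z1 z2 z3 x y w = Complex (P x y w) (Q x y w)))"

lemma su3_model_antisym:
  assumes "su3_model G S P Q"
  shows "G x y = G y x" "S x y = - S y x" "S x x = 0"
proof -
  obtain z1 z2 z3 where h: "\<And>x y. herm z1 z2 z3 x y = Complex (G x y) (- S x y)"
    using assms unfolding su3_model_def by blast
  have cnj: "cnj (herm z1 z2 z3 x y) = herm z1 z2 z3 y x" for x y
    by (simp add: herm_def mult.commute)
  have *: "G x y = G y x \<and> S x y = - S y x" for x y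
    using cnj[of x y, unfolded h] by (simp only: complex_eq_iff complex_cnj complex.sel) simp
  then show "G x y = G y x" "S x y = - S y x" by blast+
  show "S x x = 0" using *[of x x] by simp
qed

text \<open>By Lagrange's identity the Gram determinant is the squared length of the complex cross
  product of \<open>u\<close> and \<open>v\<close>, whose components up to sign are
  \<open>n1\<close>, \<open>n2\<close>, \<open>n3\<close>. It is nonzero because \<open>cdet\<close>
  at \<open>u\<close>, \<open>v\<close>, \<open>x\<close> pairs this cross product with
  \<open>x\<close>.\<close>

lemma su3_model_gram_pos:
  assumes "su3_model G S P Q" "P u v x \<noteq> 0"
  shows "G u u * G v v - (G u v)\<^sup>2 - (S u v)\<^sup>2 > 0"
proof -
  obtain z1 z2 z3 where h: "\<And>x y. herm z1 z2 z3 x y = Complex (G x y) (- S x y)"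
    and d: "\<And>x y w. cdet z1 z2 z3 x y w = Complex (P x y w) (Q x y w)"
    using assms(1) unfolding su3_model_def by blast
  define n1 where "n1 = z2 u * z3 v - z3 u * z2 v"
  define n2 where "n2 = z1 u * z3 v - z3 u * z1 v"
  define n3 where "n3 = z1 u * z2 v - z2 u * z1 v"
  have "herm z1 z2 z3 u u * herm z1 z2 z3 v v - herm z1 z2 z3 u v * herm z1 z2 z3 v u =
      n1 * cnj n1 + n2 * cnj n2 + n3 * cnj n3"
    unfolding herm_def n1_def n2_def n3_def complex_cnj_add complex_cnj_diff complex_cnj_mult
    by (simp add: algebra_simps)
  then have "Re (herm z1 z2 z3 u u * herm z1 z2 z3 v v - herm z1 z2 z3 u v * herm z1 z2 z3 v u) =
      (cmod n1)\<^sup>2 + (cmod n2)\<^sup>2 + (cmod n3)\<^sup>2"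
    by (simp add: complex_norm_square[symmetric] del: of_real_power)
  moreover have "Re (herm z1 z2 z3 u u * herm z1 z2 z3 v v - herm z1 z2 z3 u v * herm z1 z2 z3 v u) =
      G u u * G v v - (G u v)\<^sup>2 - (S u v)\<^sup>2"
    by (simp add: h power2_eq_square su3_model_antisym(1)[OF assms(1), of v u]
        su3_model_antisym(2)[OF assms(1), of v u] su3_model_antisym(3)[OF assms(1)])
  moreover have "n1 \<noteq> 0 \<or> n2 \<noteq> 0 \<or> n3 \<noteq> 0"
  proof (rule ccontr)
    assume "\<not> ?thesis"
    then have n: "n1 = 0" "n2 = 0" "n3 = 0" by auto
    have "cdet z1 z2 z3 u v x = z1 x * n1 - z2 x * n2 + z3 x * n3"
      unfolding cdet_def n1_def n2_def n3_def by algebra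
    then have "cdet z1 z2 z3 u v x = 0" by (simp add: n)
    then show False using assms(2) by (simp add: d complex_eq_iff)
  qed
  then have "(cmod n1)\<^sup>2 + (cmod n2)\<^sup>2 + (cmod n3)\<^sup>2 > 0"
    using zero_le_power2[of "cmod n1"] zero_le_power2[of "cmod n2"] zero_le_power2[of "cmod n3"]
    by (metis add_nonneg_nonneg add_nonneg_pos add_pos_nonneg norm_eq_zero zero_less_power2)
  ultimately show ?thesis by linarith
qed

text \<open>On the kernel of \<open>P u v\<close> the value of \<open>cdet\<close> at
  \<open>u\<close>, \<open>v\<close>, \<open>x\<close> is i times \<open>Q u v x\<close>, so the
  imaginary and the real part of \<open>cdet_expansion\<close> separate into these formulas. Each
  presents a contraction with \<open>v\<close> alone as a one-form wedge
  \<open>Q u v\<close>.\<close>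

lemma su3_model_expansion:
  assumes m: "su3_model G S P Q" and x: "P u v x = 0" and y: "P u v y = 0"
  defines "c \<equiv> G u u * G v v - (G u v)\<^sup>2 - (S u v)\<^sup>2"
  shows "c * Q v x y =
      (G v v * G u y - G u v * G v y + S u v * S v y) * Q u v x
      - (G v v * G u x - G u v * G v x + S u v * S v x) * Q u v y"
    and "c * P v x y =
      (G v v * S u x - S u v * G v x - G u v * S v x) * Q u v y
      - (G v v * S u y - S u v * G v y - G u v * S v y) * Q u v x"
proof -
  obtain z1 z2 z3 where h: "\<And>x y. herm z1 z2 z3 x y = Complex (G x y) (- S x y)"
    and d: "\<And>x y w. cdet z1 z2 z3 x y w = Complex (P x y w) (Q x y w)"
    using m unfolding su3_model_def by blast
  have s: "G v u = G u v" "G x u = G u x" "G x v = G v x" "G y u = G u y" "G y v = G v y"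
    "S v u = - S u v" "S x u = - S u x" "S x v = - S v x" "S y u = - S u y" "S y v = - S v y"
    "S u u = 0" "S v v = 0"
    by (rule su3_model_antisym[OF m])+
  note e = cdet_expansion[of z1 z2 z3 u v x y, unfolded h d s x y]
  show "c * Q v x y =
      (G v v * G u y - G u v * G v y + S u v * S v y) * Q u v x
      - (G v v * G u x - G u v * G v x + S u v * S v x) * Q u v y"
    using arg_cong[OF e, of Im] by (simp add: c_def power2_eq_square algebra_simps)
  show "c * P v x y =
      (G v v * S u x - S u v * G v x - G u v * S v x) * Q u v y
      - (G v v * S u y - S u v * G v y - G u v * S v y) * Q u v x"
    using arg_cong[OF e, of Re] by (simp add: c_def power2_eq_square algebra_simps)
qed

text \<open>By \<open>su3_model_expansion\<close> the contraction of \<open>P\<close> with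
  \<open>v\<close> is, up to the nonzero Gram determinant, a one-form wedge \<open>Q u v\<close>, so
  one more wedge with \<open>Q u v\<close> kills it.\<close>

lemma su3_model_contract_wedge:
  assumes m: "su3_model G S P Q" and "P u v x = 0" "P u v y = 0" "P u v w = 0"
    and "G u u * G v v - (G u v)\<^sup>2 - (S u v)\<^sup>2 \<noteq> 0"
  shows "P v x y * Q u v w - P v x w * Q u v y + P v y w * Q u v x = 0"
proof -
  define c where "c = G u u * G v v - (G u v)\<^sup>2 - (S u v)\<^sup>2"
  have "c * (P v x y * Q u v w - P v x w * Q u v y + P v y w * Q u v x) =
      (c * P v x y) * Q u v w - (c * P v x w) * Q u v y + (c * P v y w) * Q u v x"
    by (simp add: algebra_simps)
  also have "\<dots> = 0"
    unfolding c_def su3_model_expansion(2)[OF m assms(2,3)] su3_model_expansion(2)[OF m assms(2,4)]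
      su3_model_expansion(2)[OF m assms(3,4)]
    by (simp add: algebra_simps)
  finally have "(G u u * G v v - (G u v)\<^sup>2 - (S u v)\<^sup>2) *
      (P v x y * Q u v w - P v x w * Q u v y + P v y w * Q u v x) = 0"
    unfolding c_def .
  then show ?thesis using assms(5) by simp
qed

text \<open>For \<open>x\<close> and \<open>y\<close> in the kernel the left-hand side of
  \<open>cdet_gram\<close> is the real number \<open>Q u v x * Q u v y\<close>. The imaginary part
  is therefore a linear equation for \<open>S x y\<close>, with the Gram determinant
  \<open>h - s\<^sup>2\<close> as coefficient.\<close>

lemma su3_model_fundamental_form:
  assumes m: "su3_model G S P Q" and x: "P u v x = 0" and y: "P u v y = 0"
    and c: "h \<noteq> 0" "h - s\<^sup>2 \<noteq> 0"
    and h: "h = G u u * G v v - (G u v)\<^sup>2" and s: "s = S u v"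
  defines "a1 \<equiv> \<lambda>x. s * ((G v v * G u x - G u v * G v x) / h) + S v x"
  defines "a2 \<equiv> \<lambda>x. s * ((G u u * G v x - G u v * G u x) / h) - S u x"
  shows "s * S x y = S u x * S v y - S u y * S v x - h / (h - s\<^sup>2) * (a1 x * a2 y - a1 y * a2 x)"
proof -
  obtain z1 z2 z3 where hm: "\<And>x y. herm z1 z2 z3 x y = Complex (G x y) (- S x y)"
    and d: "\<And>x y w. cdet z1 z2 z3 x y w = Complex (P x y w) (Q x y w)"
    using m unfolding su3_model_def by blast
  have sy: "G v u = G u v" "G x u = G u x" "G x v = G v x"
    "S v u = - S u v" "S x u = - S u x" "S x v = - S v x"
    "S u u = 0" "S v v = 0"
    by (rule su3_model_antisym[OF m])+
  define A p B X1 X2 X3 X4 Y1 Y2 Y3 Y4 where a: "A = G u u" "p = G u v" "B = G v v"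
    "X1 = G u x" "X2 = G v x" "X3 = S u x" "X4 = S v x"
    "Y1 = G u y" "Y2 = G v y" "Y3 = S u y" "Y4 = S v y"
  note e = cdet_gram[of z1 z2 z3 u v x y, unfolded hm d sy x y]
  \<comment> \<open>\<open>R\<close> is the inhomogeneous side of that linear equation; only
    products of \<open>x\<close> and \<open>y\<close> with \<open>u\<close> and \<open>v\<close>
    occur in it.\<close>
  define R where "R = X2 * (A * Y4 + s * Y1 - p * Y3) - X4 * (A * Y2 - p * Y1 - s * Y3)
    + X1 * (B * Y3 - p * Y4 - s * Y2) + X3 * (p * Y2 - s * Y4 - B * Y1)"
  have "(h - s\<^sup>2) * S x y = R"
    using arg_cong[OF e, of Im] unfolding R_def h s a
    by (simp add: power2_eq_square x y algebra_simps)
  then have S: "S x y = R / (h - s\<^sup>2)" using c by (simp add: field_simps)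
  \<comment> \<open>\<open>N1\<close> and \<open>N2\<close> compute \<open>h\<close> times
    \<open>a1\<close> and \<open>a2\<close>. With the denominators cleared, the claim is a
    polynomial identity once \<open>h\<close> is replaced by
    \<open>A * B - p\<^sup>2\<close>.\<close>
  define N1 where "N1 = (\<lambda>X1 X2 X4. s * (B * X1 - p * X2) + h * X4)"
  define N2 where "N2 = (\<lambda>X1 X2 X3. s * (A * X2 - p * X1) - h * X3)"
  have N: "a1 x = N1 X1 X2 X4 / h" "a1 y = N1 Y1 Y2 Y4 / h" "a2 x = N2 X1 X2 X3 / h" "a2 y = N2 Y1 Y2 Y3 / h"
    using c(1) by (simp_all add: a1_def a2_def N1_def N2_def a field_simps)
  have "h * (s * R) = (h - s\<^sup>2) * h * (X3 * Y4 - Y3 * X4)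
      - (N1 X1 X2 X4 * N2 Y1 Y2 Y3 - N1 Y1 Y2 Y4 * N2 X1 X2 X3)"
    unfolding R_def N1_def N2_def h a[symmetric] by algebra
  then have "s * (R / (h - s\<^sup>2)) = X3 * Y4 - Y3 * X4 - h / (h - s\<^sup>2) *
      (N1 X1 X2 X4 / h * (N2 Y1 Y2 Y3 / h) - N1 Y1 Y2 Y4 / h * (N2 X1 X2 X3 / h))"
    using c by (simp add: divide_simps) algebra
  then show ?thesis unfolding S N a .
qed

section \<open>Charts\<close>

lemma cinv_in: "z \<in> cmap c ` cdom c \<Longrightarrow> cinv c z \<in> cdom c"
  unfolding cinv_def by (rule inv_into_into)

lemma cmap_cinv: "z \<in> cmap c ` cdom c \<Longrightarrow> cmap c (cinv c z) = z"
  unfolding cinv_def by (rule f_inv_into_f)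

lemma
  assumes "smooth_manifold M" "c \<in> charts M"
  shows chart_openin: "openin (mspace M) (cdom c)"
    and chart_open_image: "open (cmap c ` cdom c)"
    and chart_homeomorphic:
      "homeomorphic_map (subtopology (mspace M) (cdom c)) (top_of_set (cmap c ` cdom c)) (cmap c)"
  using assms unfolding smooth_manifold_def by blast+

lemma chart_subset:
  assumes "smooth_manifold M" "c \<in> charts M"
  shows "cdom c \<subseteq> points M"
  using chart_openin[OF assms] openin_subset by blast

lemma cinv_cmap:
  assumes "smooth_manifold M" "c \<in> charts M" "p \<in> cdom c"
  shows "cinv c (cmap c p) = p"
proof -
  have "topspace (subtopology (mspace M) (cdom c)) = cdom c"
    using chart_subset[OF assms(1,2)] by (simp add: Int_absorb1)
  then have "inj_on (cmap c) (cdom c)"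
    using homeomorphic_imp_injective_map[OF chart_homeomorphic[OF assms(1,2)]] by simp
  then show ?thesis unfolding cinv_def using assms(3) by (rule inv_into_f_f)
qed

lemma chart_image_open:
  assumes "smooth_manifold M" "c \<in> charts M" "openin (mspace M) U"
  shows "open (cmap c ` (U \<inter> cdom c))"
proof -
  have "openin (subtopology (mspace M) (cdom c)) (U \<inter> cdom c)"
    using assms(3) by (auto simp: openin_subtopology)
  then have "openin (top_of_set (cmap c ` cdom c)) (cmap c ` (U \<inter> cdom c))"
    using homeomorphic_imp_open_map[OF chart_homeomorphic[OF assms(1,2)]] unfolding open_map_def by blast
  then show ?thesis using openin_open_eq[OF chart_open_image[OF assms(1,2)]] by blast
qed

lemma charts_atD: "c \<in> charts_at M p \<Longrightarrow> c \<in> charts M" "c \<in> charts_at M p \<Longrightarrow> p \<in> cdom c"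
  by (auto simp: charts_at_def)

lemma chart_at_charts_at:
  assumes "smooth_manifold M" "p \<in> points M"
  shows "chart_at M p \<in> charts_at M p"
proof -
  have "\<exists>c. c \<in> charts_at M p"
    using assms unfolding smooth_manifold_def charts_at_def by blast
  then show ?thesis unfolding chart_at_def by (rule someI_ex)
qed

section \<open>Differentiable maps and their differentials in charts\<close>

abbreviation local_rep :: "('a, 'e) chart \<Rightarrow> ('b, 'f) chart \<Rightarrow> ('a \<Rightarrow> 'b) \<Rightarrow> 'e \<Rightarrow> 'f" where
  "local_rep c d F \<equiv> cmap d \<circ> F \<circ> cinv c"

text \<open>Differentiability at every point suffices for the chain rule and for differentials. For
  a single element of the torus it follows from the joint smoothness of the action by one
  application of that rule.\<close>

definition diff_map ::
    "('a, 'e::euclidean_space) mfd \<Rightarrow> ('b, 'f::euclidean_space) mfd \<Rightarrow> ('a \<Rightarrow> 'b) \<Rightarrow> bool" where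
  "diff_map M N F \<longleftrightarrow> continuous_map (mspace M) (mspace N) F \<and>
     (\<forall>c\<in>charts M. \<forall>d\<in>charts N. \<forall>p\<in>cdom c. F p \<in> cdom d \<longrightarrow>
        local_rep c d F differentiable (at (cmap c p)))"

lemma diff_mapD:
  assumes "diff_map M N F" "c \<in> charts_at M p" "d \<in> charts_at N (F p)"
  shows "local_rep c d F differentiable (at (cmap c p))"
  using assms unfolding diff_map_def charts_at_def by blast

lemma smooth_map_diff_map: "smooth_map M N F \<Longrightarrow> diff_map M N F"
  unfolding smooth_map_def diff_map_def by (auto intro!: smooth_on_differentiable)

lemma smooth_map_ident:
  assumes "smooth_manifold M"
  shows "smooth_map M M (\<lambda>p. p)"
proof -
  have "{p \<in> cdom c. p \<in> cdom d} = cdom c \<inter> cdom d" for c d :: "('a, 'b) chart" by auto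
  moreover have "cmap d \<circ> (\<lambda>p. p) \<circ> cinv c = cmap d \<circ> cinv c" for c d :: "('a, 'b) chart"
    by (simp add: o_def)
  ultimately show ?thesis
    using assms unfolding smooth_map_def smooth_manifold_def by (auto simp: o_assoc)
qed

lemma local_rep_domain_open:
  assumes "smooth_manifold M" "smooth_manifold N" "continuous_map (mspace M) (mspace N) F"
    "c \<in> charts M" "d \<in> charts N"
  shows "open (cmap c ` {p \<in> cdom c. F p \<in> cdom d})"
proof -
  have "openin (mspace M) {p \<in> points M. F p \<in> cdom d}"
    using openin_continuous_map_preimage[OF assms(3) chart_openin[OF assms(2,5)]] .
  from chart_image_open[OF assms(1,4) this]
  have "open (cmap c ` ({p \<in> points M. F p \<in> cdom d} \<inter> cdom c))" .
  moreover have "{p \<in> points M. F p \<in> cdom d} \<inter> cdom c = {p \<in> cdom c. F p \<in> cdom d}"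
    using chart_subset[OF assms(1,4)] by blast
  ultimately show ?thesis by simp
qed

text \<open>This is the chain rule, but the composition of the two coordinate expressions agrees
  with that of the composite only where the intermediate point lies in \<open>cdom d\<close>;
  continuity of \<open>F\<close> makes this an open neighbourhood.\<close>

lemma local_rep_compose:
  assumes M: "smooth_manifold M" and N: "smooth_manifold N"
    and F: "diff_map M N F" and G: "diff_map N P G"
    and c: "c \<in> charts_at M p" and d: "d \<in> charts_at N (F p)" and e: "e \<in> charts_at P (G (F p))"
  shows "(local_rep c e (\<lambda>p. G (F p)) has_derivative
    (\<lambda>x. D (local_rep d e G) (cmap d (F p)) (D (local_rep c d F) (cmap c p) x))) (at (cmap c p))"
proof -
  let ?S = "cmap c ` {p \<in> cdom c. F p \<in> cdom d}"
  have inv: "cinv c (cmap c p) = p" using cinv_cmap[OF M charts_atD[OF c]] .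
  have "(local_rep c d F has_derivative D (local_rep c d F) (cmap c p)) (at (cmap c p))"
    by (intro D_works diff_mapD[OF F c d])
  moreover have "(local_rep d e G has_derivative D (local_rep d e G) (cmap d (F p)))
      (at (local_rep c d F (cmap c p)))"
    using D_works[OF diff_mapD[OF G d e]] inv by simp
  ultimately have "(local_rep d e G \<circ> local_rep c d F has_derivative
      D (local_rep d e G) (cmap d (F p)) \<circ> D (local_rep c d F) (cmap c p)) (at (cmap c p))"
    by (rule diff_chain_at)
  then have "(local_rep c e (\<lambda>p. G (F p)) has_derivative
      D (local_rep d e G) (cmap d (F p)) \<circ> D (local_rep c d F) (cmap c p)) (at (cmap c p))"
  proof (rule has_derivative_transform_within_open)
    show "open ?S"
      using local_rep_domain_open[OF M N _ charts_atD(1)[OF c] charts_atD(1)[OF d]] F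
      unfolding diff_map_def by blast
    show "cmap c p \<in> ?S" using charts_atD(2)[OF c] charts_atD(2)[OF d] by blast
    show "(local_rep d e G \<circ> local_rep c d F) z = local_rep c e (\<lambda>p. G (F p)) z" if "z \<in> ?S" for z
      using that cinv_cmap[OF M charts_atD(1)[OF c]] cinv_cmap[OF N charts_atD(1)[OF d]] by auto
  qed
  then show ?thesis by (simp add: o_def)
qed

lemma tvec_apply:
  "d \<in> charts_at M p \<Longrightarrow> tvec M c p x d = D (local_rep c d (\<lambda>p. p)) (cmap c p) x"
  by (simp add: tvec_def o_def)

text \<open>\<open>differential\<close> evaluates in the arbitrary chart
  \<open>chart_at M p\<close>. The chain rule is used once for the change from \<open>c\<close> to
  that chart and once for the change from \<open>d\<close> to \<open>e\<close>, so neither choice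
  matters.\<close>

lemma differential_tvec:
  assumes M: "smooth_manifold M" and N: "smooth_manifold N" and F: "diff_map M N F"
    and c: "c \<in> charts_at M p" and d: "d \<in> charts_at N (F p)"
  shows "differential M N F p (tvec M c p x) = tvec N d (F p) (D (local_rep c d F) (cmap c p) x)"
proof
  fix e
  have p: "p \<in> points M" using charts_atD[OF c] chart_subset[OF M] by blast
  note c0 = chart_at_charts_at[OF M p]
  note idM = smooth_map_diff_map[OF smooth_map_ident[OF M]]
  note idN = smooth_map_diff_map[OF smooth_map_ident[OF N]]
  show "differential M N F p (tvec M c p x) e = tvec N d (F p) (D (local_rep c d F) (cmap c p) x) e"
  proof (cases "e \<in> charts_at N (F p)")
    case e: True
    have "differential M N F p (tvec M c p x) e = D (local_rep c e F) (cmap c p) x"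
      using D_eqI[OF local_rep_compose[OF M M idM F c c0 e]] e
      by (simp add: differential_def Let_def tvec_apply[OF c0])
    moreover have "D (local_rep c e F) (cmap c p) x
        = tvec N d (F p) (D (local_rep c d F) (cmap c p) x) e"
      using D_eqI[OF local_rep_compose[OF M N F idN c d e]] by (simp add: tvec_apply[OF e])
    ultimately show ?thesis by simp
  qed (simp add: differential_def tvec_def Let_def)
qed

lemma tvec_self:
  assumes "smooth_manifold M" "c \<in> charts_at M p"
  shows "tvec M c p x c = x"
proof -
  have "((\<lambda>z. z) has_derivative (\<lambda>x. x)) (at (cmap c p))" by simp
  then have "(local_rep c c (\<lambda>p. p) has_derivative (\<lambda>x. x)) (at (cmap c p))"
    by (rule has_derivative_transform_within_open[OF _ chart_open_image[OF assms(1) charts_atD(1)[OF assms(2)]]])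
      (use charts_atD(2)[OF assms(2)] in \<open>auto simp: cinv_cmap[OF assms(1) charts_atD(1)[OF assms(2)]]\<close>)
  then show ?thesis using tvec_apply[OF assms(2)] D_eqI by metis
qed

lemma tvec_change:
  assumes M: "smooth_manifold M" and c: "c \<in> charts_at M p" and d: "d \<in> charts_at M p"
  shows "tvec M d p (tvec M c p x d) = tvec M c p x"
proof
  fix e
  note idM = smooth_map_diff_map[OF smooth_map_ident[OF M]]
  show "tvec M d p (tvec M c p x d) e = tvec M c p x e"
  proof (cases "e \<in> charts_at M p")
    case e: True
    show ?thesis
      using D_eqI[OF local_rep_compose[OF M M idM idM c d e]]
      by (simp add: tvec_apply[OF d] tvec_apply[OF e])
  qed (simp add: tvec_def)
qed

lemma tvec_in_tangent_space:
  assumes "smooth_manifold M" "c \<in> charts_at M p"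
  shows "tvec M c p x \<in> tangent_space M p"
  using tvec_change[OF assms] unfolding tangent_space_def by auto

lemma tangent_tvec: "X \<in> tangent_space M p \<Longrightarrow> c \<in> charts_at M p \<Longrightarrow> tvec M c p (X c) = X"
  unfolding tangent_space_def by auto

lemma tvec_uminus:
  assumes M: "smooth_manifold M" and c: "c \<in> charts_at M p"
  shows "tvec M c p (- x) = - tvec M c p x"
proof
  fix d
  note idM = smooth_map_diff_map[OF smooth_map_ident[OF M]]
  show "tvec M c p (- x) d = (- tvec M c p x) d"
  proof (cases "d \<in> charts_at M p")
    case True
    then show ?thesis
      unfolding tvec_apply[OF True] fun_Compl_def
      using linear_neg[OF has_derivative_linear[OF D_works[OF diff_mapD[OF idM c]]]] by simp
  qed (simp add: tvec_def)
qed

section \<open>Forms in charts\<close>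

lemma in_chart_cmap:
  assumes "smooth_manifold M" "c \<in> charts_at M p"
  shows "in_chart M c \<omega> (cmap c p) xs = \<omega> p (map (tvec M c p) xs)"
  by (simp add: in_chart_def cinv_cmap[OF assms(1) charts_atD[OF assms(2)]])

lemma pullback_in_chart:
  assumes "smooth_manifold M" "smooth_manifold N" "diff_map M N F"
    "c \<in> charts_at M p" "d \<in> charts_at N (F p)"
  shows "pullback M N F \<omega> p (map (tvec M c p) xs) =
    in_chart N d \<omega> (local_rep c d F (cmap c p)) (map (D (local_rep c d F) (cmap c p)) xs)"
  using assms
  by (simp add: pullback_def in_chart_cmap differential_tvec o_def
      cinv_cmap[OF assms(1) charts_atD[OF assms(4)]])

lemma ext_deriv_function:
  "ext_deriv M (fun_form f) p [X] = D (\<lambda>z. f (cinv (chart_at M p) z)) (cmap (chart_at M p) p) (X (chart_at M p))"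
  by (simp add: ext_deriv_def in_chart_def fun_form_def Let_def)

lemma ext_deriv_1:
  "ext_deriv M \<omega> p [X, Y] = ed1 (\<lambda>z x. in_chart M (chart_at M p) \<omega> z [x]) (cmap (chart_at M p) p)
     (X (chart_at M p)) (Y (chart_at M p))"
  by (simp add: ext_deriv_def ed1_def Let_def)

lemma ext_deriv_2:
  "ext_deriv M \<omega> p [X, Y, Z] = ed2 (\<lambda>z x y. in_chart M (chart_at M p) \<omega> z [x, y]) (cmap (chart_at M p) p)
     (X (chart_at M p)) (Y (chart_at M p)) (Z (chart_at M p))"
  by (simp add: ext_deriv_def ed2_def Let_def numeral_eq_Suc)

lemma ext_deriv_3:
  "ext_deriv M \<omega> p [X, Y, Z, W] = ed3 (\<lambda>z x y w. in_chart M (chart_at M p) \<omega> z [x, y, w]) (cmap (chart_at M p) p)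
     (X (chart_at M p)) (Y (chart_at M p)) (Z (chart_at M p)) (W (chart_at M p))"
  by (simp add: ext_deriv_def ed3_def Let_def numeral_eq_Suc)

lemma eventually_in_chart:
  assumes "smooth_manifold M" "c \<in> charts_at M p"
  shows "\<forall>\<^sub>F z in nhds (cmap c p). cinv c z \<in> cdom c \<and> cmap c (cinv c z) = z"
  using eventually_nhds_in_open[OF chart_open_image[OF assms(1) charts_atD(1)[OF assms(2)]],
      of "cmap c p"] charts_atD(2)[OF assms(2)]
  by (auto elim!: eventually_mono simp: cinv_in cmap_cinv)

lemma smooth_form_smooth_on:
  "smooth_form M k \<omega> \<Longrightarrow> c \<in> charts M \<Longrightarrow> length xs = k \<Longrightarrow>
    smooth_on (cmap c ` cdom c) (\<lambda>x. in_chart M c \<omega> x xs)"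
  unfolding smooth_form_def by blast

lemma smooth_form_form1_at:
  assumes M: "smooth_manifold M" and \<omega>: "smooth_form M 1 \<omega>" and c: "c \<in> charts_at M p"
  shows "form1_at (cmap c p) (\<lambda>z x. in_chart M c \<omega> z [x])"
  unfolding form1_at_def
proof safe
  have "linear (\<lambda>x. in_chart M c \<omega> z [x])" if "cinv c z \<in> cdom c" for z
  proof -
    have "alternating_covector M (cinv c z) 1 (\<omega> (cinv c z))" "c \<in> charts_at M (cinv c z)"
      using \<omega> that chart_subset[OF M charts_atD(1)[OF c]] charts_atD[OF c]
      unfolding smooth_form_def charts_at_def by auto
    from this(1)[unfolded alternating_covector_def, rule_format, OF this(2), of "[0]"]
    show ?thesis unfolding in_chart_def by simp
  qed
  then show "\<forall>\<^sub>F z in nhds (cmap c p). linear (\<lambda>x. in_chart M c \<omega> z [x])"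
    using eventually_in_chart[OF M c] by (auto elim: eventually_mono)
  show "(\<lambda>z. in_chart M c \<omega> z [x]) differentiable (at (cmap c p))" for x
    using smooth_form_smooth_on[OF \<omega> charts_atD(1)[OF c], of "[x]"] charts_atD(2)[OF c]
    by (auto intro: smooth_on_differentiable)
qed

lemma smooth_form_form3_at:
  assumes M: "smooth_manifold M" and \<omega>: "smooth_form M 3 \<omega>" and c: "c \<in> charts_at M p"
  shows "form3_at (cmap c p) (\<lambda>z x y w. in_chart M c \<omega> z [x, y, w])"
  unfolding form3_at_def
proof (intro conjI allI)
  have "(\<forall>y w. linear (\<lambda>x. in_chart M c \<omega> z [x, y, w])) \<and> (\<forall>x w. linear (\<lambda>y. in_chart M c \<omega> z [x, y, w])) \<and>
      (\<forall>x y. linear (\<lambda>w. in_chart M c \<omega> z [x, y, w])) \<and>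
      (\<forall>x y. in_chart M c \<omega> z [x, x, y] = 0 \<and> in_chart M c \<omega> z [x, y, y] = 0 \<and> in_chart M c \<omega> z [x, y, x] = 0)"
    if "cinv c z \<in> cdom c" for z
  proof -
    have "alternating_covector M (cinv c z) 3 (\<omega> (cinv c z))" and c': "c \<in> charts_at M (cinv c z)"
      using \<omega> that chart_subset[OF M charts_atD(1)[OF c]] charts_atD[OF c]
      unfolding smooth_form_def charts_at_def by auto
    note alt = bspec[OF this(1)[unfolded alternating_covector_def] c']
    have "(\<forall>i<3. linear (\<lambda>x. \<omega> (cinv c z) (map (tvec M c (cinv c z)) ([a, b, d][i := x])))) \<and>
     (\<forall>i j. i < j \<and> j < 3 \<and> [a, b, d] ! i = [a, b, d] ! j \<longrightarrow>
       \<omega> (cinv c z) (map (tvec M c (cinv c z)) [a, b, d]) = 0)" for a b d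
      by (rule mp[OF spec[OF alt]]) simp
    then have l: "i < 3 \<Longrightarrow> linear (\<lambda>x. \<omega> (cinv c z) (map (tvec M c (cinv c z)) ([a, b, d][i := x])))"
      and z: "i < j \<Longrightarrow> j < 3 \<Longrightarrow> [a, b, d] ! i = [a, b, d] ! j \<Longrightarrow>
       \<omega> (cinv c z) (map (tvec M c (cinv c z)) [a, b, d]) = 0" for a b d i j
      by blast+
    show ?thesis
      using l[of 0] l[of 1] l[of 2] z[of 0 1] z[of 1 2] z[of 0 2]
      unfolding in_chart_def by (auto simp: numeral_2_eq_2)
  qed
  then show "\<forall>\<^sub>F z in nhds (cmap c p). (\<forall>y w. linear (\<lambda>x. in_chart M c \<omega> z [x, y, w])) \<and>
      (\<forall>x w. linear (\<lambda>y. in_chart M c \<omega> z [x, y, w])) \<and>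
      (\<forall>x y. linear (\<lambda>w. in_chart M c \<omega> z [x, y, w])) \<and>
      (\<forall>x y. in_chart M c \<omega> z [x, x, y] = 0 \<and> in_chart M c \<omega> z [x, y, y] = 0 \<and> in_chart M c \<omega> z [x, y, x] = 0)"
    using eventually_in_chart[OF M c] by (rule eventually_mono[rotated]) blast
  show "(\<lambda>z. in_chart M c \<omega> z [x, y, w]) differentiable (at (cmap c p))" for x y w
    using smooth_form_smooth_on[OF \<omega> charts_atD(1)[OF c], of "[x, y, w]"] charts_atD(2)[OF c]
    by (auto intro: smooth_on_differentiable)
qed

section \<open>Wedge products in low degrees\<close>

lemmas permutation_sum_simps = sum_over_permutations_insert sign_compose permutation_compose
  permutation_swap_id sign_swap_id transpose_def sign_id

lemma wedge_1_1:
  "wedge 1 1 a b [X, Y] = a [X] * b [Y] - a [Y] * b [X]"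
proof -
  \<comment> \<open>Building the index set by insertions lets the sum over permutations be expanded
    one element at a time.\<close>
  have "{..<1 + 1::nat} = insert 1 (insert 0 {})" by auto
  then show ?thesis
    unfolding wedge_def by (simp add: permutation_sum_simps)
qed

lemma wedge_2_1:
  "wedge 2 1 a b [X, Y, Z] = (a [X, Y] * b [Z] - a [Y, X] * b [Z] - a [X, Z] * b [Y] + a [Z, X] * b [Y]
     + a [Y, Z] * b [X] - a [Z, Y] * b [X]) / 2"
proof -
  have i: "{..<2 + 1::nat} = insert (Suc (Suc 0)) (insert (Suc 0) (insert 0 {}))" by auto
  have l: "[0..<2] = [0, Suc 0]" "[2..<2 + 1] = [Suc (Suc 0)]" by (simp_all add: upt_rec)
  show ?thesis
    unfolding wedge_def i l by (simp add: permutation_sum_simps algebra_simps)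
qed

text \<open>The 24 permutations divided by 2! 2! leave six shuffles, and complementary shuffles
  coincide because both factors are \<open>a\<close>. Antisymmetry is required only on the four
  arguments, since \<sigma> is antisymmetric only on tangent vectors.\<close>

lemma wedge_2_2:
  fixes a b :: "'t list \<Rightarrow> 'b::real_normed_field"
  assumes "\<And>x y. x \<in> {X, Y, Z, W} \<Longrightarrow> y \<in> {X, Y, Z, W} \<Longrightarrow> a [x, y] = - a [y, x]"
  shows "wedge 2 2 a a [X, Y, Z, W] = 2 * (a [X, Y] * a [Z, W] - a [X, Z] * a [Y, W] + a [X, W] * a [Y, Z])"
proof -
  have i: "{..<2 + 2::nat} = insert (Suc (Suc (Suc 0))) (insert (Suc (Suc 0)) (insert (Suc 0) (insert 0 {})))"
    by auto
  have l: "[0..<2] = [0, Suc 0]" "[2..<2 + 2] = [Suc (Suc 0), Suc (Suc (Suc 0))]" by (simp_all add: upt_rec)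
  have s: "a [Y, X] = - a [X, Y]" "a [Z, X] = - a [X, Z]" "a [W, X] = - a [X, W]" "a [Z, Y] = - a [Y, Z]"
    "a [W, Y] = - a [Y, W]" "a [W, Z] = - a [Z, W]"
    by (rule assms; simp)+
  show ?thesis
    unfolding wedge_def i l by (simp add: permutation_sum_simps s field_simps)
qed

section \<open>Torus actions in charts\<close>

text \<open>The coordinate expression is taken jointly in the Lie algebra variable and the point:
  the generator, its derivative and the differential of the flow are then all partial derivatives of
  one smooth function.\<close>

definition act_rep :: "(complex \<times> complex \<Rightarrow> 'a \<Rightarrow> 'a) \<Rightarrow> ('a, 'e) chart \<Rightarrow> ('a, 'e) chart \<Rightarrow>
    (real \<times> real) \<times> 'e \<Rightarrow> 'e" where
  "act_rep \<rho> c d y = cmap d (\<rho> (torus_exp (fst y)) (cinv c (snd y)))"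

definition act_dom :: "(complex \<times> complex \<Rightarrow> 'a \<Rightarrow> 'a) \<Rightarrow> ('a, 'e) chart \<Rightarrow> ('a, 'e) chart \<Rightarrow>
    ((real \<times> real) \<times> 'e) set" where
  "act_dom \<rho> c d = {y. snd y \<in> cmap c ` cdom c \<and> \<rho> (torus_exp (fst y)) (cinv c (snd y)) \<in> cdom d}"

lemma torus_exp_0: "torus_exp 0 = (1, 1)"
  by (simp add: torus_exp_def)

lemma torus_exp_in: "torus_exp \<xi> \<in> torus2"
  by (simp add: torus_exp_def torus2_def)

lemma torus_exp_commute:
  assumes "torus_action M \<rho>" "p \<in> points M"
  shows "\<rho> (torus_exp \<xi>) (\<rho> (torus_exp \<eta>) p) = \<rho> (torus_exp \<eta>) (\<rho> (torus_exp \<xi>) p)"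
proof -
  have "\<rho> (fst t * fst u, snd t * snd u) p = \<rho> t (\<rho> u p)" if "t \<in> torus2" "u \<in> torus2" for t u
    using assms that unfolding torus_action_def by blast
  from this[of "torus_exp \<xi>" "torus_exp \<eta>"] this[of "torus_exp \<eta>" "torus_exp \<xi>"]
  show ?thesis by (simp add: torus_exp_in mult.commute)
qed

lemma torus_exp_0_act: "torus_action M \<rho> \<Longrightarrow> p \<in> points M \<Longrightarrow> \<rho> (torus_exp 0) p = p"
  unfolding torus_action_def torus_exp_0 by blast

lemma act_continuous:
  assumes "torus_action M \<rho>"
  shows "continuous_map (prod_topology euclidean (mspace M)) (mspace M) (\<lambda>y. \<rho> (torus_exp (fst y)) (snd y))"
  using assms unfolding torus_action_def smooth_map_def algebra_times_def by (simp add: case_prod_unfold)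

lemma cinv_continuous:
  assumes M: "smooth_manifold M" and c: "c \<in> charts M"
  shows "continuous_map (top_of_set (cmap c ` cdom c)) (mspace M) (cinv c)"
  unfolding continuous_map_def
proof (intro conjI allI impI)
  show "cinv c \<in> topspace (top_of_set (cmap c ` cdom c)) \<rightarrow> topspace (mspace M)"
  proof
    fix z assume "z \<in> topspace (top_of_set (cmap c ` cdom c))"
    then show "cinv c z \<in> points M" using subsetD[OF chart_subset[OF M c] cinv_in[of z c]] by simp
  qed
  fix U assume U: "openin (mspace M) U"
  have "{z \<in> topspace (top_of_set (cmap c ` cdom c)). cinv c z \<in> U} = cmap c ` (U \<inter> cdom c)"
    by (auto simp: cinv_cmap[OF M c])
  then show "openin (top_of_set (cmap c ` cdom c)) {z \<in> topspace (top_of_set (cmap c ` cdom c)). cinv c z \<in> U}"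
    using open_subset[OF image_mono[OF Int_lower2] chart_image_open[OF M c U]] by simp
qed

lemma act_dom_open:
  assumes M: "smooth_manifold M" and \<rho>: "torus_action M \<rho>" and c: "c \<in> charts M" and d: "d \<in> charts M"
  shows "open (act_dom \<rho> c d)"
proof -
  let ?S = "cmap c ` cdom c"
  let ?X = "prod_topology (euclidean :: (real \<times> real) topology) (top_of_set ?S)"
  have "continuous_map ?X (mspace M) (\<lambda>y. cinv c (snd y))"
    using continuous_map_compose[OF continuous_map_snd cinv_continuous[OF M c]] by (simp add: o_def)
  then have "continuous_map ?X (prod_topology euclidean (mspace M)) (\<lambda>y. (fst y, cinv c (snd y)))"
    by (intro continuous_map_pairedI continuous_map_fst)
  from continuous_map_compose[OF this act_continuous[OF \<rho>]]
  have "continuous_map ?X (mspace M) (\<lambda>y. \<rho> (torus_exp (fst y)) (cinv c (snd y)))"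
    by (simp add: o_def)
  from openin_continuous_map_preimage[OF this chart_openin[OF M d]]
  have "openin ?X {y \<in> topspace ?X. \<rho> (torus_exp (fst y)) (cinv c (snd y)) \<in> cdom d}" .
  moreover have X: "?X = top_of_set (UNIV \<times> ?S)"
    using prod_topology_subtopology_eu[of UNIV ?S] by (simp only: subtopology_UNIV)
  moreover have "{y \<in> topspace ?X. \<rho> (torus_exp (fst y)) (cinv c (snd y)) \<in> cdom d} = act_dom \<rho> c d"
    unfolding X act_dom_def by (simp add: mem_Times_iff)
  ultimately have "openin (top_of_set (UNIV \<times> ?S)) (act_dom \<rho> c d)" by metis
  moreover have "open ((UNIV :: (real \<times> real) set) \<times> ?S)"
    by (intro open_Times open_UNIV chart_open_image[OF M c])
  ultimately show ?thesis by (rule openin_open_trans)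
qed

lemma act_rep_smooth:
  assumes M: "smooth_manifold M" and \<rho>: "torus_action M \<rho>" and c: "c \<in> charts M" and d: "d \<in> charts M"
  shows "smooth_on (act_dom \<rho> c d) (act_rep \<rho> c d)"
proof -
  define C where "C = ((UNIV :: (real \<times> real) set) \<times> cdom c, \<lambda>(\<xi>::real \<times> real, p). (\<xi>, cmap c p))"
  let ?F = "\<lambda>(\<xi>, p). \<rho> (torus_exp \<xi>) p"
  have "C \<in> charts (algebra_times M)" using c by (auto simp: algebra_times_def C_def)
  then have s: "smooth_on (cmap C ` {q \<in> cdom C. ?F q \<in> cdom d}) (cmap d \<circ> ?F \<circ> cinv C)"
    using \<rho> d unfolding torus_action_def smooth_map_def by blast
  have inj: "inj_on (cmap C) (cdom C)"
  proof (rule inj_onI)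
    fix x y assume "x \<in> cdom C" "y \<in> cdom C" "cmap C x = cmap C y"
    then have "fst x = fst y" "cmap c (snd x) = cmap c (snd y)" "snd x \<in> cdom c" "snd y \<in> cdom c"
      by (auto simp: C_def case_prod_unfold)
    then show "x = y" using cinv_cmap[OF M c] by (metis prod.expand)
  qed
  have set: "cmap C ` {q \<in> cdom C. ?F q \<in> cdom d} = act_dom \<rho> c d"
  proof (intro subset_antisym subsetI)
    fix y assume "y \<in> cmap C ` {q \<in> cdom C. ?F q \<in> cdom d}"
    then show "y \<in> act_dom \<rho> c d" by (auto simp: act_dom_def C_def cinv_cmap[OF M c])
  next
    fix y assume "y \<in> act_dom \<rho> c d"
    then have y: "snd y \<in> cmap c ` cdom c" "\<rho> (torus_exp (fst y)) (cinv c (snd y)) \<in> cdom d"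
      by (simp_all add: act_dom_def)
    show "y \<in> cmap C ` {q \<in> cdom C. ?F q \<in> cdom d}"
    proof (rule image_eqI)
      show "y = cmap C (fst y, cinv c (snd y))" by (simp add: C_def cmap_cinv[OF y(1)])
      show "(fst y, cinv c (snd y)) \<in> {q \<in> cdom C. ?F q \<in> cdom d}"
        using y(2) cinv_in[OF y(1)] by (simp add: C_def)
    qed
  qed
  \<comment> \<open>\<open>cinv C\<close> is an \<open>inv_into\<close>, so its values are known
    only on the image of the product chart; injectivity identifies it there with the identity times
    \<open>cinv c\<close>.\<close>
  have inv: "cinv C y = (fst y, cinv c (snd y))" if "y \<in> act_dom \<rho> c d" for y
  proof -
    have y: "snd y \<in> cmap c ` cdom c" using that by (simp add: act_dom_def)
    have "cmap C (fst y, cinv c (snd y)) = y" "(fst y, cinv c (snd y)) \<in> cdom C"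
      using cmap_cinv[OF y] cinv_in[OF y] by (simp_all add: C_def)
    then show ?thesis unfolding cinv_def[of C] using inv_into_f_f[OF inj] by metis
  qed
  show ?thesis
    unfolding smooth_on_def
  proof
    fix k
    have "Ck_on k (act_dom \<rho> c d) (cmap d \<circ> ?F \<circ> cinv C)"
      using s unfolding smooth_on_def set by blast
    then show "Ck_on k (act_dom \<rho> c d) (act_rep \<rho> c d)"
      by (rule Ck_on_cong[OF act_dom_open[OF M \<rho> c d]]) (simp add: inv act_rep_def)
  qed
qed

lemma act_diff_map:
  assumes M: "smooth_manifold M" and \<rho>: "torus_action M \<rho>"
  shows "diff_map M M (\<rho> (torus_exp \<xi>))"
  unfolding diff_map_def
proof (intro conjI ballI impI)
  have "continuous_map (mspace M) (prod_topology euclidean (mspace M)) (\<lambda>p. (\<xi>, p))"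
    by (intro continuous_map_pairedI) auto
  from continuous_map_compose[OF this act_continuous[OF \<rho>]]
  show "continuous_map (mspace M) (mspace M) (\<rho> (torus_exp \<xi>))" by (simp add: o_def)
  fix c d p assume c: "c \<in> charts M" and d: "d \<in> charts M" and p: "p \<in> cdom c" "\<rho> (torus_exp \<xi>) p \<in> cdom d"
  have "(\<xi>, cmap c p) \<in> act_dom \<rho> c d" using p cinv_cmap[OF M c] by (simp add: act_dom_def)
  note der = D_works[OF smooth_on_differentiable[OF act_rep_smooth[OF M \<rho> c d] this]]
  have "((\<lambda>z. act_rep \<rho> c d (\<xi>, z)) has_derivative
      (\<lambda>x. D (act_rep \<rho> c d) (\<xi>, cmap c p) (0, x))) (at (cmap c p))"
    by (rule has_derivative_compose[where g = "act_rep \<rho> c d" and f = "\<lambda>z. (\<xi>, z)", OF _ der])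
      (auto intro!: derivative_eq_intros)
  then show "local_rep c d (\<rho> (torus_exp \<xi>)) differentiable (at (cmap c p))"
    using differentiableI by (fastforce simp: act_rep_def o_def)
qed

text \<open>In a chart, a generator is the derivative of the action in the Lie algebra direction. Its own
  derivative is \<open>gen_deriv\<close>, which by symmetry of second derivatives is also the time derivative
  of the differential of the flow.\<close>

definition gen_rep :: "(complex \<times> complex \<Rightarrow> 'a \<Rightarrow> 'a) \<Rightarrow> ('a, 'e::euclidean_space) chart \<Rightarrow> real \<times> real \<Rightarrow>
    'e \<Rightarrow> 'e" where
  "gen_rep \<rho> c \<xi> z = D (act_rep \<rho> c c) (0, z) (\<xi>, 0)"

definition gen_deriv :: "(complex \<times> complex \<Rightarrow> 'a \<Rightarrow> 'a) \<Rightarrow> ('a, 'e::euclidean_space) chart \<Rightarrow> real \<times> real \<Rightarrow>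
    'e \<Rightarrow> 'e \<Rightarrow> 'e" where
  "gen_deriv \<rho> c \<xi> z x = D (\<lambda>y. D (act_rep \<rho> c c) y (\<xi>, 0)) (0, z) (0, x)"

locale torus_chart =
  fixes M :: "('a, 'e::euclidean_space) mfd" and \<rho> :: "complex \<times> complex \<Rightarrow> 'a \<Rightarrow> 'a"
    and p :: 'a and c :: "('a, 'e) chart"
  assumes M: "smooth_manifold M" and \<rho>: "torus_action M \<rho>" and c: "c \<in> charts_at M p"
begin

lemma c': "c \<in> charts M" and p_cdom: "p \<in> cdom c"
  using charts_atD[OF c] by auto

lemma p_points: "p \<in> points M"
  using chart_subset[OF M c'] p_cdom by blast

lemma act_derivative:
  "y \<in> act_dom \<rho> c c \<Longrightarrow> (act_rep \<rho> c c has_derivative D (act_rep \<rho> c c) y) (at y)"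
  by (rule D_works[OF smooth_on_differentiable[OF act_rep_smooth[OF M \<rho> c' c']]])

lemma act_derivative2:
  "y \<in> act_dom \<rho> c c \<Longrightarrow> ((\<lambda>y. D (act_rep \<rho> c c) y v) has_derivative D (\<lambda>y. D (act_rep \<rho> c c) y v) y) (at y)"
  by (rule D_works[OF smooth_on_differentiable[OF smooth_on_D[OF act_rep_smooth[OF M \<rho> c' c']]]])

lemma cinv_points: "z \<in> cmap c ` cdom c \<Longrightarrow> cinv c z \<in> points M"
  by (rule subsetD[OF chart_subset[OF M c'] cinv_in])

lemma zero_in_dom: "z \<in> cmap c ` cdom c \<Longrightarrow> (0, z) \<in> act_dom \<rho> c c"
  by (simp add: act_dom_def torus_exp_0_act[OF \<rho> cinv_points] cinv_in)

lemma act_zero: "z \<in> cmap c ` cdom c \<Longrightarrow> act_rep \<rho> c c (0, z) = z"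
  by (simp add: act_rep_def torus_exp_0_act[OF \<rho> cinv_points] cmap_cinv)

lemma p_image: "cmap c p \<in> cmap c ` cdom c"
  using p_cdom by simp

lemma dom_eventually: "\<forall>\<^sub>F t in nhds (0::real). (t *\<^sub>R \<xi>, cmap c p) \<in> act_dom \<rho> c c"
proof (rule eventually_nhds_compose[where \<phi> = "\<lambda>t::real. (t *\<^sub>R \<xi>, cmap c p)" and P = "\<lambda>y. y \<in> act_dom \<rho> c c"])
  show "\<forall>\<^sub>F z in nhds (0 *\<^sub>R \<xi>, cmap c p). z \<in> act_dom \<rho> c c"
    using act_dom_open[OF M \<rho> c' c'] zero_in_dom[OF p_image]
    by (intro eventually_nhds_in_open) auto
  show "((\<lambda>t::real. (t *\<^sub>R \<xi>, cmap c p)) has_derivative (\<lambda>h. (h *\<^sub>R \<xi>, 0))) (at 0)"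
    by (auto intro!: derivative_eq_intros)
qed

lemma act_curve_derivative:
  assumes "z \<in> cmap c ` cdom c"
  shows "((\<lambda>t::real. act_rep \<rho> c c (t *\<^sub>R \<xi>, z)) has_derivative (\<lambda>h. h *\<^sub>R gen_rep \<rho> c \<xi> z)) (at 0)"
proof -
  have d: "(act_rep \<rho> c c has_derivative D (act_rep \<rho> c c) (0, z)) (at (0 *\<^sub>R \<xi>, z))"
    using act_derivative[OF zero_in_dom[OF assms]] by simp
  have "((\<lambda>t::real. act_rep \<rho> c c (t *\<^sub>R \<xi>, z)) has_derivative (\<lambda>h. D (act_rep \<rho> c c) (0, z) (h *\<^sub>R \<xi>, 0))) (at 0)"
    by (rule has_derivative_compose[where g = "act_rep \<rho> c c" and f = "\<lambda>t. (t *\<^sub>R \<xi>, z)", OF _ d])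
      (auto intro!: derivative_eq_intros)
  moreover have "D (act_rep \<rho> c c) (0, z) (h *\<^sub>R \<xi>, 0) = h *\<^sub>R gen_rep \<rho> c \<xi> z" for h
    using linear_scale[OF has_derivative_linear[OF d], of h "(\<xi>, 0)"] by (simp add: gen_rep_def)
  ultimately show ?thesis by simp
qed

lemma generator_in_chart: "generator M \<rho> \<xi> p c = gen_rep \<rho> c \<xi> (cmap c p)"
proof -
  have "((\<lambda>t::real. act_rep \<rho> c c (t *\<^sub>R \<xi>, cmap c p)) has_vector_derivative gen_rep \<rho> c \<xi> (cmap c p)) (at 0)"
    using act_curve_derivative[OF p_image] by (simp add: has_vector_derivative_def)
  then show ?thesis
    using c cinv_cmap[OF M c' p_cdom]
    by (simp add: generator_def act_rep_def vector_derivative_at)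
qed

lemma gen_rep_uminus: "z \<in> cmap c ` cdom c \<Longrightarrow> gen_rep \<rho> c (- \<xi>) z = - gen_rep \<rho> c \<xi> z"
  using linear_neg[OF has_derivative_linear[OF act_derivative[OF zero_in_dom]], of z "(\<xi>, 0)"]
  by (simp add: gen_rep_def)

lemma gen_rep_derivative:
  "(gen_rep \<rho> c \<xi> has_derivative gen_deriv \<rho> c \<xi> (cmap c p)) (at (cmap c p))"
proof -
  have "((\<lambda>z. D (act_rep \<rho> c c) (0, z) (\<xi>, 0)) has_derivative
      (\<lambda>x. D (\<lambda>y. D (act_rep \<rho> c c) y (\<xi>, 0)) (0, cmap c p) (0, x))) (at (cmap c p))"
    by (rule has_derivative_compose[where g = "\<lambda>y. D (act_rep \<rho> c c) y (\<xi>, 0)" and f = "\<lambda>z. (0, z)",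
          OF _ act_derivative2[OF zero_in_dom[OF p_image]]])
      (auto intro!: derivative_eq_intros)
  then show ?thesis by (simp add: gen_rep_def[abs_def] gen_deriv_def[abs_def])
qed

lemma flow_derivative_derivative:
  "((\<lambda>t::real. D (act_rep \<rho> c c) (t *\<^sub>R \<xi>, cmap c p) (0, x)) has_derivative
     (\<lambda>h. h *\<^sub>R gen_deriv \<rho> c \<xi> (cmap c p) x)) (at 0)"
proof -
  let ?A = "act_rep \<rho> c c"
  have d: "((\<lambda>y. D ?A y (0, x)) has_derivative D (\<lambda>y. D ?A y (0, x)) (0, cmap c p)) (at (0 *\<^sub>R \<xi>, cmap c p))"
    using act_derivative2[OF zero_in_dom[OF p_image]] by simp
  have "((\<lambda>t::real. D ?A (t *\<^sub>R \<xi>, cmap c p) (0, x)) has_derivative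
      (\<lambda>h. D (\<lambda>y. D ?A y (0, x)) (0, cmap c p) (h *\<^sub>R \<xi>, 0))) (at 0)"
    by (rule has_derivative_compose[where g = "\<lambda>y. D ?A y (0, x)" and f = "\<lambda>t. (t *\<^sub>R \<xi>, cmap c p)", OF _ d])
      (auto intro!: derivative_eq_intros)
  moreover have "D (\<lambda>y. D ?A y (0, x)) (0, cmap c p) (h *\<^sub>R \<xi>, 0) = h *\<^sub>R gen_deriv \<rho> c \<xi> (cmap c p) x" for h
  proof -
    have "D (\<lambda>y. D ?A y (0, x)) (0, cmap c p) (h *\<^sub>R \<xi>, 0) = h *\<^sub>R D (\<lambda>y. D ?A y (0, x)) (0, cmap c p) (\<xi>, 0)"
      using linear_scale[OF has_derivative_linear[OF d], of h "(\<xi>, 0)"] by simp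
    also have "\<dots> = h *\<^sub>R gen_deriv \<rho> c \<xi> (cmap c p) x"
      unfolding gen_deriv_def
      using symmetric_D[OF act_rep_smooth[OF M \<rho> c' c'] act_dom_open[OF M \<rho> c' c'] zero_in_dom[OF p_image]]
      by metis
    finally show ?thesis .
  qed
  ultimately show ?thesis by simp
qed

lemma flow_derivative_zero: "D (act_rep \<rho> c c) (0, cmap c p) (0, x) = x"
proof -
  have "((\<lambda>z. act_rep \<rho> c c (0, z)) has_derivative (\<lambda>x. D (act_rep \<rho> c c) (0, cmap c p) (0, x))) (at (cmap c p))"
    by (rule has_derivative_compose[where g = "act_rep \<rho> c c" and f = "\<lambda>z. (0, z)",
          OF _ act_derivative[OF zero_in_dom[OF p_image]]])
      (auto intro!: derivative_eq_intros)
  then have "((\<lambda>z. z) has_derivative (\<lambda>x. D (act_rep \<rho> c c) (0, cmap c p) (0, x))) (at (cmap c p))"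
    by (rule has_derivative_transform_within_open[OF _ chart_open_image[OF M c'] p_image])
      (simp add: act_zero)
  then show ?thesis using has_derivative_unique[OF has_derivative_ident] by metis
qed

lemma local_rep_act:
  assumes "(\<xi>, cmap c p) \<in> act_dom \<rho> c c"
  shows "D (local_rep c c (\<rho> (torus_exp \<xi>))) (cmap c p) x = D (act_rep \<rho> c c) (\<xi>, cmap c p) (0, x)"
proof -
  have "((\<lambda>z. act_rep \<rho> c c (\<xi>, z)) has_derivative
      (\<lambda>x. D (act_rep \<rho> c c) (\<xi>, cmap c p) (0, x))) (at (cmap c p))"
    by (rule has_derivative_compose[where g = "act_rep \<rho> c c" and f = "\<lambda>z. (\<xi>, z)", OF _ act_derivative[OF assms]])
      (auto intro!: derivative_eq_intros)
  then have "(local_rep c c (\<rho> (torus_exp \<xi>)) has_derivative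
      (\<lambda>x. D (act_rep \<rho> c c) (\<xi>, cmap c p) (0, x))) (at (cmap c p))"
    by (simp add: act_rep_def o_def)
  then show ?thesis using D_eqI by metis
qed

lemma invariant_form_in_chart:
  assumes inv: "form_eq M k (pullback M M (\<rho> (torus_exp \<xi>)) \<omega>) \<omega>"
    and y: "(\<xi>, cmap c p) \<in> act_dom \<rho> c c" and xs: "length xs = k"
  shows "in_chart M c \<omega> (act_rep \<rho> c c (\<xi>, cmap c p)) (map (\<lambda>x. D (act_rep \<rho> c c) (\<xi>, cmap c p) (0, x)) xs)
    = in_chart M c \<omega> (cmap c p) xs"
proof -
  have d: "c \<in> charts_at M (\<rho> (torus_exp \<xi>) p)"
    using y c' cinv_cmap[OF M c' p_cdom] by (simp add: act_dom_def charts_at_def)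
  have "pullback M M (\<rho> (torus_exp \<xi>)) \<omega> p (map (tvec M c p) xs) = \<omega> p (map (tvec M c p) xs)"
  proof (rule inv[unfolded form_eq_def, rule_format, OF p_points])
    show "length (map (tvec M c p) xs) = k \<and> set (map (tvec M c p) xs) \<subseteq> tangent_space M p"
      using tvec_in_tangent_space[OF M c] xs by auto
  qed
  then show ?thesis
    unfolding pullback_in_chart[OF M M act_diff_map[OF M \<rho>] c d] in_chart_cmap[OF M c]
    by (simp add: local_rep_act[OF y, abs_def] act_rep_def)
qed

text \<open>Invariance makes the form at the flowed point, evaluated on the flowed vectors, constant
  in time. Its derivative at time 0 is the coordinate Lie derivative, because
  \<open>gen_deriv\<close> is the time derivative of the differential of the flow.
  \<open>Lie_form3\<close> is the analogue for three arguments.\<close>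

lemma Lie_form2:
  assumes \<omega>: "form2_at (cmap c p) (\<lambda>z x y. in_chart M c \<omega> z [x, y])"
    and inv: "\<And>\<xi>. form_eq M 2 (pullback M M (\<rho> (torus_exp \<xi>)) \<omega>) \<omega>"
  shows "D (\<lambda>z. in_chart M c \<omega> z [x, y]) (cmap c p) (gen_rep \<rho> c \<xi> (cmap c p))
    + in_chart M c \<omega> (cmap c p) [gen_deriv \<rho> c \<xi> (cmap c p) x, y]
    + in_chart M c \<omega> (cmap c p) [x, gen_deriv \<rho> c \<xi> (cmap c p) y] = 0"
proof -
  let ?A = "act_rep \<rho> c c" and ?z = "cmap c p"
  let ?X = "\<lambda>x t::real. D ?A (t *\<^sub>R \<xi>, ?z) (0, x)"
  have A0: "?A (0 *\<^sub>R \<xi>, ?z) = ?z" using act_zero[OF p_image] by simp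
  have X0: "?X x 0 = x" for x using flow_derivative_zero by simp
  note d = form2_compose[where \<phi> = "\<lambda>t. ?A (t *\<^sub>R \<xi>, ?z)" and ?w0.0 = 0, unfolded A0, OF \<omega>
      act_curve_derivative[OF p_image] flow_derivative_derivative[of \<xi> x] flow_derivative_derivative[of \<xi> y],
      unfolded X0]
  have "((\<lambda>t::real. in_chart M c \<omega> ?z [x, y]) has_derivative
      (\<lambda>h. D (\<lambda>z. in_chart M c \<omega> z [x, y]) ?z (h *\<^sub>R gen_rep \<rho> c \<xi> ?z)
        + in_chart M c \<omega> ?z [h *\<^sub>R gen_deriv \<rho> c \<xi> ?z x, y]
        + in_chart M c \<omega> ?z [x, h *\<^sub>R gen_deriv \<rho> c \<xi> ?z y])) (at 0)"
  proof (rule has_derivative_transform_eventually[OF d])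
    have "\<forall>\<^sub>F t in nhds (0::real). in_chart M c \<omega> (?A (t *\<^sub>R \<xi>, ?z)) [?X x t, ?X y t] = in_chart M c \<omega> ?z [x, y]"
      using dom_eventually[of \<xi>]
    proof (rule eventually_mono)
      fix t assume "(t *\<^sub>R \<xi>, ?z) \<in> act_dom \<rho> c c"
      from invariant_form_in_chart[OF inv this, of "[x, y]"]
      show "in_chart M c \<omega> (?A (t *\<^sub>R \<xi>, ?z)) [?X x t, ?X y t] = in_chart M c \<omega> ?z [x, y]" by simp
    qed
    then show "\<forall>\<^sub>F t in at 0. in_chart M c \<omega> (?A (t *\<^sub>R \<xi>, ?z)) [?X x t, ?X y t] = in_chart M c \<omega> ?z [x, y]"
      unfolding eventually_at_filter by (rule eventually_mono) simp
  qed (use A0 X0 in simp_all)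
  from fun_cong[OF has_derivative_unique[OF this has_derivative_const], of 1] show ?thesis by simp
qed

lemma Lie_form3:
  assumes \<omega>: "form3_at (cmap c p) (\<lambda>z x y w. in_chart M c \<omega> z [x, y, w])"
    and inv: "\<And>\<xi>. form_eq M 3 (pullback M M (\<rho> (torus_exp \<xi>)) \<omega>) \<omega>"
  shows "D (\<lambda>z. in_chart M c \<omega> z [x, y, w]) (cmap c p) (gen_rep \<rho> c \<xi> (cmap c p))
    + in_chart M c \<omega> (cmap c p) [gen_deriv \<rho> c \<xi> (cmap c p) x, y, w]
    + in_chart M c \<omega> (cmap c p) [x, gen_deriv \<rho> c \<xi> (cmap c p) y, w]
    + in_chart M c \<omega> (cmap c p) [x, y, gen_deriv \<rho> c \<xi> (cmap c p) w] = 0"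
proof -
  let ?A = "act_rep \<rho> c c" and ?z = "cmap c p"
  let ?X = "\<lambda>x t::real. D ?A (t *\<^sub>R \<xi>, ?z) (0, x)"
  have A0: "?A (0 *\<^sub>R \<xi>, ?z) = ?z" using act_zero[OF p_image] by simp
  have X0: "?X x 0 = x" for x using flow_derivative_zero by simp
  note d = form3_compose[where \<phi> = "\<lambda>t. ?A (t *\<^sub>R \<xi>, ?z)" and ?w0.0 = 0, unfolded A0, OF \<omega>
      act_curve_derivative[OF p_image] flow_derivative_derivative[of \<xi> x] flow_derivative_derivative[of \<xi> y]
      flow_derivative_derivative[of \<xi> w], unfolded X0]
  have "((\<lambda>t::real. in_chart M c \<omega> ?z [x, y, w]) has_derivative
      (\<lambda>h. D (\<lambda>z. in_chart M c \<omega> z [x, y, w]) ?z (h *\<^sub>R gen_rep \<rho> c \<xi> ?z)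
        + in_chart M c \<omega> ?z [h *\<^sub>R gen_deriv \<rho> c \<xi> ?z x, y, w]
        + in_chart M c \<omega> ?z [x, h *\<^sub>R gen_deriv \<rho> c \<xi> ?z y, w]
        + in_chart M c \<omega> ?z [x, y, h *\<^sub>R gen_deriv \<rho> c \<xi> ?z w])) (at 0)"
  proof (rule has_derivative_transform_eventually[OF d])
    have "\<forall>\<^sub>F t in nhds (0::real). in_chart M c \<omega> (?A (t *\<^sub>R \<xi>, ?z)) [?X x t, ?X y t, ?X w t]
        = in_chart M c \<omega> ?z [x, y, w]"
      using dom_eventually[of \<xi>]
    proof (rule eventually_mono)
      fix t assume "(t *\<^sub>R \<xi>, ?z) \<in> act_dom \<rho> c c"
      from invariant_form_in_chart[OF inv this, of "[x, y, w]"]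
      show "in_chart M c \<omega> (?A (t *\<^sub>R \<xi>, ?z)) [?X x t, ?X y t, ?X w t] = in_chart M c \<omega> ?z [x, y, w]" by simp
    qed
    then show "\<forall>\<^sub>F t in at 0. in_chart M c \<omega> (?A (t *\<^sub>R \<xi>, ?z)) [?X x t, ?X y t, ?X w t]
        = in_chart M c \<omega> ?z [x, y, w]"
      unfolding eventually_at_filter by (rule eventually_mono) simp
  qed (use A0 X0 in simp_all)
  from fun_cong[OF has_derivative_unique[OF this has_derivative_const], of 1] show ?thesis by simp
qed

text \<open>The bracket vanishes because the torus is abelian: the flow of \<open>\<xi>\<close>
  carries the generator of \<open>\<eta>\<close> to itself, and the derivative of this invariance at
  time 0 is the claim.\<close>

lemma gen_commute:
  "gen_deriv \<rho> c \<xi> (cmap c p) (gen_rep \<rho> c \<eta> (cmap c p)) = gen_deriv \<rho> c \<eta> (cmap c p) (gen_rep \<rho> c \<xi> (cmap c p))"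
proof -
  let ?A = "act_rep \<rho> c c" and ?z = "cmap c p"
  have inv: "cinv c ?z = p" using cinv_cmap[OF M c' p_cdom] .
  \<comment> \<open>Invariance of the generator of \<open>\<eta>\<close> under the flow of
    \<open>\<xi>\<close>: the two orders of composing the flows agree, and their derivatives in the
    time \<open>r\<close> of the flow of \<open>\<eta>\<close> are compared.\<close>
  have eq: "gen_rep \<rho> c \<eta> (?A (t *\<^sub>R \<xi>, ?z)) = D ?A (t *\<^sub>R \<xi>, ?z) (0, gen_rep \<rho> c \<eta> ?z)"
    if t: "(t *\<^sub>R \<xi>, ?z) \<in> act_dom \<rho> c c" for t
  proof -
    let ?q = "\<rho> (torus_exp (t *\<^sub>R \<xi>)) p"
    have q: "?q \<in> cdom c" "?A (t *\<^sub>R \<xi>, ?z) = cmap c ?q"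
      using t inv by (simp_all add: act_dom_def act_rep_def)
    have "((\<lambda>r::real. ?A (r *\<^sub>R \<eta>, ?A (t *\<^sub>R \<xi>, ?z))) has_derivative
        (\<lambda>h. h *\<^sub>R gen_rep \<rho> c \<eta> (?A (t *\<^sub>R \<xi>, ?z)))) (at 0)"
      by (rule act_curve_derivative) (use q in simp)
    moreover have "((\<lambda>r::real. ?A (r *\<^sub>R \<eta>, ?A (t *\<^sub>R \<xi>, ?z))) has_derivative
        (\<lambda>h. D ?A (t *\<^sub>R \<xi>, ?z) (0, h *\<^sub>R gen_rep \<rho> c \<eta> ?z))) (at 0)"
    proof (rule has_derivative_transform_eventually)
      have d: "(?A has_derivative D ?A (t *\<^sub>R \<xi>, ?z)) (at (t *\<^sub>R \<xi>, ?A (0 *\<^sub>R \<eta>, ?z)))"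
        using act_derivative[OF t] act_zero[OF p_image] by simp
      show "((\<lambda>r::real. ?A (t *\<^sub>R \<xi>, ?A (r *\<^sub>R \<eta>, ?z))) has_derivative
        (\<lambda>h. D ?A (t *\<^sub>R \<xi>, ?z) (0, h *\<^sub>R gen_rep \<rho> c \<eta> ?z))) (at 0)"
        by (rule has_derivative_compose[where g = ?A and f = "\<lambda>r. (t *\<^sub>R \<xi>, ?A (r *\<^sub>R \<eta>, ?z))", OF _ d])
          (intro has_derivative_Pair has_derivative_const act_curve_derivative p_image)
      have *: "?A (t *\<^sub>R \<xi>, ?A (r *\<^sub>R \<eta>, ?z)) = ?A (r *\<^sub>R \<eta>, ?A (t *\<^sub>R \<xi>, ?z))"
        if "(r *\<^sub>R \<eta>, ?z) \<in> act_dom \<rho> c c" for r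
        using that t cinv_cmap[OF M c'] torus_exp_commute[OF \<rho> p_points]
        by (simp add: act_dom_def act_rep_def inv)
      show "\<forall>\<^sub>F r in at 0. ?A (t *\<^sub>R \<xi>, ?A (r *\<^sub>R \<eta>, ?z)) = ?A (r *\<^sub>R \<eta>, ?A (t *\<^sub>R \<xi>, ?z))"
        using dom_eventually[of \<eta>] unfolding eventually_at_filter
        by (rule eventually_mono) (simp add: *)
      show "?A (t *\<^sub>R \<xi>, ?A (0 *\<^sub>R \<eta>, ?z)) = ?A (0 *\<^sub>R \<eta>, ?A (t *\<^sub>R \<xi>, ?z))"
        by (rule *) (use zero_in_dom[OF p_image] in simp)
    qed simp
    ultimately have "(\<lambda>h. h *\<^sub>R gen_rep \<rho> c \<eta> (?A (t *\<^sub>R \<xi>, ?z))) =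
        (\<lambda>h. D ?A (t *\<^sub>R \<xi>, ?z) (0, h *\<^sub>R gen_rep \<rho> c \<eta> ?z))"
      by (rule has_derivative_unique)
    from fun_cong[OF this, of 1] show ?thesis by simp
  qed
  have g: "(gen_rep \<rho> c \<eta> has_derivative gen_deriv \<rho> c \<eta> ?z) (at (?A (0 *\<^sub>R \<xi>, ?z)))"
    using gen_rep_derivative act_zero[OF p_image] by simp
  \<comment> \<open>The left-hand side of \<open>eq\<close> is differentiated at time 0 by the chain
    rule; the next step differentiates the right-hand side, where the differential of the flow acts
    on a fixed vector.\<close>
  have "((\<lambda>t::real. gen_rep \<rho> c \<eta> (?A (t *\<^sub>R \<xi>, ?z))) has_derivative
      (\<lambda>h. gen_deriv \<rho> c \<eta> ?z (h *\<^sub>R gen_rep \<rho> c \<xi> ?z))) (at 0)"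
    by (rule has_derivative_compose[OF act_curve_derivative[OF p_image] g])
  moreover have "((\<lambda>t::real. gen_rep \<rho> c \<eta> (?A (t *\<^sub>R \<xi>, ?z))) has_derivative
      (\<lambda>h. h *\<^sub>R gen_deriv \<rho> c \<xi> ?z (gen_rep \<rho> c \<eta> ?z))) (at 0)"
  proof (rule has_derivative_transform_eventually[OF flow_derivative_derivative])
    show "\<forall>\<^sub>F t in at 0. D ?A (t *\<^sub>R \<xi>, ?z) (0, gen_rep \<rho> c \<eta> ?z) = gen_rep \<rho> c \<eta> (?A (t *\<^sub>R \<xi>, ?z))"
      using dom_eventually[of \<xi>] unfolding eventually_at_filter
      by (rule eventually_mono) (simp add: eq)
    show "D ?A (0 *\<^sub>R \<xi>, ?z) (0, gen_rep \<rho> c \<eta> ?z) = gen_rep \<rho> c \<eta> (?A (0 *\<^sub>R \<xi>, ?z))"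
      by (rule eq[symmetric]) (use zero_in_dom[OF p_image] in simp)
  qed simp
  ultimately have "(\<lambda>h. gen_deriv \<rho> c \<eta> ?z (h *\<^sub>R gen_rep \<rho> c \<xi> ?z)) =
      (\<lambda>h. h *\<^sub>R gen_deriv \<rho> c \<xi> ?z (gen_rep \<rho> c \<eta> ?z))"
    by (rule has_derivative_unique)
  from fun_cong[OF this, of 1] show ?thesis by simp
qed

end

text \<open>\<open>generator\<close> takes a separate derivative in every chart. For short times the
  orbit curves in two charts differ by the change of coordinates, so the chain rule makes these
  derivatives the coordinates of one tangent vector.\<close>

lemma generator_tangent:
  assumes M: "smooth_manifold M" and \<rho>: "torus_action M \<rho>" and c: "c \<in> charts_at M p"
  shows "generator M \<rho> \<xi> p = tvec M c p (gen_rep \<rho> c \<xi> (cmap c p))"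
proof
  fix d
  show "generator M \<rho> \<xi> p d = tvec M c p (gen_rep \<rho> c \<xi> (cmap c p)) d"
  proof (cases "d \<in> charts_at M p")
    case d: True
    interpret C: torus_chart M \<rho> p c by unfold_locales (use assms in auto)
    interpret D: torus_chart M \<rho> p d by unfold_locales (use assms d in auto)
    note idM = smooth_map_diff_map[OF smooth_map_ident[OF M]]
    have A0: "act_rep \<rho> c c (0 *\<^sub>R \<xi>, cmap c p) = cmap c p" using C.act_zero[OF C.p_image] by simp
    have g: "(local_rep c d (\<lambda>p. p) has_derivative D (local_rep c d (\<lambda>p. p)) (cmap c p))
        (at (act_rep \<rho> c c (0 *\<^sub>R \<xi>, cmap c p)))"
      unfolding A0 using D_works[OF diff_mapD[OF idM c, of d]] d by simp
    note chain = has_derivative_compose[OF C.act_curve_derivative[OF C.p_image] g]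
    have *: "local_rep c d (\<lambda>p. p) (act_rep \<rho> c c (t *\<^sub>R \<xi>, cmap c p)) = act_rep \<rho> d d (t *\<^sub>R \<xi>, cmap d p)"
      if "(t *\<^sub>R \<xi>, cmap c p) \<in> act_dom \<rho> c c" for t
      using that cinv_cmap[OF M C.c'] cinv_cmap[OF M D.c'] C.p_cdom D.p_cdom
      by (simp add: act_dom_def act_rep_def)
    have "((\<lambda>t::real. act_rep \<rho> d d (t *\<^sub>R \<xi>, cmap d p)) has_derivative
        (\<lambda>h. D (local_rep c d (\<lambda>p. p)) (cmap c p) (h *\<^sub>R gen_rep \<rho> c \<xi> (cmap c p)))) (at 0)"
    proof (rule has_derivative_transform_eventually[OF chain])
      show "\<forall>\<^sub>F t in at 0. local_rep c d (\<lambda>p. p) (act_rep \<rho> c c (t *\<^sub>R \<xi>, cmap c p))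
          = act_rep \<rho> d d (t *\<^sub>R \<xi>, cmap d p)"
        using C.dom_eventually[of \<xi>] unfolding eventually_at_filter
        by (rule eventually_mono) (use * in blast)
      show "local_rep c d (\<lambda>p. p) (act_rep \<rho> c c (0 *\<^sub>R \<xi>, cmap c p)) = act_rep \<rho> d d (0 *\<^sub>R \<xi>, cmap d p)"
        by (rule *) (use C.zero_in_dom[OF C.p_image] in simp)
    qed simp
    from fun_cong[OF has_derivative_unique[OF this D.act_curve_derivative[OF D.p_image]], of 1]
    show ?thesis using D.generator_in_chart tvec_apply[OF d] by simp
  qed (simp add: generator_def tvec_def)
qed

section \<open>Nearly Kaehler torus actions in charts\<close>

lemma wedge_1_1_1:
  "wedge 2 1 (wedge 1 1 a b) d [X, Y, Z] = a [X] * (b [Y] * d [Z] - d [Y] * b [Z])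
    - b [X] * (a [Y] * d [Z] - d [Y] * a [Z]) + d [X] * (a [Y] * b [Z] - b [Y] * a [Z])"
  unfolding wedge_2_1 wedge_1_1 by (simp add: field_simps)

locale nearly_kaehler_torus =
  fixes M :: "('a, real^6) mfd"
    and g :: "('a, real^6) bilinear_field"
    and J :: "('a, real^6) endo_field"
    and psi_re psi_im :: "('a, real^6) form"
    and \<rho> :: "complex \<times> complex \<Rightarrow> 'a \<Rightarrow> 'a"
  assumes M: "smooth_manifold M"
    and nearly_kaehler: "nearly_kaehler M g J psi_re psi_im"
    and torus_action: "torus_action M \<rho>"
    and preserves: "preserves_structure M g J psi_re psi_im \<rho>"
begin

abbreviation "\<sigma> \<equiv> fundamental_form g J"

abbreviation "Gc c z x y \<equiv> g (cinv c z) (tvec M c (cinv c z) x) (tvec M c (cinv c z) y)"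
abbreviation "Sc c z x y \<equiv> in_chart M c \<sigma> z [x, y]"
abbreviation "Pc c z x y w \<equiv> in_chart M c psi_re z [x, y, w]"
abbreviation "Qc c z x y w \<equiv> in_chart M c psi_im z [x, y, w]"

lemma su3: "su3_structure M g J psi_re psi_im"
  using nearly_kaehler unfolding nearly_kaehler_def by blast

lemma metric: "riemannian_metric M g" and almost_complex: "almost_complex_structure M J"
  and forms: "smooth_form M 3 psi_re" "smooth_form M 3 psi_im"
  using su3 unfolding su3_structure_def by blast+

lemma J_isometry:
  "p \<in> points M \<Longrightarrow> X \<in> tangent_space M p \<Longrightarrow> Y \<in> tangent_space M p \<Longrightarrow> g p (J p X) (J p Y) = g p X Y"
  using su3 unfolding su3_structure_def by blast

lemma g_commute:
  "p \<in> points M \<Longrightarrow> X \<in> tangent_space M p \<Longrightarrow> Y \<in> tangent_space M p \<Longrightarrow> g p X Y = g p Y X"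
  using metric unfolding riemannian_metric_def by blast

lemma J_tangent:
  assumes "p \<in> points M" "X \<in> tangent_space M p"
  shows "J p X \<in> tangent_space M p" "J p (J p X) = - X"
  using almost_complex assms unfolding almost_complex_structure_def by blast+

lemma g_bilinear: "p \<in> points M \<Longrightarrow> c \<in> charts_at M p \<Longrightarrow> bilinear (\<lambda>x y. g p (tvec M c p x) (tvec M c p y))"
  using metric unfolding riemannian_metric_def by blast

lemma g_uminus:
  assumes "p \<in> points M" "X \<in> tangent_space M p" "Y \<in> tangent_space M p"
  shows "g p (- X) Y = - g p X Y"
proof -
  note c = chart_at_charts_at[OF M assms(1)]
  show ?thesis
    using bilinear_lneg[OF g_bilinear[OF assms(1) c], of "X (chart_at M p)" "Y (chart_at M p)"]
    by (simp add: tvec_uminus[OF M c] tangent_tvec[OF _ c] assms)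
qed

text \<open>The frame expresses \<sigma> and the volume form, but not g, through the dual coframe.
  Duality identifies \<open>f k\<close> and \<open>f' k\<close> with the metric products with
  \<open>F k\<close> and \<open>J p (F k)\<close>, which determines their composition with J; then
  g(X, Y) = \<sigma>(X, JY) yields g without expanding vectors in the frame.\<close>

lemma su3_model_at:
  assumes p: "p \<in> points M" and c: "c \<in> charts_at M p"
  shows "su3_model (\<lambda>x y. g p (tvec M c p x) (tvec M c p y)) (\<lambda>x y. \<sigma> p [tvec M c p x, tvec M c p y])
    (\<lambda>x y w. psi_re p [tvec M c p x, tvec M c p y, tvec M c p w])
    (\<lambda>x y w. psi_im p [tvec M c p x, tvec M c p y, tvec M c p w])"
proof -
  let ?T = "tangent_space M p"
  have "\<exists>F f f'. su3_frame M g J psi_re psi_im p F f f'"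
    using su3 p unfolding su3_structure_def by blast
  then obtain F f f' where fr: "su3_frame M g J psi_re psi_im p F f f'"
    by blast
  have F: "F i \<in> ?T" if "i \<in> {1..3}" for i
    using fr that unfolding su3_frame_def by blast
  have dual: "f i [F j] = of_bool (i = j)" "f i [J p (F j)] = 0" "f' i [F j] = 0"
    "f' i [J p (F j)] = of_bool (i = j)" if "i \<in> {1..3}" "j \<in> {1..3}" for i j
    using fr that unfolding su3_frame_def by blast+
  have "\<sigma> p [X, Y] = (\<Sum>k\<in>{1..3}. wedge 1 1 (f k) (f' k) [X, Y])" if "X \<in> ?T" "Y \<in> ?T" for X Y
    using fr that unfolding su3_frame_def by blast
  then have sig: "\<sigma> p [X, Y] = (\<Sum>k\<in>{1..3}. f k [X] * f' k [Y] - f k [Y] * f' k [X])"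
    if "X \<in> ?T" "Y \<in> ?T" for X Y
    using that unfolding wedge_1_1 by blast
  have psi: "Complex (psi_re p [X, Y, Z]) (psi_im p [X, Y, Z]) =
      wedge 2 1 (wedge 1 1 (\<lambda>Xs. Complex (f 1 Xs) (f' 1 Xs)) (\<lambda>Xs. Complex (f 2 Xs) (f' 2 Xs)))
        (\<lambda>Xs. Complex (f 3 Xs) (f' 3 Xs)) [X, Y, Z]"
    if "X \<in> ?T" "Y \<in> ?T" "Z \<in> ?T" for X Y Z
    using fr that unfolding su3_frame_def Let_def by blast
  have sg: "\<sigma> p [X, Y] = g p (J p X) Y" for X Y by (simp add: fundamental_form_def)
  have f'_eq: "f' k [X] = g p (J p (F k)) X" if "X \<in> ?T" "k \<in> {1..3}" for X k
  proof -
    \<comment> \<open>Inserting \<open>F k\<close> into the coframe formula for \<sigma> leaves only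
      \<open>f' k\<close>; inserting \<open>J p (F k)\<close> further below leaves the negative of
      \<open>f k\<close>.\<close>
    have "(\<Sum>j\<in>{1..3}. f j [F k] * f' j [X] - f j [X] * f' j [F k]) = (\<Sum>j\<in>{1..3}. if j = k then f' j [X] else 0)"
      using dual[OF _ that(2)] by (intro sum.cong[OF refl]) auto
    also have "\<dots> = f' k [X]" using that(2) by simp
    finally show ?thesis using sig[OF F[OF that(2)] that(1)] sg by simp
  qed
  have f_eq: "f k [X] = g p (F k) X" if "X \<in> ?T" "k \<in> {1..3}" for X k
  proof -
    have "(\<Sum>j\<in>{1..3}. f j [J p (F k)] * f' j [X] - f j [X] * f' j [J p (F k)]) =
        (\<Sum>j\<in>{1..3}. if j = k then - f j [X] else 0)"
      using dual[OF _ that(2)] by (intro sum.cong[OF refl]) auto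
    also have "\<dots> = - f k [X]" using that(2) by simp
    finally have "g p (J p (J p (F k))) X = - f k [X]"
      using sig[OF J_tangent(1)[OF p F[OF that(2)]] that(1)] sg by simp
    then show ?thesis
      using J_tangent(2)[OF p F[OF that(2)]] g_uminus[OF p F[OF that(2)] that(1)] by simp
  qed
  have fJ: "f k [J p X] = - f' k [X]" and f'J: "f' k [J p X] = f k [X]" if "X \<in> ?T" "k \<in> {1..3}" for X k
  proof -
    note Fk = F[OF that(2)]
    note JF = J_tangent(1)[OF p Fk] and JX = J_tangent(1)[OF p that(1)]
    \<comment> \<open>The negative of a tangent vector is recognised as tangent because it is
      \<open>J p (J p X)\<close>.\<close>
    have X': "- X \<in> ?T" using J_tangent(1)[OF p JX] J_tangent(2)[OF p that(1)] by simp
    have "f k [J p X] = g p (F k) (J p X)" using f_eq[OF JX that(2)] .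
    also have "\<dots> = g p (J p (F k)) (- X)"
      using J_isometry[OF p Fk JX] J_tangent(2)[OF p that(1)] by simp
    also have "\<dots> = - g p X (J p (F k))"
      using g_commute[OF p JF X'] g_uminus[OF p that(1) JF] by simp
    also have "\<dots> = - f' k [X]" using f'_eq[OF that] g_commute[OF p that(1) JF] by simp
    finally show "f k [J p X] = - f' k [X]" .
    show "f' k [J p X] = f k [X]"
      using f'_eq[OF JX that(2)] f_eq[OF that] J_isometry[OF p Fk that(1)] by simp
  qed
  have g_eq: "g p X Y = (\<Sum>k\<in>{1..3}. f k [X] * f k [Y] + f' k [X] * f' k [Y])" if X: "X \<in> ?T" and Y: "Y \<in> ?T" for X Y
  proof -
    have "g p X Y = \<sigma> p [X, J p Y]" using J_isometry[OF p X Y] sg by simp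
    also have "\<dots> = (\<Sum>k\<in>{1..3}. f k [X] * f' k [J p Y] - f k [J p Y] * f' k [X])"
      by (rule sig[OF X J_tangent(1)[OF p Y]])
    also have "\<dots> = (\<Sum>k\<in>{1..3}. f k [X] * f k [Y] + f' k [X] * f' k [Y])"
      using fJ[OF Y] f'J[OF Y] by (intro sum.cong[OF refl]) simp
    finally show ?thesis .
  qed
  have three: "{1..3::nat} = {1, 2, 3}" by auto
  define t where "t = tvec M c p"
  have t: "t x \<in> ?T" for x unfolding t_def by (rule tvec_in_tangent_space[OF M c])
  define z where "z = (\<lambda>k x. Complex (f k [t x]) (f' k [t x]))"
  have "herm (z 1) (z 2) (z 3) x y = Complex (g p (t x) (t y)) (- \<sigma> p [t x, t y])" for x y
    unfolding g_eq[OF t t] sig[OF t t] three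
    by (simp add: herm_def z_def complex_eq_iff algebra_simps)
  moreover have "cdet (z 1) (z 2) (z 3) x y w =
      Complex (psi_re p [t x, t y, t w]) (psi_im p [t x, t y, t w])" for x y w
    unfolding psi[OF t t t] wedge_1_1_1 cdet_def z_def ..
  ultimately show ?thesis unfolding su3_model_def t_def by blast
qed

lemma su3_model_eventually:
  assumes c: "c \<in> charts_at M p"
  shows "\<forall>\<^sub>F z in nhds (cmap c p). su3_model (Gc c z) (Sc c z) (Pc c z) (Qc c z)"
  using eventually_in_chart[OF M c]
proof (rule eventually_mono)
  fix z assume z: "cinv c z \<in> cdom c \<and> cmap c (cinv c z) = z"
  have "c \<in> charts_at M (cinv c z)" "cinv c z \<in> points M"
    using z charts_atD(1)[OF c] subsetD[OF chart_subset[OF M charts_atD(1)[OF c]]] by (simp_all add: charts_at_def)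
  from su3_model_at[OF this(2,1)] show "su3_model (Gc c z) (Sc c z) (Pc c z) (Qc c z)"
    by (simp add: in_chart_def)
qed

lemma Gc_bilinear_eventually:
  assumes c: "c \<in> charts_at M p"
  shows "\<forall>\<^sub>F z in nhds (cmap c p). bilinear (Gc c z)"
  using eventually_in_chart[OF M c]
proof (rule eventually_mono)
  fix z assume z: "cinv c z \<in> cdom c \<and> cmap c (cinv c z) = z"
  have "c \<in> charts_at M (cinv c z)" "cinv c z \<in> points M"
    using z charts_atD(1)[OF c] subsetD[OF chart_subset[OF M charts_atD(1)[OF c]]] by (simp_all add: charts_at_def)
  from g_bilinear[OF this(2,1)] show "bilinear (Gc c z)" .
qed

lemma Gc_differentiable:
  assumes c: "c \<in> charts_at M p"
  shows "(\<lambda>z. Gc c z x y) differentiable (at (cmap c p))"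
proof -
  have "smooth_on (cmap c ` cdom c) (\<lambda>z. Gc c z x y)"
    using metric charts_atD(1)[OF c] unfolding riemannian_metric_def by blast
  then show ?thesis using charts_atD(2)[OF c] by (auto intro: smooth_on_differentiable)
qed

text \<open>\<sigma> is not given as a smooth form. Near the point it is the metric with the moving
  vector Jx in its first slot, so it inherits differentiability from g and J; that it is alternating
  comes from the SU(3)-model.\<close>

lemma sigma_form2_at:
  assumes c: "c \<in> charts_at M p"
  shows "form2_at (cmap c p) (Sc c)"
  unfolding form2_at_def
proof (intro conjI allI)
  let ?Jx = "\<lambda>z x. J (cinv c z) (tvec M c (cinv c z) x) c"
  have *: "bilinear (Gc c z) \<and> linear (?Jx z) \<and> (\<forall>x y. Sc c z x y = Gc c z (?Jx z x) y) \<and> (\<forall>x. Sc c z x x = 0)"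
    if z: "cinv c z \<in> cdom c \<and> cmap c (cinv c z) = z" for z
  proof -
    have c': "c \<in> charts_at M (cinv c z)" and q: "cinv c z \<in> points M"
      using z charts_atD(1)[OF c] subsetD[OF chart_subset[OF M charts_atD(1)[OF c]]] by (simp_all add: charts_at_def)
    have "linear (?Jx z)"
      using almost_complex q c' unfolding almost_complex_structure_def by blast
    moreover have "Sc c z x y = Gc c z (?Jx z x) y" for x y
      using tangent_tvec[OF J_tangent(1)[OF q tvec_in_tangent_space[OF M c']] c']
      by (simp add: in_chart_def fundamental_form_def)
    moreover have "Sc c z x x = 0" for x
      using su3_model_antisym(3)[OF su3_model_at[OF q c'], of x] by (simp add: in_chart_def)
    ultimately show ?thesis using g_bilinear[OF q c'] by blast
  qed
  have ev: "\<forall>\<^sub>F z in nhds (cmap c p). bilinear (Gc c z) \<and> linear (?Jx z) \<and>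
      (\<forall>x y. Sc c z x y = Gc c z (?Jx z x) y) \<and> (\<forall>x. Sc c z x x = 0)"
    using eventually_in_chart[OF M c] by (rule eventually_mono) (rule *)
  then show "\<forall>\<^sub>F z in nhds (cmap c p). (\<forall>y. linear (\<lambda>x. Sc c z x y)) \<and> (\<forall>x. linear (Sc c z x)) \<and> (\<forall>x. Sc c z x x = 0)"
  proof (rule eventually_mono)
    fix z assume a: "bilinear (Gc c z) \<and> linear (?Jx z) \<and> (\<forall>x y. Sc c z x y = Gc c z (?Jx z x) y) \<and> (\<forall>x. Sc c z x x = 0)"
    then have e: "Sc c z x y = Gc c z (?Jx z x) y" for x y by blast
    have "linear (\<lambda>x. Sc c z x y)" for y
      unfolding e using linear_compose[of "?Jx z" "\<lambda>w. Gc c z w y"] a unfolding bilinear_def o_def by blast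
    moreover have "linear (Sc c z x)" for x
      unfolding e using a unfolding bilinear_def by blast
    ultimately show "(\<forall>y. linear (\<lambda>x. Sc c z x y)) \<and> (\<forall>x. linear (Sc c z x)) \<and> (\<forall>x. Sc c z x x = 0)"
      using a by blast
  qed
  fix x y
  have "smooth_on (cmap c ` cdom c) (\<lambda>z. ?Jx z x)"
    using almost_complex charts_atD(1)[OF c] unfolding almost_complex_structure_def by blast
  then have Jd: "(\<lambda>z. ?Jx z x) differentiable (at (cmap c p))"
    using charts_atD(2)[OF c] by (auto intro: smooth_on_differentiable)
  have "\<forall>\<^sub>F z in nhds (cmap c p). linear (\<lambda>w. Gc c z w y)"
    using Gc_bilinear_eventually[OF c] by (rule eventually_mono) (simp add: bilinear_def)
  from linear_slot_has_derivative[OF this D_works[OF Gc_differentiable[OF c]] D_works[OF Jd]]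
  have "((\<lambda>z. Sc c z x y) has_derivative (\<lambda>h. D (\<lambda>z. Gc c z (?Jx (cmap c p) x) y) (cmap c p) h
      + Gc c (cmap c p) (D (\<lambda>z. ?Jx z x) (cmap c p) h) y)) (at (cmap c p))"
  proof (rule has_derivative_transform_eventually)
    show "\<forall>\<^sub>F z in at (cmap c p). Gc c z (?Jx z x) y = Sc c z x y"
      using ev unfolding eventually_at_filter by (rule eventually_mono) metis
    show "Gc c (cmap c p) (?Jx (cmap c p) x) y = Sc c (cmap c p) x y"
      using eventually_nhds_x_imp_x[OF ev] by metis
  qed simp
  then show "(\<lambda>z. Sc c z x y) differentiable (at (cmap c p))" by (rule differentiableI)
qed

lemma sigma_invariant: "form_eq M 2 (pullback M M (\<rho> (torus_exp \<xi>)) \<sigma>) \<sigma>"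
  unfolding form_eq_def
proof (intro ballI allI impI)
  fix p and Xs :: "('a, real^6) tangent list" assume p: "p \<in> points M" and Xs: "length Xs = 2 \<and> set Xs \<subseteq> tangent_space M p"
  then obtain X Y where X: "Xs = [X, Y]" "X \<in> tangent_space M p" "Y \<in> tangent_space M p"
    by (auto simp: length_Suc_conv numeral_2_eq_2)
  let ?d = "differential M M (\<rho> (torus_exp \<xi>)) p" and ?q = "\<rho> (torus_exp \<xi>) p"
  have "J ?q (?d X) = ?d (J p X)" "g ?q (?d (J p X)) (?d Y) = g p (J p X) Y"
    using preserves torus_exp_in[of \<xi>] p X J_tangent(1)[OF p X(2)] unfolding preserves_structure_def by blast+
  then show "pullback M M (\<rho> (torus_exp \<xi>)) \<sigma> p Xs = \<sigma> p Xs"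
    by (simp add: pullback_def fundamental_form_def X(1))
qed

lemma psi_invariant:
  "form_eq M 3 (pullback M M (\<rho> (torus_exp \<xi>)) psi_im) psi_im"
  using preserves torus_exp_in[of \<xi>] unfolding preserves_structure_def by blast

lemma d_sigma:
  assumes p: "p \<in> points M"
  defines "c \<equiv> chart_at M p"
  shows "ed2 (Sc c) (cmap c p) x y w = 3 * Pc c (cmap c p) x y w"
proof -
  have c: "c \<in> charts_at M p" unfolding c_def by (rule chart_at_charts_at[OF M p])
  have "form_eq M 3 (ext_deriv M \<sigma>) (\<lambda>p Xs. 3 * psi_re p Xs)"
    using nearly_kaehler unfolding nearly_kaehler_def Let_def by blast
  then have "ext_deriv M \<sigma> p [tvec M c p x, tvec M c p y, tvec M c p w]
      = 3 * psi_re p [tvec M c p x, tvec M c p y, tvec M c p w]"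
    using p tvec_in_tangent_space[OF M c] unfolding form_eq_def by simp
  then show ?thesis
    by (simp add: ext_deriv_2 c_def[symmetric] tvec_self[OF M c] in_chart_cmap[OF M c])
qed

text \<open>The constant -4 is the -2 of the structure equation times the factor 2 in
  \<open>wedge_2_2\<close>.\<close>

lemma d_psi:
  assumes p: "p \<in> points M"
  defines "c \<equiv> chart_at M p"
  shows "ed3 (Qc c) (cmap c p) x y w t = - 4 * (Sc c (cmap c p) x y * Sc c (cmap c p) w t
    - Sc c (cmap c p) x w * Sc c (cmap c p) y t + Sc c (cmap c p) x t * Sc c (cmap c p) y w)"
proof -
  have c: "c \<in> charts_at M p" unfolding c_def by (rule chart_at_charts_at[OF M p])
  let ?t = "tvec M c p"
  have "form_eq M 4 (ext_deriv M psi_im) (\<lambda>p Xs. - 2 * form_wedge 2 2 \<sigma> \<sigma> p Xs)"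
    using nearly_kaehler unfolding nearly_kaehler_def Let_def by blast
  then have e: "ext_deriv M psi_im p [?t x, ?t y, ?t w, ?t t]
      = - 2 * wedge 2 2 (\<sigma> p) (\<sigma> p) [?t x, ?t y, ?t w, ?t t]"
    using p tvec_in_tangent_space[OF M c] unfolding form_eq_def form_wedge_def by simp
  have "wedge 2 2 (\<sigma> p) (\<sigma> p) [?t x, ?t y, ?t w, ?t t] = 2 * (\<sigma> p [?t x, ?t y] * \<sigma> p [?t w, ?t t]
      - \<sigma> p [?t x, ?t w] * \<sigma> p [?t y, ?t t] + \<sigma> p [?t x, ?t t] * \<sigma> p [?t y, ?t w])"
  proof (rule wedge_2_2)
    fix X Y assume "X \<in> {?t x, ?t y, ?t w, ?t t}" "Y \<in> {?t x, ?t y, ?t w, ?t t}"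
    then obtain a b where XY: "X = ?t a" "Y = ?t b" by blast
    show "\<sigma> p [X, Y] = - \<sigma> p [Y, X]"
      unfolding XY by (rule su3_model_antisym(2)[OF su3_model_at[OF p c]])
  qed
  then show ?thesis
    using e by (simp add: ext_deriv_3 c_def[symmetric] tvec_self[OF M c] in_chart_cmap[OF M c])
qed

lemma torus_chart_at: "c \<in> charts_at M p \<Longrightarrow> torus_chart M \<rho> p c"
  by (intro torus_chart.intro M torus_action)

lemma d_moment_map:
  assumes p: "p \<in> points M"
  defines "c \<equiv> chart_at M p"
  shows "D (\<lambda>z. Sc c z (gen_rep \<rho> c \<xi> z) (gen_rep \<rho> c \<eta> z)) (cmap c p) x
    = 3 * Pc c (cmap c p) (gen_rep \<rho> c \<xi> (cmap c p)) (gen_rep \<rho> c \<eta> (cmap c p)) x"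
proof -
  have c: "c \<in> charts_at M p" unfolding c_def by (rule chart_at_charts_at[OF M p])
  interpret C: torus_chart M \<rho> p c by (rule torus_chart_at[OF c])
  note Lie = C.Lie_form2[OF sigma_form2_at[OF c] sigma_invariant]
  have "D (\<lambda>z. Sc c z (gen_rep \<rho> c \<xi> z) (gen_rep \<rho> c \<eta> z)) (cmap c p) x
      = ed2 (Sc c) (cmap c p) (gen_rep \<rho> c \<xi> (cmap c p)) (gen_rep \<rho> c \<eta> (cmap c p)) x"
  proof (rule D_contract_invariant[OF sigma_form2_at[OF c] C.gen_rep_derivative[of \<xi>] C.gen_rep_derivative[of \<eta>]])
    show "gen_deriv \<rho> c \<xi> (cmap c p) (gen_rep \<rho> c \<eta> (cmap c p))
        = gen_deriv \<rho> c \<eta> (cmap c p) (gen_rep \<rho> c \<xi> (cmap c p))" by (rule C.gen_commute)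
  qed (rule Lie)+
  also have "\<dots> = 3 * Pc c (cmap c p) (gen_rep \<rho> c \<xi> (cmap c p)) (gen_rep \<rho> c \<eta> (cmap c p)) x"
    unfolding c_def by (rule d_sigma[OF p])
  finally show ?thesis .
qed

lemma generator_chart:
  assumes "c \<in> charts M" "q \<in> cdom c"
  shows "generator M \<rho> \<xi> q = tvec M c q (gen_rep \<rho> c \<xi> (cmap c q))"
  by (rule generator_tangent[OF M torus_action]) (use assms in \<open>simp add: charts_at_def\<close>)

end

section \<open>The structure equations in coordinates\<close>

lemma D_eventually_eq:
  assumes "\<forall>\<^sub>F w in nhds w0. f w = g w" "f differentiable (at w0)"
  shows "D f w0 = D g w0"
proof -
  have "(g has_derivative D f w0) (at w0)"
  proof (rule has_derivative_transform_eventually[OF D_works[OF assms(2)]])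
    show "\<forall>\<^sub>F w in at w0. f w = g w"
      using assms(1) unfolding eventually_at_filter by (rule eventually_mono) simp
    show "f w0 = g w0" using assms(1) by (rule eventually_nhds_x_imp_x)
  qed simp
  then show ?thesis using D_eqI by metis
qed

text \<open>In the following locale, \<open>\<phi>\<close> is the inclusion of the level set into the ambient manifold, \<open>P\<close> and
  \<open>Q\<close> are \<open>\<psi>\<^sub>+\<close> and \<open>\<psi>\<^sub>-\<close>, and \<open>Lu\<close>, \<open>Lv\<close>, \<open>LvS\<close> and \<open>uv\<close> express the vanishing of Lie derivatives
  and of the bracket.\<close>

locale level_chart =
  fixes S G :: "'e::euclidean_space \<Rightarrow> 'e \<Rightarrow> 'e \<Rightarrow> real" and P Q :: "'e \<Rightarrow> 'e \<Rightarrow> 'e \<Rightarrow> 'e \<Rightarrow> real"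
    and u v u' v' :: "'e \<Rightarrow> 'e" and s :: real
    and \<phi> :: "'n::euclidean_space \<Rightarrow> 'e" and T :: "'n set" and w0 :: 'n and z0 :: 'e
  assumes S: "form2_at z0 S" and Q: "form3_at z0 Q"
    and G_bilinear: "\<forall>\<^sub>F z in nhds z0. bilinear (G z)"
    and G_differentiable: "\<And>x y. (\<lambda>z. G z x y) differentiable (at z0)"
    and model: "\<forall>\<^sub>F z in nhds z0. su3_model (G z) (S z) (P z) (Q z)"
    and u: "(u has_derivative u') (at z0)" and v: "(v has_derivative v') (at z0)"
    and Lu: "\<And>x y w. D (\<lambda>z. Q z x y w) z0 (u z0) + Q z0 (u' x) y w + Q z0 x (u' y) w + Q z0 x y (u' w) = 0"
    and Lv: "\<And>x y w. D (\<lambda>z. Q z x y w) z0 (v z0) + Q z0 (v' x) y w + Q z0 x (v' y) w + Q z0 x y (v' w) = 0"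
    and LvS: "\<And>x y. D (\<lambda>z. S z x y) z0 (v z0) + S z0 (v' x) y + S z0 x (v' y) = 0"
    and uv: "u' (v z0) = v' (u z0)"
    and dS: "\<And>x y w. ed2 S z0 x y w = 3 * P z0 x y w"
    and dQ: "\<And>x y w t. ed3 Q z0 x y w t = - 4 * (S z0 x y * S z0 w t - S z0 x w * S z0 y t + S z0 x t * S z0 y w)"
    and \<phi>: "smooth_on T \<phi>" "open T" "w0 \<in> T" and z0: "\<phi> w0 = z0"
    and level: "\<And>w. w \<in> T \<Longrightarrow> S (\<phi> w) (u (\<phi> w)) (v (\<phi> w)) = s"
    and tangent: "\<And>w x. w \<in> T \<Longrightarrow> P (\<phi> w) (u (\<phi> w)) (v (\<phi> w)) (D \<phi> w x) = 0"
    and regular: "\<And>w. w \<in> T \<Longrightarrow> \<exists>y. P (\<phi> w) (u (\<phi> w)) (v (\<phi> w)) y \<noteq> 0"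
    and s: "s \<noteq> 0"
begin

text \<open>\<open>h\<close> is the function written h^2 in the theorem.\<close>

definition "h z = G z (u z) (u z) * G z (v z) (v z) - (G z (u z) (v z))\<^sup>2"
definition "th1 z x = (G z (v z) (v z) * G z (u z) x - G z (u z) (v z) * G z (v z) x) / h z"
definition "th2 z x = (G z (u z) (u z) * G z (v z) x - G z (u z) (v z) * G z (u z) x) / h z"
definition "a0 z = Q z (u z) (v z)"
definition "a1 z x = s * th1 z x + S z (v z) x"
definition "a2 z x = s * th2 z x - S z (u z) x"
text \<open>\<open>k\<close> is chosen so that in \<open>th1\<close> plus \<open>k\<close> times
  \<open>a1\<close> the denominators combine to \<open>h z - s\<^sup>2\<close> alone: up to sign
  this is the one-form that \<open>su3_model_expansion\<close> wedges with \<open>a0\<close> to give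
  V \<lrcorner> \<psi>_-.\<close>

definition "k z = s / (h z - s\<^sup>2)"
definition "f z = 4 * h z / (h z - s\<^sup>2)"

lemma u_differentiable: "u differentiable (at z0)" and v_differentiable: "v differentiable (at z0)"
  using u v differentiableI by blast+

lemma G_form1:
  assumes "X differentiable (at z0)"
  shows "form1_at z0 (\<lambda>z. G z (X z))"
  unfolding form1_at_def
proof (intro conjI allI)
  show "\<forall>\<^sub>F z in nhds z0. linear (G z (X z))"
    using G_bilinear by (rule eventually_mono) (simp add: bilinear_def)
  show "(\<lambda>z. G z (X z) y) differentiable (at z0)" for y
  proof (rule differentiableI, rule linear_slot_has_derivative[OF _ D_works[OF G_differentiable] D_works[OF assms]])
    show "\<forall>\<^sub>F z in nhds z0. linear (\<lambda>x. G z x y)"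
      using G_bilinear by (rule eventually_mono) (simp add: bilinear_def)
  qed
qed

lemma G_apply_differentiable:
  assumes "X differentiable (at z0)" "Y differentiable (at z0)"
  shows "(\<lambda>z. G z (X z) (Y z)) differentiable (at z0)"
  by (rule differentiableI, rule form1_D[OF G_form1[OF assms(1)] D_works[OF assms(2)]])

lemma h_differentiable: "h differentiable (at z0)"
  unfolding h_def[abs_def] power2_eq_square
  by (intro differentiable_diff differentiable_mult G_apply_differentiable u_differentiable v_differentiable)

lemma model_level:
  "\<forall>\<^sub>F w in nhds w0. w \<in> T \<and> su3_model (G (\<phi> w)) (S (\<phi> w)) (P (\<phi> w)) (Q (\<phi> w))"
proof (rule eventually_conj)
  show "\<forall>\<^sub>F w in nhds w0. w \<in> T" by (rule eventually_nhds_in_open[OF \<phi>(2,3)])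
  show "\<forall>\<^sub>F w in nhds w0. su3_model (G (\<phi> w)) (S (\<phi> w)) (P (\<phi> w)) (Q (\<phi> w))"
    by (rule eventually_nhds_compose[OF _ D_works[OF smooth_on_differentiable[OF \<phi>(1,3)]],
          where P = "\<lambda>z. su3_model (G z) (S z) (P z) (Q z)"]) (simp add: z0 model)
qed

lemma h_level:
  assumes "w \<in> T" "su3_model (G (\<phi> w)) (S (\<phi> w)) (P (\<phi> w)) (Q (\<phi> w))"
  shows "h (\<phi> w) - s\<^sup>2 > 0" "h (\<phi> w) > 0"
proof -
  obtain y where "P (\<phi> w) (u (\<phi> w)) (v (\<phi> w)) y \<noteq> 0" using regular[OF assms(1)] by blast
  from su3_model_gram_pos[OF assms(2) this] show "h (\<phi> w) - s\<^sup>2 > 0"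
    unfolding h_def level[OF assms(1)] by simp
  then show "h (\<phi> w) > 0" using zero_le_power2[of s] by linarith
qed

lemma model0: "su3_model (G z0) (S z0) (P z0) (Q z0)"
  using model by (rule eventually_nhds_x_imp_x)

lemma h0: "h z0 - s\<^sup>2 > 0" "h z0 > 0"
  using h_level[OF \<phi>(3)] model0 unfolding z0 by auto

lemma k_differentiable: "k differentiable (at z0)"
  unfolding k_def[abs_def]
  by (intro differentiable_divide differentiable_diff h_differentiable differentiable_const) (use h0 in simp)

lemma D_f: "D f z0 x = 4 * s * D k z0 x" and f_eq: "f z0 = 4 * (1 + s * k z0)"
  and f_differentiable: "f differentiable (at z0)"
proof -
  have eq: "f z = 4 * (1 + s * k z)" if "h z - s\<^sup>2 \<noteq> 0" for z
    using that by (simp add: f_def k_def field_simps power2_eq_square)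
  have d: "((\<lambda>z. 4 * (1 + s * k z)) has_derivative (\<lambda>x. 4 * (s * D k z0 x))) (at z0)"
    by (auto intro!: derivative_eq_intros D_works k_differentiable)
  \<comment> \<open>Continuity keeps \<open>h\<close> above s^2 near \<open>z0\<close>, where
    \<open>f\<close> can be rewritten through \<open>k\<close>.\<close>
  have "isCont h z0" using h_differentiable by (rule differentiable_imp_continuous_within)
  then have "\<forall>\<^sub>F z in at z0. s\<^sup>2 < h z"
    using h0 unfolding isCont_def by (intro order_tendstoD(1)) simp_all
  then have ev: "\<forall>\<^sub>F z in at z0. 4 * (1 + s * k z) = f z"
    by (rule eventually_mono) (use eq in force)
  show f0: "f z0 = 4 * (1 + s * k z0)" using eq h0 by simp
  have der: "(f has_derivative (\<lambda>x. 4 * (s * D k z0 x))) (at z0)"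
    by (rule has_derivative_transform_eventually[OF d ev]) (use f0 in simp_all)
  show "D f z0 x = 4 * s * D k z0 x" using fun_cong[OF D_eqI[OF der], of x] by simp
  show "f differentiable (at z0)" using der by (rule differentiableI)
qed

lemma th1_form1: "form1_at z0 th1"
proof -
  have h: "h z0 \<noteq> 0" using h0 by simp
  have "form1_at z0 (\<lambda>z x. G z (v z) (v z) / h z * G z (u z) x + - G z (u z) (v z) / h z * G z (v z) x)"
    by (rule form1_at_add[OF form1_at_scale[OF _ G_form1[OF u_differentiable]]
          form1_at_scale[OF _ G_form1[OF v_differentiable]]])
      (intro differentiable_divide differentiable_minus h_differentiable h G_apply_differentiable
        u_differentiable v_differentiable)+
  moreover have "th1 = (\<lambda>z x. G z (v z) (v z) / h z * G z (u z) x + - G z (u z) (v z) / h z * G z (v z) x)"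
    by (intro ext) (simp add: th1_def diff_divide_distrib)
  ultimately show ?thesis by (simp only:)
qed

lemma a0_form1: "form1_at z0 a0"
  unfolding a0_def[abs_def]
  by (rule form1_at_contract[OF form2_at_contract[OF Q u_differentiable] v_differentiable])

lemma a1_form1: "form1_at z0 a1"
  unfolding a1_def[abs_def]
  by (rule form1_at_add[OF form1_at_scale[OF differentiable_const th1_form1] form1_at_contract[OF S v_differentiable]])

lemma tangent0: "P z0 (u z0) (v z0) (D \<phi> w0 x) = 0" and level0: "S z0 (u z0) (v z0) = s"
  using tangent[OF \<phi>(3)] level[OF \<phi>(3)] unfolding z0 by auto

lemma S_decomposition:
  fixes X Y defines "x \<equiv> D \<phi> w0 X" and "y \<equiv> D \<phi> w0 Y"
  shows "s * S z0 x y = S z0 (u z0) x * S z0 (v z0) y - S z0 (u z0) y * S z0 (v z0) x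
    - f z0 / 4 * (a1 z0 x * a2 z0 y - a1 z0 y * a2 z0 x)"
proof -
  have "s * S z0 x y = S z0 (u z0) x * S z0 (v z0) y - S z0 (u z0) y * S z0 (v z0) x
      - h z0 / (h z0 - s\<^sup>2) * (a1 z0 x * a2 z0 y - a1 z0 y * a2 z0 x)"
    unfolding x_def y_def a1_def a2_def th1_def th2_def
    by (rule su3_model_fundamental_form[OF model0 tangent0 tangent0 _ _ h_def level0[symmetric]])
      (use h0 in simp_all)
  moreover have f4: "f z0 / 4 = h z0 / (h z0 - s\<^sup>2)" using h0 by (simp add: f_def divide_simps)
  ultimately show ?thesis by (simp only: f4)
qed

lemma d_a0:
  fixes X Y defines "x \<equiv> D \<phi> w0 X" and "y \<equiv> D \<phi> w0 Y"
  shows "ed1 a0 z0 x y = f z0 * (a1 z0 x * a2 z0 y - a1 z0 y * a2 z0 x)"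
proof -
  have "ed1 a0 z0 x y = ed3 Q z0 (u z0) (v z0) x y"
    unfolding a0_def[abs_def] by (rule ed1_contract2_invariant[OF Q u v]) (rule Lu Lv uv)+
  \<comment> \<open>The parenthesis is half of \<sigma> \<and> \<sigma> contracted with
    \<open>u\<close> and \<open>v\<close>. By \<open>S_decomposition\<close> it equals -f/4 times
    \<open>a1\<close> wedge \<open>a2\<close>, so the constants combine to \<open>f\<close>.\<close>
  also have "\<dots> = - 4 * (s * S z0 x y - S z0 (u z0) x * S z0 (v z0) y + S z0 (u z0) y * S z0 (v z0) x)"
    unfolding dQ level0 ..
  also have "\<dots> = f z0 * (a1 z0 x * a2 z0 y - a1 z0 y * a2 z0 x)"
    using S_decomposition[of X Y] unfolding x_def y_def by (simp add: algebra_simps)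
  finally show ?thesis .
qed

text \<open>The form \<open>E\<close> vanishes along the level set, but not near it; the equation for \<open>a1\<close> is its
  exterior derivative on the level set.\<close>

definition "b z x = th1 z x + k z * a1 z x"
definition "E z x y = Q z (v z) x y + (b z x * a0 z y - b z y * a0 z x)"

lemma b_form1: "form1_at z0 b"
  unfolding b_def[abs_def] by (rule form1_at_add[OF th1_form1 form1_at_scale[OF k_differentiable a1_form1]])

lemma E_form2: "form2_at z0 E"
  unfolding E_def[abs_def]
  by (rule form2_at_add[OF form2_at_contract[OF Q v_differentiable] form2_at_wedge[OF b_form1 a0_form1]])

lemma E_level:
  assumes w: "w \<in> T" and m: "su3_model (G (\<phi> w)) (S (\<phi> w)) (P (\<phi> w)) (Q (\<phi> w))"
  shows "E (\<phi> w) (D \<phi> w x) (D \<phi> w y) = 0"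
proof -
  let ?z = "\<phi> w" and ?x = "D \<phi> w x" and ?y = "D \<phi> w y"
  define B where "B = (\<lambda>x. G ?z (v ?z) (v ?z) * G ?z (u ?z) x - G ?z (u ?z) (v ?z) * G ?z (v ?z) x + s * S ?z (v ?z) x)"
  have c: "h ?z - s\<^sup>2 \<noteq> 0" "h ?z \<noteq> 0" using h_level[OF w m] by auto
  have b: "b ?z x = B x / (h ?z - s\<^sup>2)" for x
    using c by (simp add: b_def a1_def k_def th1_def B_def divide_simps) (simp add: algebra_simps power2_eq_square)
  have "(h ?z - s\<^sup>2) * Q ?z (v ?z) ?x ?y = B ?y * a0 ?z ?x - B ?x * a0 ?z ?y"
    using su3_model_expansion(1)[OF m tangent[OF w, of x] tangent[OF w, of y]] level[OF w]
    by (simp add: h_def B_def a0_def)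
  then have "Q ?z (v ?z) ?x ?y = (B ?y * a0 ?z ?x - B ?x * a0 ?z ?y) / (h ?z - s\<^sup>2)"
    using c by (simp add: field_simps)
  then show ?thesis by (simp add: E_def b diff_divide_distrib)
qed

text \<open>By \<open>E_level\<close> the pull-back of \<open>E\<close> under \<open>\<phi>\<close>
  is zero on a whole neighbourhood of \<open>w0\<close>, so its exterior derivative vanishes, and
  pull-back commutes with that derivative.\<close>

lemma d_E: "ed2 E z0 (D \<phi> w0 X) (D \<phi> w0 Y) (D \<phi> w0 Z) = 0"
proof -
  have "D (\<lambda>w. E (\<phi> w) (D \<phi> w x) (D \<phi> w y)) w0 = (\<lambda>_. 0)" for x y
  proof -
    have "\<forall>\<^sub>F w in nhds w0. 0 = E (\<phi> w) (D \<phi> w x) (D \<phi> w y)"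
      using model_level by (rule eventually_mono) (simp add: E_level)
    from D_eventually_eq[OF this differentiable_const] show ?thesis by simp
  qed
  then have "ed2 (\<lambda>w x y. E (\<phi> w) (D \<phi> w x) (D \<phi> w y)) w0 X Y Z = 0"
    by (simp add: ed2_def)
  then show ?thesis using ed2_pullback[OF \<phi>, of E X Y Z] E_form2 by (simp add: z0)
qed

lemma d_a1:
  fixes X Y Z defines "x \<equiv> D \<phi> w0 X" and "y \<equiv> D \<phi> w0 Y" and "w \<equiv> D \<phi> w0 Z"
  shows "f z0 * (ed1 a1 z0 x y * a0 z0 w - ed1 a1 z0 x w * a0 z0 y + ed1 a1 z0 y w * a0 z0 x) =
    - ((D f z0 x * a1 z0 y - D f z0 y * a1 z0 x) * a0 z0 w - (D f z0 x * a1 z0 w - D f z0 w * a1 z0 x) * a0 z0 y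
      + (D f z0 y * a1 z0 w - D f z0 w * a1 z0 y) * a0 z0 x)"
proof -
  note t = tangent0[of X, folded x_def] tangent0[of Y, folded y_def] tangent0[of Z, folded w_def]
  let ?S = "S z0" and ?v = "v z0" and ?u = "u z0"
  \<comment> \<open>For antisymmetric \<omega>, \<open>cyc \<omega>\<close> is the value of \<omega>
    wedge \<open>a0\<close> on the three tangent vectors.\<close>
  define cyc where "cyc = (\<lambda>\<omega> :: 'e \<Rightarrow> 'e \<Rightarrow> real. \<omega> x y * a0 z0 w - \<omega> x w * a0 z0 y + \<omega> y w * a0 z0 x)"
  \<comment> \<open>This removes the contribution of d(V \<lrcorner> \<sigma>) to d\<alpha>1 \<and>
    \<alpha>0 and leaves only that of s d\<theta>1.\<close>
  have cycP: "cyc (P z0 ?v) = 0"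
    unfolding cyc_def a0_def
    by (rule su3_model_contract_wedge[OF model0 t]) (use h0 level0 in \<open>simp add: h_def\<close>)
  have da1: "ed1 a1 z0 x y = s * ed1 th1 z0 x y - 3 * P z0 ?v x y" for x y
  proof -
    have "ed1 a1 z0 x y = ed1 (\<lambda>z x. s * th1 z x) z0 x y + ed1 (\<lambda>z. S z (v z)) z0 x y"
      unfolding a1_def[abs_def]
      by (rule ed1_add[OF form1_at_scale[OF differentiable_const th1_form1] form1_at_contract[OF S v_differentiable]])
    moreover have "ed1 (\<lambda>z x. s * th1 z x) z0 x y = s * ed1 th1 z0 x y"
      using ed1_scale[OF differentiable_const th1_form1, of s x y] by simp
    moreover have "ed1 (\<lambda>z. S z (v z)) z0 x y = - 3 * P z0 ?v x y"
    proof -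
    have "ed1 (\<lambda>z. S z (v z)) z0 x y = - ed2 S z0 (v z0) x y"
      by (rule ed1_contract_invariant[OF S v]) (rule LvS)
    then show ?thesis unfolding dS by simp
  qed
    ultimately show ?thesis by simp
  qed
  have cyc1: "cyc (ed1 a1 z0) = s * cyc (ed1 th1 z0)"
    using cycP unfolding cyc_def da1 by (simp add: algebra_simps)
  have db: "ed1 b z0 x y = ed1 th1 z0 x y + (D k z0 x * a1 z0 y - D k z0 y * a1 z0 x) + k z0 * ed1 a1 z0 x y" for x y
  proof -
    have "ed1 b z0 x y = ed1 th1 z0 x y + ed1 (\<lambda>z x. k z * a1 z x) z0 x y"
      unfolding b_def[abs_def] by (rule ed1_add[OF th1_form1 form1_at_scale[OF k_differentiable a1_form1]])
    then show ?thesis using ed1_scale[OF k_differentiable a1_form1] by simp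
  qed
  have "ed2 E z0 x y w = ed2 (\<lambda>z. Q z (v z)) z0 x y w + ed2 (\<lambda>z x y. b z x * a0 z y - b z y * a0 z x) z0 x y w"
    unfolding E_def[abs_def]
    by (rule ed2_add[OF form2_at_contract[OF Q v_differentiable] form2_at_wedge[OF b_form1 a0_form1]])
  then have E0: "ed2 (\<lambda>z. Q z (v z)) z0 x y w + cyc (ed1 b z0)
      - (b z0 x * ed1 a0 z0 y w - b z0 y * ed1 a0 z0 x w + b z0 w * ed1 a0 z0 x y) = 0"
    using d_E[of X Y Z] ed2_wedge[OF b_form1 a0_form1, of x y w]
    unfolding cyc_def x_def y_def w_def by linarith
  have dv: "ed2 (\<lambda>z. Q z (v z)) z0 x y w = 4 * (?S ?v x * ?S y w - ?S ?v y * ?S x w + ?S ?v w * ?S x y)"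
  proof -
    have "ed2 (\<lambda>z. Q z (v z)) z0 x y w = - ed3 Q z0 (v z0) x y w"
      by (rule ed2_contract_invariant[OF Q v]) (rule Lv)
    then show ?thesis unfolding dQ by simp
  qed
  have Sv: "?S ?v x = a1 z0 x - s * th1 z0 x" for x by (simp add: a1_def)
  have da0: "ed1 a0 z0 x y = f z0 * (a1 z0 x * a2 z0 y - a1 z0 y * a2 z0 x)"
    "ed1 a0 z0 x w = f z0 * (a1 z0 x * a2 z0 w - a1 z0 w * a2 z0 x)"
    "ed1 a0 z0 y w = f z0 * (a1 z0 y * a2 z0 w - a1 z0 w * a2 z0 y)"
    unfolding x_def y_def w_def by (rule d_a0)+
  have dec: "s * ?S x y = ?S ?u x * ?S ?v y - ?S ?u y * ?S ?v x - f z0 / 4 * (a1 z0 x * a2 z0 y - a1 z0 y * a2 z0 x)"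
    "s * ?S x w = ?S ?u x * ?S ?v w - ?S ?u w * ?S ?v x - f z0 / 4 * (a1 z0 x * a2 z0 w - a1 z0 w * a2 z0 x)"
    "s * ?S y w = ?S ?u y * ?S ?v w - ?S ?u w * ?S ?v y - f z0 / 4 * (a1 z0 y * a2 z0 w - a1 z0 w * a2 z0 y)"
    unfolding x_def y_def w_def by (rule S_decomposition)+
  \<comment> \<open>The factor \<open>s\<close> is introduced because the decomposition is one of s
    \<sigma>. Wedged with V \<lrcorner> \<sigma> its first part vanishes, and V \<lrcorner> \<sigma>
    = \<alpha>1 - s \<theta>1 turns the rest into s f \<theta>1 \<and> \<alpha>1 \<and> \<alpha>2.
    This is also s b \<and> d\<alpha>0, since the \<alpha>1-part of \<open>b\<close> drops out;
    hence only d\<open>b\<close> \<and> \<alpha>0 survives in \<open>E0\<close>.\<close>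
  have "s * ed2 (\<lambda>z. Q z (v z)) z0 x y w = 4 * (?S ?v x * (s * ?S y w) - ?S ?v y * (s * ?S x w) + ?S ?v w * (s * ?S x y))"
    unfolding dv by (simp add: algebra_simps)
  also have "\<dots> = s * (b z0 x * ed1 a0 z0 y w - b z0 y * ed1 a0 z0 x w + b z0 w * ed1 a0 z0 x y)"
    unfolding dec da0 Sv b_def by (simp add: field_simps)
  finally have "ed2 (\<lambda>z. Q z (v z)) z0 x y w = b z0 x * ed1 a0 z0 y w - b z0 y * ed1 a0 z0 x w + b z0 w * ed1 a0 z0 x y"
    using s by simp
  then have "cyc (ed1 b z0) = 0" using E0 by simp
  then have "cyc (ed1 th1 z0) + cyc (\<lambda>x y. D k z0 x * a1 z0 y - D k z0 y * a1 z0 x) + k z0 * cyc (ed1 a1 z0) = 0"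
    unfolding cyc_def db by (simp add: algebra_simps)
  then have "cyc (ed1 th1 z0) + k z0 * cyc (ed1 a1 z0) = - cyc (\<lambda>x y. D k z0 x * a1 z0 y - D k z0 y * a1 z0 x)"
    by linarith
  \<comment> \<open>By \<open>cyc1\<close> the unknown d\<theta>1 is eliminated in favour of
    d\<alpha>1; the factor 1 + s k that appears is a quarter of \<open>f\<close>.\<close>
  moreover have "cyc (ed1 a1 z0) * (1 + s * k z0) = s * (cyc (ed1 th1 z0) + k z0 * cyc (ed1 a1 z0))"
    unfolding distrib_left cyc1[symmetric] by simp
  ultimately have e: "cyc (ed1 a1 z0) * (1 + s * k z0) = - (s * cyc (\<lambda>x y. D k z0 x * a1 z0 y - D k z0 y * a1 z0 x))"
    by simp
  have "f z0 * cyc (ed1 a1 z0) = 4 * (cyc (ed1 a1 z0) * (1 + s * k z0))"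
    unfolding f_eq by simp
  also have "\<dots> = - (4 * s * cyc (\<lambda>x y. D k z0 x * a1 z0 y - D k z0 y * a1 z0 x))"
    unfolding e by simp
  also have "\<dots> = - cyc (\<lambda>x y. D f z0 x * a1 z0 y - D f z0 y * a1 z0 x)"
    unfolding D_f cyc_def by (simp add: algebra_simps)
  finally show ?thesis unfolding cyc_def .
qed

end

section \<open>The reduction\<close>

lemma form_eq_pullback:
  assumes M: "smooth_manifold M" and N: "smooth_manifold N" and F: "diff_map N M F"
    and eq: "form_eq M k \<omega> \<omega>'"
  shows "form_eq N k (pullback N M F \<omega>) (pullback N M F \<omega>')"
  unfolding form_eq_def pullback_def
proof (intro ballI allI impI)
  fix p Xs assume p: "p \<in> points N" and Xs: "length Xs = k \<and> set Xs \<subseteq> tangent_space N p"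
  have Fp: "F p \<in> points M"
    using F p unfolding diff_map_def continuous_map_def by blast
  note d = chart_at_charts_at[OF N p] and c = chart_at_charts_at[OF M Fp]
  have "differential N M F p X \<in> tangent_space M (F p)" if "X \<in> tangent_space N p" for X
    using differential_tvec[OF N M F d c, of "X (chart_at N p)"] tvec_in_tangent_space[OF M c]
    unfolding tangent_tvec[OF that d] by simp
  then have "length (map (differential N M F p) Xs) = k \<and>
      set (map (differential N M F p) Xs) \<subseteq> tangent_space M (F p)"
    using Xs by auto
  then show "\<omega> (F p) (map (differential N M F p) Xs) = \<omega>' (F p) (map (differential N M F p) Xs)"
    using eq Fp unfolding form_eq_def by blast
qed

text \<open>The level set and quotient enter only through the consequences listed here, phrased in
  terms of \<open>\<xi>\<close> and \<open>\<eta>\<close>. The locale can thus be instantiated a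
  second time with \<open>\<eta>\<close> and \<open>- \<xi>\<close>, which yields the equation for
  the remaining one-form.\<close>

locale torus_reduction = nearly_kaehler_torus M g J psi_re psi_im \<rho>
  for M :: "('a, real^6) mfd" and g J psi_re psi_im \<rho> +
  fixes N :: "('a, 'n::euclidean_space) mfd" and Q :: "('a set, 'q::euclidean_space) mfd"
    and \<xi> \<eta> :: "real \<times> real" and s :: real
  assumes N: "smooth_manifold N" and Q: "smooth_manifold Q"
    and inclusion: "smooth_map N M (\<lambda>p. p)" and points_subset: "points N \<subseteq> points M"
    and projection: "submersion N Q (orbit \<rho>)"
    and moment: "\<And>p. p \<in> points N \<Longrightarrow> \<sigma> p [generator M \<rho> \<xi> p, generator M \<rho> \<eta> p] = s"
    and regular: "\<And>p. p \<in> points N \<Longrightarrow>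
      \<exists>X\<in>tangent_space M p. psi_re p [generator M \<rho> \<xi> p, generator M \<rho> \<eta> p, X] \<noteq> 0"
    and s: "s \<noteq> 0"
begin

abbreviation "U \<equiv> generator M \<rho> \<xi>"
abbreviation "V \<equiv> generator M \<rho> \<eta>"

lemma inclusion_diff: "diff_map N M (\<lambda>p. p)"
  by (rule smooth_map_diff_map[OF inclusion])

lemma projection_smooth: "smooth_map N Q (orbit \<rho>)"
  using projection unfolding submersion_def by blast

lemma projection_diff: "diff_map N Q (orbit \<rho>)"
  by (rule smooth_map_diff_map[OF projection_smooth])

text \<open>The moment map is constant along the inclusion of the level set, and by
  \<open>d_moment_map\<close> its differential is 3 \<psi>_+(U, V, \<cdot>); the chain rule does the
  rest.\<close>

lemma tangent_level:
  assumes p: "p \<in> points N" and X: "X \<in> tangent_space N p"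
  shows "psi_re p [U p, V p, differential N M (\<lambda>p. p) p X] = 0"
proof -
  have pM: "p \<in> points M" using p points_subset by blast
  define c where "c = chart_at M p"
  define d where "d = chart_at N p"
  have c: "c \<in> charts_at M p" and d: "d \<in> charts_at N p"
    unfolding c_def d_def using chart_at_charts_at[OF M pM] chart_at_charts_at[OF N p] by auto
  interpret C: torus_chart M \<rho> p c by (rule torus_chart_at[OF c])
  let ?T = "cmap d ` {p \<in> cdom d. p \<in> cdom c}"
  let ?\<phi> = "local_rep d c (\<lambda>p. p)" and ?w = "cmap d p"
  let ?\<nu> = "\<lambda>z. Sc c z (gen_rep \<rho> c \<xi> z) (gen_rep \<rho> c \<eta> z)"
  have \<phi>w: "?\<phi> ?w = cmap c p" using cinv_cmap[OF N charts_atD[OF d]] by simp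
  have const: "s = ?\<nu> (?\<phi> w)" if w: "w \<in> ?T" for w
  proof -
    obtain q where q: "q \<in> cdom d" "q \<in> cdom c" "w = cmap d q" using w by blast
    have cq: "c \<in> charts_at M q" using q(2) charts_atD(1)[OF c] by (simp add: charts_at_def)
    have "q \<in> points N" using q(1) chart_subset[OF N charts_atD(1)[OF d]] by blast
    from moment[OF this] show ?thesis
      unfolding generator_chart[OF charts_atD(1)[OF c] q(2)]
      by (simp add: q(3) cinv_cmap[OF N charts_atD(1)[OF d] q(1)] in_chart_cmap[OF M cq])
  qed
  have opn: "open ?T"
    by (rule local_rep_domain_open[OF N M _ charts_atD(1)[OF d] charts_atD(1)[OF c]])
      (use inclusion_diff in \<open>simp add: diff_map_def\<close>)
  have mem: "?w \<in> ?T" using charts_atD(2)[OF d] charts_atD(2)[OF c] by blast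
  have chain: "((\<lambda>w. ?\<nu> (?\<phi> w)) has_derivative (\<lambda>x. D ?\<nu> (cmap c p) (D ?\<phi> ?w x))) (at ?w)"
  proof (rule has_derivative_compose[where f = ?\<phi> and g = ?\<nu>])
    show "(?\<phi> has_derivative D ?\<phi> ?w) (at ?w)"
      by (rule D_works[OF diff_mapD[OF inclusion_diff d c]])
    have "?\<nu> differentiable (at (cmap c p))"
      by (rule differentiableI, rule form2_D[OF sigma_form2_at[OF c] C.gen_rep_derivative C.gen_rep_derivative])
    then show "(?\<nu> has_derivative D ?\<nu> (cmap c p)) (at (?\<phi> ?w))"
      unfolding \<phi>w by (rule D_works)
  qed
  have "((\<lambda>w. s) has_derivative (\<lambda>x. D ?\<nu> (cmap c p) (D ?\<phi> ?w x))) (at ?w)"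
    by (rule has_derivative_transform_within_open[OF chain opn mem]) (rule const[symmetric])
  from fun_cong[OF has_derivative_unique[OF this has_derivative_const]]
  have "D ?\<nu> (cmap c p) (D ?\<phi> ?w (X d)) = 0" .
  moreover have "D ?\<nu> (cmap c p) (D ?\<phi> ?w (X d)) = 3 * Pc c (cmap c p) (gen_rep \<rho> c \<xi> (cmap c p))
      (gen_rep \<rho> c \<eta> (cmap c p)) (D ?\<phi> ?w (X d))"
    unfolding c_def by (rule d_moment_map[OF pM])
  ultimately have "Pc c (cmap c p) (gen_rep \<rho> c \<xi> (cmap c p)) (gen_rep \<rho> c \<eta> (cmap c p)) (D ?\<phi> ?w (X d)) = 0"
    by linarith
  then show ?thesis
    using differential_tvec[OF N M inclusion_diff d c, of "X d"]
    unfolding in_chart_cmap[OF M c] tangent_tvec[OF X d]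
    by (simp add: generator_chart[OF charts_atD[OF c]])
qed

end

section \<open>Pulling equations on the quotient back to the level set\<close>

locale reduction_point = torus_reduction M g J psi_re psi_im \<rho> N Q \<xi> \<eta> s
  for M :: "('a, real^6) mfd" and g J psi_re psi_im \<rho> N Q \<xi> \<eta> s +
  fixes p assumes p: "p \<in> points N"
begin

text \<open>\<open>c\<close> and \<open>e\<close> are the charts in which \<open>ext_deriv\<close>
  computes at \<open>p\<close> and at its orbit, so the coordinate results apply to it without a
  change of chart.\<close>

definition "c = chart_at M p"
definition "d = chart_at N p"
definition "e = chart_at Q (orbit \<rho> p)"

abbreviation "\<phi> \<equiv> local_rep d c (\<lambda>p. p)"
abbreviation "\<pi> \<equiv> local_rep d e (orbit \<rho>)"
abbreviation "w0 \<equiv> cmap d p"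
abbreviation "T \<equiv> cmap d ` {p \<in> cdom d. p \<in> cdom c}"
abbreviation "T' \<equiv> cmap d ` {p \<in> cdom d. orbit \<rho> p \<in> cdom e}"

lemma pM: "p \<in> points M" using p points_subset by blast

lemma orbit_points: "orbit \<rho> p \<in> points Q"
  using projection_diff p unfolding diff_map_def continuous_map_def by blast

lemma c: "c \<in> charts_at M p" and d: "d \<in> charts_at N p" and e: "e \<in> charts_at Q (orbit \<rho> p)"
  unfolding c_def d_def e_def
  using chart_at_charts_at[OF M pM] chart_at_charts_at[OF N p] chart_at_charts_at[OF Q orbit_points] by auto

lemma \<phi>_smooth: "smooth_on T \<phi>"
  using inclusion charts_atD(1)[OF d] charts_atD(1)[OF c] unfolding smooth_map_def by blast

lemma \<pi>_smooth: "smooth_on T' \<pi>"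
  using projection_smooth charts_atD(1)[OF d] charts_atD(1)[OF e] unfolding smooth_map_def by blast

lemma T_open: "open T"
  by (rule local_rep_domain_open[OF N M _ charts_atD(1)[OF d] charts_atD(1)[OF c]])
    (use inclusion_diff in \<open>simp add: diff_map_def\<close>)

lemma T'_open: "open T'"
  by (rule local_rep_domain_open[OF N Q _ charts_atD(1)[OF d] charts_atD(1)[OF e]])
    (use projection_diff in \<open>simp add: diff_map_def\<close>)

lemma w0_T: "w0 \<in> T" and w0_T': "w0 \<in> T'"
  using charts_atD(2)[OF c] charts_atD(2)[OF d] charts_atD(2)[OF e] by blast+

lemma \<phi>_w0: "\<phi> w0 = cmap c p" and \<pi>_w0: "\<pi> w0 = cmap e (orbit \<rho> p)"
  using cinv_cmap[OF N charts_atD[OF d]] by simp_all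

lemma in_T:
  assumes "w \<in> T"
  obtains q where "q \<in> points N" "w = cmap d q" "\<phi> w = cmap c q" "c \<in> charts_at M q" "d \<in> charts_at N q"
proof -
  obtain q where q: "q \<in> cdom d" "q \<in> cdom c" "w = cmap d q" using assms by blast
  then show ?thesis
    using that[of q] charts_atD(1)[OF c] charts_atD(1)[OF d] subsetD[OF chart_subset[OF N charts_atD(1)[OF d]]]
    by (simp add: charts_at_def cinv_cmap[OF N])
qed

lemma in_T_T':
  assumes "w \<in> T \<inter> T'"
  obtains q where "q \<in> points N" "w = cmap d q" "\<phi> w = cmap c q" "c \<in> charts_at M q" "d \<in> charts_at N q"
    "\<pi> w = cmap e (orbit \<rho> q)" "e \<in> charts_at Q (orbit \<rho> q)"
proof -
  from assms obtain q where q: "q \<in> points N" "w = cmap d q" "\<phi> w = cmap c q" "c \<in> charts_at M q" "d \<in> charts_at N q"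
    using in_T[OF IntD1] by blast
  obtain q' where q': "q' \<in> cdom d" "orbit \<rho> q' \<in> cdom e" "w = cmap d q'" using assms by blast
  have inv: "cinv d w = q" unfolding q(2) by (rule cinv_cmap[OF N charts_atD[OF q(5)]])
  moreover have "cinv d w = q'" unfolding q'(3) by (rule cinv_cmap[OF N charts_atD(1)[OF d] q'(1)])
  ultimately have "orbit \<rho> q \<in> cdom e" using q'(2) by simp
  then have "e \<in> charts_at Q (orbit \<rho> q)" using charts_atD(1)[OF e] by (simp add: charts_at_def)
  moreover have "\<pi> w = cmap e (orbit \<rho> q)" by (simp add: inv)
  ultimately show ?thesis using that q by blast
qed

lemma level_chart:
  "level_chart (Sc c) (Gc c) (Pc c) (Qc c) (gen_rep \<rho> c \<xi>) (gen_rep \<rho> c \<eta>)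
    (gen_deriv \<rho> c \<xi> (cmap c p)) (gen_deriv \<rho> c \<eta> (cmap c p)) s \<phi> T w0 (cmap c p)"
proof -
  interpret C: torus_chart M \<rho> p c by (rule torus_chart_at[OF c])
  show ?thesis
  proof (unfold_locales)
    show "form2_at (cmap c p) (Sc c)" by (rule sigma_form2_at[OF c])
    show "form3_at (cmap c p) (Qc c)" by (rule smooth_form_form3_at[OF M forms(2) c])
    show "\<forall>\<^sub>F z in nhds (cmap c p). bilinear (Gc c z)" by (rule Gc_bilinear_eventually[OF c])
    show "(\<lambda>z. Gc c z x y) differentiable (at (cmap c p))" for x y by (rule Gc_differentiable[OF c])
    show "\<forall>\<^sub>F z in nhds (cmap c p). su3_model (Gc c z) (Sc c z) (Pc c z) (Qc c z)"
      by (rule su3_model_eventually[OF c])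
    show "(gen_rep \<rho> c \<xi> has_derivative gen_deriv \<rho> c \<xi> (cmap c p)) (at (cmap c p))"
      "(gen_rep \<rho> c \<eta> has_derivative gen_deriv \<rho> c \<eta> (cmap c p)) (at (cmap c p))"
      by (rule C.gen_rep_derivative)+
    show "D (\<lambda>z. Qc c z x y w) (cmap c p) (gen_rep \<rho> c \<xi> (cmap c p)) + Qc c (cmap c p) (gen_deriv \<rho> c \<xi> (cmap c p) x) y w
      + Qc c (cmap c p) x (gen_deriv \<rho> c \<xi> (cmap c p) y) w + Qc c (cmap c p) x y (gen_deriv \<rho> c \<xi> (cmap c p) w) = 0" for x y w
      by (rule C.Lie_form3[OF smooth_form_form3_at[OF M forms(2) c] psi_invariant])
    show "D (\<lambda>z. Qc c z x y w) (cmap c p) (gen_rep \<rho> c \<eta> (cmap c p)) + Qc c (cmap c p) (gen_deriv \<rho> c \<eta> (cmap c p) x) y w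
      + Qc c (cmap c p) x (gen_deriv \<rho> c \<eta> (cmap c p) y) w + Qc c (cmap c p) x y (gen_deriv \<rho> c \<eta> (cmap c p) w) = 0" for x y w
      by (rule C.Lie_form3[OF smooth_form_form3_at[OF M forms(2) c] psi_invariant])
    show "D (\<lambda>z. Sc c z x y) (cmap c p) (gen_rep \<rho> c \<eta> (cmap c p)) + Sc c (cmap c p) (gen_deriv \<rho> c \<eta> (cmap c p) x) y
      + Sc c (cmap c p) x (gen_deriv \<rho> c \<eta> (cmap c p) y) = 0" for x y
      by (rule C.Lie_form2[OF sigma_form2_at[OF c] sigma_invariant])
    show "gen_deriv \<rho> c \<xi> (cmap c p) (gen_rep \<rho> c \<eta> (cmap c p)) = gen_deriv \<rho> c \<eta> (cmap c p) (gen_rep \<rho> c \<xi> (cmap c p))"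
      by (rule C.gen_commute)
    show "ed2 (Sc c) (cmap c p) x y w = 3 * Pc c (cmap c p) x y w" for x y w
      unfolding c_def by (rule d_sigma[OF pM])
    show "ed3 (Qc c) (cmap c p) x y w t = - 4 * (Sc c (cmap c p) x y * Sc c (cmap c p) w t
      - Sc c (cmap c p) x w * Sc c (cmap c p) y t + Sc c (cmap c p) x t * Sc c (cmap c p) y w)" for x y w t
      unfolding c_def by (rule d_psi[OF pM])
    show "smooth_on T \<phi>" "open T" "w0 \<in> T" "\<phi> w0 = cmap c p" "s \<noteq> 0"
      by (rule \<phi>_smooth T_open w0_T \<phi>_w0 s)+
    fix w assume "w \<in> T"
    then obtain q where q: "q \<in> points N" "w = cmap d q" "\<phi> w = cmap c q" "c \<in> charts_at M q" "d \<in> charts_at N q"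
      by (rule in_T)
    note gen = generator_chart[OF charts_atD[OF q(4)], symmetric]
    show "Sc c (\<phi> w) (gen_rep \<rho> c \<xi> (\<phi> w)) (gen_rep \<rho> c \<eta> (\<phi> w)) = s"
      using moment[OF q(1)] unfolding q(3) by (simp add: in_chart_cmap[OF M q(4)] gen)
    show "Pc c (\<phi> w) (gen_rep \<rho> c \<xi> (\<phi> w)) (gen_rep \<rho> c \<eta> (\<phi> w)) (D \<phi> w x) = 0" for x
      using tangent_level[OF q(1) tvec_in_tangent_space[OF N q(5), of x]]
      unfolding q(3) unfolding q(2) differential_tvec[OF N M inclusion_diff q(5,4)]
      by (simp add: in_chart_cmap[OF M q(4)] gen)
    obtain X where X: "X \<in> tangent_space M q" "psi_re q [U q, V q, X] \<noteq> 0" using regular[OF q(1)] by blast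
    have "Pc c (\<phi> w) (gen_rep \<rho> c \<xi> (\<phi> w)) (gen_rep \<rho> c \<eta> (\<phi> w)) (X c) \<noteq> 0"
      using X(2) unfolding q(3) by (simp add: in_chart_cmap[OF M q(4)] gen tangent_tvec[OF X(1) q(4)])
    then show "\<exists>y. Pc c (\<phi> w) (gen_rep \<rho> c \<xi> (\<phi> w)) (gen_rep \<rho> c \<eta> (\<phi> w)) y \<noteq> 0" by blast
  qed
qed

sublocale L: level_chart "Sc c" "Gc c" "Pc c" "Qc c" "gen_rep \<rho> c \<xi>" "gen_rep \<rho> c \<eta>"
    "gen_deriv \<rho> c \<xi> (cmap c p)" "gen_deriv \<rho> c \<eta> (cmap c p)" s \<phi> T w0 "cmap c p"
  by (rule level_chart)

lemma
  assumes q: "c \<in> charts_at M q"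
  shows alpha0_in_chart: "alpha0 psi_im U V q [tvec M c q x] = L.a0 (cmap c q) x"
    and alpha1_in_chart: "alpha1 g J U V s q [tvec M c q x] = L.a1 (cmap c q) x"
    and alpha2_in_chart: "alpha2 g J U V s q [tvec M c q x] = L.a2 (cmap c q) x"
    and hsq_in_chart: "hsq g U V q = L.h (cmap c q)"
  unfolding alpha0_def alpha1_def alpha2_def theta1_def theta2_def contract_def flat_def hsq_def
    L.a0_def L.a1_def L.a2_def L.th1_def L.th2_def L.h_def
  by (simp_all add: in_chart_cmap[OF M q] generator_chart[OF charts_atD[OF q]] cinv_cmap[OF M charts_atD[OF q]])

text \<open>The projection is a submersion, so every tangent vector of the quotient comes from one
  of the level set; equations on the quotient can therefore be checked after pulling them
  back.\<close>

lemma lift: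
  assumes "X \<in> tangent_space Q (orbit \<rho> p)"
  obtains x where "X e = D \<pi> w0 x" "\<And>\<alpha>. \<alpha> (orbit \<rho> p) [X] = in_chart Q e \<alpha> (\<pi> w0) [D \<pi> w0 x]"
proof -
  obtain X' where X': "X' \<in> tangent_space N p" "X = differential N Q (orbit \<rho>) p X'"
    using projection p assms unfolding submersion_def by blast
  have X: "X = tvec Q e (orbit \<rho> p) (D \<pi> w0 (X' d))"
    using differential_tvec[OF N Q projection_diff d e, of "X' d"] X' tangent_tvec[OF X'(1) d] by simp
  show ?thesis
    by (rule that[of "X' d"]) (simp_all only: X tvec_self[OF Q e] \<pi>_w0 in_chart_cmap[OF Q e] list.map)
qed

lemma pullback_eq_1:
  assumes eq: "form_eq N 1 (pullback N Q (orbit \<rho>) \<alpha>) (pullback N M (\<lambda>p. p) \<beta>)"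
    and \<beta>: "\<And>q x. c \<in> charts_at M q \<Longrightarrow> \<beta> q [tvec M c q x] = B (cmap c q) x"
    and w: "w \<in> T \<inter> T'"
  shows "in_chart Q e \<alpha> (\<pi> w) [D \<pi> w x] = B (\<phi> w) (D \<phi> w x)"
proof -
  obtain q where q: "q \<in> points N" "w = cmap d q" "\<phi> w = cmap c q" "c \<in> charts_at M q" "d \<in> charts_at N q"
    and eq': "e \<in> charts_at Q (orbit \<rho> q)"
    by (rule in_T_T'[OF w]) blast
  have "pullback N Q (orbit \<rho>) \<alpha> q (map (tvec N d q) [x]) = pullback N M (\<lambda>p. p) \<beta> q (map (tvec N d q) [x])"
    using eq q(1) tvec_in_tangent_space[OF N q(5)] unfolding form_eq_def by simp
  then show ?thesis
    unfolding pullback_in_chart[OF N Q projection_diff q(5) eq'] pullback_in_chart[OF N M inclusion_diff q(5,4)]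
    unfolding q(2)[symmetric] unfolding q(3) by (simp add: in_chart_cmap[OF M q(4)] \<beta>[OF q(4)])
qed

lemma eventually_T: "\<forall>\<^sub>F w in nhds w0. w \<in> T \<inter> T'"
  by (rule eventually_nhds_in_open) (use T_open T'_open w0_T w0_T' in blast)+

text \<open>\<open>\<alpha>\<close> on the quotient and \<open>\<beta>\<close> on the ambient
  manifold have the same pull-back to the level set near \<open>w0\<close>, and the exterior
  derivative commutes with both pull-backs.\<close>

lemma ed1_reduction:
  assumes \<alpha>: "smooth_form Q 1 \<alpha>"
    and eq: "form_eq N 1 (pullback N Q (orbit \<rho>) \<alpha>) (pullback N M (\<lambda>p. p) \<beta>)"
    and \<beta>: "\<And>q x. c \<in> charts_at M q \<Longrightarrow> \<beta> q [tvec M c q x] = B (cmap c q) x"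
    and B: "form1_at (cmap c p) B"
  shows "ed1 (\<lambda>z x. in_chart Q e \<alpha> z [x]) (\<pi> w0) (D \<pi> w0 x) (D \<pi> w0 y) = ed1 B (cmap c p) (D \<phi> w0 x) (D \<phi> w0 y)"
proof -
  have a: "form1_at (\<pi> w0) (\<lambda>z x. in_chart Q e \<alpha> z [x])"
    unfolding \<pi>_w0 by (rule smooth_form_form1_at[OF Q \<alpha> e])
  have B': "form1_at (\<phi> w0) B" unfolding \<phi>_w0 by (rule B)
  have "D (\<lambda>w. in_chart Q e \<alpha> (\<pi> w) [D \<pi> w x]) w0 = D (\<lambda>w. B (\<phi> w) (D \<phi> w x)) w0" for x
  proof (rule D_eventually_eq)
    show "\<forall>\<^sub>F w in nhds w0. in_chart Q e \<alpha> (\<pi> w) [D \<pi> w x] = B (\<phi> w) (D \<phi> w x)"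
      using eventually_T by (rule eventually_mono) (rule pullback_eq_1[OF eq \<beta>])
    show "(\<lambda>w. in_chart Q e \<alpha> (\<pi> w) [D \<pi> w x]) differentiable (at w0)"
      by (rule differentiableI, rule form1_compose[OF a
            D_works[OF smooth_on_differentiable[OF \<pi>_smooth w0_T']]
            D_works[OF smooth_on_differentiable[OF smooth_on_D[OF \<pi>_smooth] w0_T']]])
  qed
  then have e: "ed1 (\<lambda>w x. in_chart Q e \<alpha> (\<pi> w) [D \<pi> w x]) w0 x y = ed1 (\<lambda>w x. B (\<phi> w) (D \<phi> w x)) w0 x y"
    unfolding ed1_def by presburger
  have "ed1 (\<lambda>z x. in_chart Q e \<alpha> z [x]) (\<pi> w0) (D \<pi> w0 x) (D \<pi> w0 y)
      = ed1 (\<lambda>w x. in_chart Q e \<alpha> (\<pi> w) [D \<pi> w x]) w0 x y"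
    by (rule ed1_pullback[OF \<pi>_smooth T'_open w0_T' a, symmetric])
  also have "\<dots> = ed1 B (\<phi> w0) (D \<phi> w0 x) (D \<phi> w0 y)"
    unfolding e by (rule ed1_pullback[OF \<phi>_smooth T_open w0_T B'])
  finally show ?thesis unfolding \<phi>_w0 .
qed

text \<open>For functions the comparison uses only the chain rule, as \<open>F\<close> along the
  projection and \<open>L.f\<close> along the inclusion agree near \<open>w0\<close>.
  Differentiability of \<open>F\<close> at the orbit rests on h^2 > s^2, which regularity
  provides.\<close>

lemma D_reduction:
  assumes H: "smooth_form Q 0 (fun_form H)"
    and eq: "form_eq N 0 (pullback N Q (orbit \<rho>) (fun_form H)) (pullback N M (\<lambda>p. p) (fun_form (hsq g U V)))"
    and F: "\<And>q. F q = 4 * H q / (H q - s\<^sup>2)"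
  shows "H (orbit \<rho> p) = L.h (cmap c p)" "F (orbit \<rho> p) = L.f (cmap c p)"
    "D (\<lambda>z. F (cinv e z)) (\<pi> w0) (D \<pi> w0 x) = D L.f (cmap c p) (D \<phi> w0 x)"
proof -
  have Hq: "H (orbit \<rho> q) = L.h (cmap c q)" if "q \<in> points N" "c \<in> charts_at M q" for q
  proof -
    have "pullback N Q (orbit \<rho>) (fun_form H) q [] = pullback N M (\<lambda>p. p) (fun_form (hsq g U V)) q []"
      using eq that(1) unfolding form_eq_def by simp
    then show ?thesis using hsq_in_chart[OF that(2)] by (simp add: pullback_def fun_form_def)
  qed
  show Hp: "H (orbit \<rho> p) = L.h (cmap c p)" by (rule Hq[OF p c])
  show Fp: "F (orbit \<rho> p) = L.f (cmap c p)" by (simp add: F Hp L.f_def)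
  have inv: "cinv e (\<pi> w0) = orbit \<rho> p" unfolding \<pi>_w0 by (rule cinv_cmap[OF Q charts_atD[OF e]])
  have "smooth_on (cmap e ` cdom e) (\<lambda>z. H (cinv e z))"
    using smooth_form_smooth_on[OF H charts_atD(1)[OF e], of "[]"] by (simp add: in_chart_def fun_form_def)
  then have Hd: "(\<lambda>z. H (cinv e z)) differentiable (at (\<pi> w0))"
    unfolding \<pi>_w0 by (rule smooth_on_differentiable) (rule imageI[OF charts_atD(2)[OF e]])
  have Fd: "(\<lambda>z. F (cinv e z)) differentiable (at (\<pi> w0))"
    unfolding F
  proof (rule differentiable_divide[OF differentiable_mult[OF differentiable_const Hd] differentiable_diff[OF Hd differentiable_const]])
    show "H (cinv e (\<pi> w0)) - s\<^sup>2 \<noteq> 0" unfolding inv Hp using L.h0(1) by simp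
  qed
  have c1: "((\<lambda>w. F (cinv e (\<pi> w))) has_derivative (\<lambda>x. D (\<lambda>z. F (cinv e z)) (\<pi> w0) (D \<pi> w0 x))) (at w0)"
    by (rule has_derivative_compose[OF D_works[OF smooth_on_differentiable[OF \<pi>_smooth w0_T']] D_works[OF Fd]])
  have c2: "((\<lambda>w. L.f (\<phi> w)) has_derivative (\<lambda>x. D L.f (\<phi> w0) (D \<phi> w0 x))) (at w0)"
    by (rule has_derivative_compose[OF D_works[OF smooth_on_differentiable[OF \<phi>_smooth w0_T]] D_works])
      (unfold \<phi>_w0, rule L.f_differentiable)
  have deq: "D (\<lambda>w. F (cinv e (\<pi> w))) w0 = D (\<lambda>w. L.f (\<phi> w)) w0"
  proof (rule D_eventually_eq)
    show "(\<lambda>w. F (cinv e (\<pi> w))) differentiable (at w0)"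
      using c1 by (rule differentiableI)
    show "\<forall>\<^sub>F w in nhds w0. F (cinv e (\<pi> w)) = L.f (\<phi> w)"
      using eventually_T
    proof (rule eventually_mono)
      fix w assume w: "w \<in> T \<inter> T'"
      then obtain q where q: "q \<in> points N" "\<phi> w = cmap c q" "c \<in> charts_at M q"
        "\<pi> w = cmap e (orbit \<rho> q)" "e \<in> charts_at Q (orbit \<rho> q)"
        by (rule in_T_T')
      have "cinv e (\<pi> w) = orbit \<rho> q"
        unfolding q(4) by (rule cinv_cmap[OF Q charts_atD[OF q(5)]])
      then show "F (cinv e (\<pi> w)) = L.f (\<phi> w)"
        unfolding q(2) by (simp add: F Hq[OF q(1,3)] L.f_def)
    qed
  qed
  have "(\<lambda>x. D (\<lambda>z. F (cinv e z)) (\<pi> w0) (D \<pi> w0 x)) = (\<lambda>x. D L.f (\<phi> w0) (D \<phi> w0 x))"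
    using deq unfolding D_eqI[OF c1] D_eqI[OF c2] .
  from fun_cong[OF this, of x]
  show "D (\<lambda>z. F (cinv e z)) (\<pi> w0) (D \<pi> w0 x) = D L.f (cmap c p) (D \<phi> w0 x)" unfolding \<phi>_w0 .
qed

end

section \<open>The structure equations on the quotient\<close>

context reduction_point
begin

lemma d_alpha0:
  assumes 0: "smooth_form Q 1 \<alpha>0" "form_eq N 1 (pullback N Q (orbit \<rho>) \<alpha>0) (pullback N M (\<lambda>p. p) (alpha0 psi_im U V))"
    and 1: "form_eq N 1 (pullback N Q (orbit \<rho>) \<alpha>1) (pullback N M (\<lambda>p. p) (alpha1 g J U V s))"
    and 2: "form_eq N 1 (pullback N Q (orbit \<rho>) \<alpha>2) (pullback N M (\<lambda>p. p) (alpha2 g J U V s))"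
    and H: "smooth_form Q 0 (fun_form H)"
      "form_eq N 0 (pullback N Q (orbit \<rho>) (fun_form H)) (pullback N M (\<lambda>p. p) (fun_form (hsq g U V)))"
    and F: "\<And>q. F q = 4 * H q / (H q - s\<^sup>2)"
    and X: "X \<in> tangent_space Q (orbit \<rho> p)" and Y: "Y \<in> tangent_space Q (orbit \<rho> p)"
  shows "ext_deriv Q \<alpha>0 (orbit \<rho> p) [X, Y] =
    F (orbit \<rho> p) * (\<alpha>1 (orbit \<rho> p) [X] * \<alpha>2 (orbit \<rho> p) [Y] - \<alpha>1 (orbit \<rho> p) [Y] * \<alpha>2 (orbit \<rho> p) [X])"
proof -
  obtain x where x: "X e = D \<pi> w0 x" "\<And>\<alpha>. \<alpha> (orbit \<rho> p) [X] = in_chart Q e \<alpha> (\<pi> w0) [D \<pi> w0 x]"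
    using lift[OF X] by blast
  obtain y where y: "Y e = D \<pi> w0 y" "\<And>\<alpha>. \<alpha> (orbit \<rho> p) [Y] = in_chart Q e \<alpha> (\<pi> w0) [D \<pi> w0 y]"
    using lift[OF Y] by blast
  have w0: "w0 \<in> T \<inter> T'" using w0_T w0_T' by blast
  have v1: "in_chart Q e \<alpha>1 (\<pi> w0) [D \<pi> w0 x] = L.a1 (cmap c p) (D \<phi> w0 x)" for x
    unfolding \<phi>_w0[symmetric] by (rule pullback_eq_1[OF 1 alpha1_in_chart w0])
  have v2: "in_chart Q e \<alpha>2 (\<pi> w0) [D \<pi> w0 x] = L.a2 (cmap c p) (D \<phi> w0 x)" for x
    unfolding \<phi>_w0[symmetric] by (rule pullback_eq_1[OF 2 alpha2_in_chart w0])
  have "ext_deriv Q \<alpha>0 (orbit \<rho> p) [X, Y] = ed1 L.a0 (cmap c p) (D \<phi> w0 x) (D \<phi> w0 y)"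
    unfolding ext_deriv_1 e_def[symmetric] x(1) y(1) \<pi>_w0[symmetric]
    by (rule ed1_reduction[OF 0 alpha0_in_chart L.a0_form1])
  then show ?thesis
    unfolding L.d_a0 D_reduction(2)[OF H F] x(2) y(2) v1 v2 .
qed

lemma d_alpha1:
  assumes 0: "form_eq N 1 (pullback N Q (orbit \<rho>) \<alpha>0) (pullback N M (\<lambda>p. p) (alpha0 psi_im U V))"
    and 1: "smooth_form Q 1 \<alpha>1" "form_eq N 1 (pullback N Q (orbit \<rho>) \<alpha>1) (pullback N M (\<lambda>p. p) (alpha1 g J U V s))"
    and H: "smooth_form Q 0 (fun_form H)"
      "form_eq N 0 (pullback N Q (orbit \<rho>) (fun_form H)) (pullback N M (\<lambda>p. p) (fun_form (hsq g U V)))"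
    and F: "\<And>q. F q = 4 * H q / (H q - s\<^sup>2)"
    and X: "X \<in> tangent_space Q (orbit \<rho> p)" and Y: "Y \<in> tangent_space Q (orbit \<rho> p)"
    and Z: "Z \<in> tangent_space Q (orbit \<rho> p)"
  shows "form_wedge 2 1 (ext_deriv Q \<alpha>1) \<alpha>0 (orbit \<rho> p) [X, Y, Z] =
    form_wedge 2 1 (form_wedge 1 1 (\<lambda>q Xs. - ext_deriv Q (fun_form F) q Xs / F q) \<alpha>1) \<alpha>0 (orbit \<rho> p) [X, Y, Z]"
proof -
  obtain x where x: "X e = D \<pi> w0 x" "\<And>\<alpha>. \<alpha> (orbit \<rho> p) [X] = in_chart Q e \<alpha> (\<pi> w0) [D \<pi> w0 x]"
    using lift[OF X] by blast
  obtain y where y: "Y e = D \<pi> w0 y" "\<And>\<alpha>. \<alpha> (orbit \<rho> p) [Y] = in_chart Q e \<alpha> (\<pi> w0) [D \<pi> w0 y]"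
    using lift[OF Y] by blast
  obtain z where z: "Z e = D \<pi> w0 z" "\<And>\<alpha>. \<alpha> (orbit \<rho> p) [Z] = in_chart Q e \<alpha> (\<pi> w0) [D \<pi> w0 z]"
    using lift[OF Z] by blast
  have w0: "w0 \<in> T \<inter> T'" using w0_T w0_T' by blast
  have v0: "in_chart Q e \<alpha>0 (\<pi> w0) [D \<pi> w0 x] = L.a0 (cmap c p) (D \<phi> w0 x)" for x
    unfolding \<phi>_w0[symmetric] by (rule pullback_eq_1[OF 0 alpha0_in_chart w0])
  have v1: "in_chart Q e \<alpha>1 (\<pi> w0) [D \<pi> w0 x] = L.a1 (cmap c p) (D \<phi> w0 x)" for x
    unfolding \<phi>_w0[symmetric] by (rule pullback_eq_1[OF 1(2) alpha1_in_chart w0])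
  have dF: "ext_deriv Q (fun_form F) (orbit \<rho> p) [W] = D L.f (cmap c p) (D \<phi> w0 w)"
    if "W e = D \<pi> w0 w" for W w
    unfolding ext_deriv_function e_def[symmetric] that \<pi>_w0[symmetric] by (rule D_reduction(3)[OF H F])
  have d1: "ext_deriv Q \<alpha>1 (orbit \<rho> p) [W, W'] = ed1 L.a1 (cmap c p) (D \<phi> w0 w) (D \<phi> w0 w')"
    if "W e = D \<pi> w0 w" "W' e = D \<pi> w0 w'" for W w W' w'
    unfolding ext_deriv_1 e_def[symmetric] that \<pi>_w0[symmetric]
    by (rule ed1_reduction[OF 1 alpha1_in_chart L.a1_form1])
  have anti: "ed1 L.a1 (cmap c p) a b = - ed1 L.a1 (cmap c p) b a" for a b by (simp add: ed1_def)
  have f: "L.f (cmap c p) \<noteq> 0" using L.h0 by (simp add: L.f_def)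
  let ?x = "D \<phi> w0 x" and ?y = "D \<phi> w0 y" and ?z = "D \<phi> w0 z" and ?p = "cmap c p"
  \<comment> \<open>\<open>wedge_2_1\<close> has six terms and a division by 2; antisymmetry of
    \<open>ed1\<close> merges them in pairs.\<close>
  have "form_wedge 2 1 (ext_deriv Q \<alpha>1) \<alpha>0 (orbit \<rho> p) [X, Y, Z] =
      ed1 L.a1 ?p ?x ?y * L.a0 ?p ?z - ed1 L.a1 ?p ?x ?z * L.a0 ?p ?y + ed1 L.a1 ?p ?y ?z * L.a0 ?p ?x"
    unfolding form_wedge_def wedge_2_1 d1[of X x Y y, OF x(1) y(1)] d1[of Y y X x, OF y(1) x(1)] d1[of X x Z z, OF x(1) z(1)] d1[of Z z X x, OF z(1) x(1)]
      d1[of Y y Z z, OF y(1) z(1)] d1[of Z z Y y, OF z(1) y(1)] x(2) y(2) z(2) v0 anti[of ?y ?x] anti[of ?z ?x] anti[of ?z ?y]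
    by simp
  also have "\<dots> = - ((D L.f ?p ?x * L.a1 ?p ?y - D L.f ?p ?y * L.a1 ?p ?x) * L.a0 ?p ?z
      - (D L.f ?p ?x * L.a1 ?p ?z - D L.f ?p ?z * L.a1 ?p ?x) * L.a0 ?p ?y
      + (D L.f ?p ?y * L.a1 ?p ?z - D L.f ?p ?z * L.a1 ?p ?y) * L.a0 ?p ?x) / L.f ?p"
    using L.d_a1[of x y z] f by (simp add: eq_divide_eq mult.commute)
  also have "\<dots> = form_wedge 2 1 (form_wedge 1 1 (\<lambda>q Xs. - ext_deriv Q (fun_form F) q Xs / F q) \<alpha>1) \<alpha>0 (orbit \<rho> p) [X, Y, Z]"
    unfolding form_wedge_def wedge_1_1_1 dF[of X x, OF x(1)] dF[of Y y, OF y(1)] dF[of Z z, OF z(1)] D_reduction(2)[OF H F]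
    unfolding x(2)[of \<alpha>0] y(2)[of \<alpha>0] z(2)[of \<alpha>0] x(2)[of \<alpha>1] y(2)[of \<alpha>1] z(2)[of \<alpha>1] v0 v1
    using f by (simp add: field_simps)
  finally show ?thesis .
qed

end

text \<open>The pair (V, -U) arises from (U, V) by a quarter turn, of determinant one, so quantities
  alternating in the pair and the Gram determinant \<open>hsq\<close> are unchanged. As it is
  generated by \<open>\<eta>\<close> and \<open>- \<xi>\<close>, it again fits the locale
  \<open>torus_reduction\<close>.\<close>

lemma generator_swap:
  fixes M :: "('a, real^6) mfd" and \<xi> \<eta> :: "real \<times> real"
  assumes nk: "nearly_kaehler_torus M g J psi_re psi_im \<rho>" and p: "p \<in> points M"
  defines "U \<equiv> generator M \<rho> \<xi>" and "V \<equiv> generator M \<rho> \<eta>" and "U' \<equiv> generator M \<rho> (- \<xi>)"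
  shows "fundamental_form g J p [V p, U' p] = fundamental_form g J p [U p, V p]"
    and "X \<in> tangent_space M p \<Longrightarrow> psi_re p [V p, U' p, X] = psi_re p [U p, V p, X]"
    and "X \<in> tangent_space M p \<Longrightarrow> alpha0 psi_im V U' p [X] = alpha0 psi_im U V p [X]"
    and "X \<in> tangent_space M p \<Longrightarrow> alpha1 g J V U' s p [X] = alpha2 g J U V s p [X]"
    and "hsq g V U' p = hsq g U V p"
proof -
  interpret nearly_kaehler_torus M g J psi_re psi_im \<rho> by (rule nk)
  define c where "c = chart_at M p"
  have c: "c \<in> charts_at M p" unfolding c_def by (rule chart_at_charts_at[OF M p])
  interpret C: torus_chart M \<rho> p c by (rule torus_chart_at[OF c])
  define u where "u = gen_rep \<rho> c \<xi> (cmap c p)"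
  define v where "v = gen_rep \<rho> c \<eta> (cmap c p)"
  have UV: "U p = tvec M c p u" "V p = tvec M c p v" "U' p = tvec M c p (- u)"
    unfolding U_def V_def U'_def u_def v_def generator_tangent[OF M torus_action c] C.gen_rep_uminus[OF C.p_image]
    by (rule refl)+
  note S = form2_atD[OF sigma_form2_at[OF c]]
  note Pr = form3_atD[OF smooth_form_form3_at[OF M forms(1) c]]
  note Pi = form3_atD[OF smooth_form_form3_at[OF M forms(2) c]]
  note ic = in_chart_cmap[OF M c]
  have s: "\<sigma> p [tvec M c p v, tvec M c p (- u)] = \<sigma> p [tvec M c p u, tvec M c p v]"
    using linear_neg[OF S(2), of v u] S(4)[of v u] unfolding ic by simp
  have su: "\<sigma> p [tvec M c p (- u), tvec M c p x] = - \<sigma> p [tvec M c p u, tvec M c p x]" for x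
    using linear_neg[OF S(1), of u x] unfolding ic by simp
  have r: "psi_re p [tvec M c p v, tvec M c p (- u), tvec M c p x] = psi_re p [tvec M c p u, tvec M c p v, tvec M c p x]" for x
    using linear_neg[OF Pr(2), of v u x] Pr(4)[of v u x] unfolding ic by simp
  have i: "psi_im p [tvec M c p v, tvec M c p (- u), tvec M c p x] = psi_im p [tvec M c p u, tvec M c p v, tvec M c p x]" for x
    using linear_neg[OF Pi(2), of v u x] Pi(4)[of v u x] unfolding ic by simp
  note G = g_bilinear[OF p c]
  have g1: "g p (tvec M c p (- u)) (tvec M c p x) = - g p (tvec M c p u) (tvec M c p x)"
    "g p (tvec M c p x) (tvec M c p (- u)) = - g p (tvec M c p x) (tvec M c p u)" for x
    using bilinear_lneg[OF G] bilinear_rneg[OF G] by blast+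
  have g2: "g p (tvec M c p v) (tvec M c p u) = g p (tvec M c p u) (tvec M c p v)"
    by (rule g_commute[OF p]) (rule tvec_in_tangent_space[OF M c])+
  show "\<sigma> p [V p, U' p] = \<sigma> p [U p, V p]" unfolding UV by (rule s)
  show h: "hsq g V U' p = hsq g U V p" unfolding hsq_def UV g1 g2 by (simp add: power2_eq_square)
  assume "X \<in> tangent_space M p"
  then have X: "X = tvec M c p (X c)" using tangent_tvec[OF _ c] by metis
  obtain x where X: "X = tvec M c p x" using X by blast
  show "psi_re p [V p, U' p, X] = psi_re p [U p, V p, X]" unfolding UV X by (rule r)
  show "alpha0 psi_im V U' p [X] = alpha0 psi_im U V p [X]"
    unfolding alpha0_def contract_def UV X by (rule i)
  show "alpha1 g J V U' s p [X] = alpha2 g J U V s p [X]"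
    unfolding alpha1_def alpha2_def theta1_def theta2_def flat_def contract_def h
    unfolding UV X su by (simp add: g1 g2)
qed

theorem proposition4p2:
  fixes M :: "('a, real^6) mfd"
    and g :: "('a, real^6) bilinear_field"
    and J :: "('a, real^6) endo_field"
    and psi_re psi_im :: "('a, real^6) form"
    and \<rho> :: "complex \<times> complex \<Rightarrow> 'a \<Rightarrow> 'a"
    and \<xi> \<eta> :: "real \<times> real"
    and U V :: "'a \<Rightarrow> ('a, real^6) tangent"
    and \<nu> :: "'a \<Rightarrow> real"
    and s :: real
    and N :: "('a, real^5) mfd"
    and Q :: "('a set, real^3) mfd"
    and \<alpha>\<^sub>0 \<alpha>\<^sub>1 \<alpha>\<^sub>2 :: "('a set, real^3) form"
    and H f :: "'a set \<Rightarrow> real"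
  assumes "smooth_manifold M" and "compact_space (mspace M)" and "connected_space (mspace M)"
    and "nearly_kaehler M g J psi_re psi_im"
    and "torus_action M \<rho>" and "effective_action M \<rho>" and "preserves_structure M g J psi_re psi_im \<rho>"
    and "\<xi> \<noteq> \<eta>" and "independent {\<xi>, \<eta>}" and "span {\<xi>, \<eta>} = UNIV"
    and "U = generator M \<rho> \<xi>" and "V = generator M \<rho> \<eta>"
    and "\<nu> = multi_moment_map (fundamental_form g J) U V"
    and "regular_value M \<nu> s" and "s \<noteq> 0"
    and "level_manifold M \<nu> s N" and "quotient_manifold N \<rho> Q"
    and "descends_to M N \<rho> Q 1 (alpha0 psi_im U V) \<alpha>\<^sub>0"
    and "descends_to M N \<rho> Q 1 (alpha1 g J U V s) \<alpha>\<^sub>1"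
    and "descends_to M N \<rho> Q 1 (alpha2 g J U V s) \<alpha>\<^sub>2"
    and "descends_to M N \<rho> Q 0 (fun_form (hsq g U V)) (fun_form H)"
    and "f = (\<lambda>q. 4 * H q / (H q - s\<^sup>2))"
  shows "form_eq Q 2 (ext_deriv Q \<alpha>\<^sub>0) (\<lambda>q Xs. f q * form_wedge 1 1 \<alpha>\<^sub>1 \<alpha>\<^sub>2 q Xs) \<and>
    form_eq Q 3 (form_wedge 2 1 (ext_deriv Q \<alpha>\<^sub>1) \<alpha>\<^sub>0)
      (form_wedge 2 1 (form_wedge 1 1 (\<lambda>q Xs. - ext_deriv Q (fun_form f) q Xs / f q) \<alpha>\<^sub>1) \<alpha>\<^sub>0) \<and>
    form_eq Q 3 (form_wedge 2 1 (ext_deriv Q \<alpha>\<^sub>2) \<alpha>\<^sub>0)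
      (form_wedge 2 1 (form_wedge 1 1 (\<lambda>q Xs. - ext_deriv Q (fun_form f) q Xs / f q) \<alpha>\<^sub>2) \<alpha>\<^sub>0)"
proof -
  have nk: "nearly_kaehler_torus M g J psi_re psi_im \<rho>"
    by (rule nearly_kaehler_torus.intro) (rule assms)+
  interpret nearly_kaehler_torus M g J psi_re psi_im \<rho> by (rule nk)
  have N: "smooth_manifold N" and mN: "mspace N = subtopology (mspace M) {p. \<nu> p = s}"
    and inclusion: "smooth_map N M (\<lambda>p. p)"
    using \<open>level_manifold M \<nu> s N\<close> unfolding level_manifold_def immersion_def by blast+
  have Q: "smooth_manifold Q" and projection: "submersion N Q (orbit \<rho>)"
    and quotient: "quotient_map (mspace N) (mspace Q) (orbit \<rho>)"
    using \<open>quotient_manifold N \<rho> Q\<close> unfolding quotient_manifold_def by blast+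
  have surj: "orbit \<rho> ` points N = points Q" by (rule quotient_imp_surjective_map[OF quotient])
  have points: "points N \<subseteq> points M" using mN by auto
  have \<nu>: "\<sigma> p [U p, V p] = s" if "p \<in> points N" for p
    using that assms(13) mN unfolding multi_moment_map_def by simp
  \<comment> \<open>Regularity is given for d\<nu>; since d\<nu> = 3 \<psi>_+(U, V, \<cdot>), it
    provides a vector on which the latter does not vanish.\<close>
  have regular: "\<exists>X\<in>tangent_space M p. psi_re p [U p, V p, X] \<noteq> 0" if pN: "p \<in> points N" for p
  proof -
    have p: "p \<in> points M" using pN points by blast
    define c where "c = chart_at M p"
    have c: "c \<in> charts_at M p" unfolding c_def by (rule chart_at_charts_at[OF M p])
    have "\<nu> p = s" using pN mN by simp
    then obtain X where X: "X \<in> tangent_space M p" "ext_deriv M (fun_form \<nu>) p [X] \<noteq> 0"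
      using \<open>regular_value M \<nu> s\<close> p unfolding regular_value_def by blast
    interpret C: torus_chart M \<rho> p c by (rule torus_chart_at[OF c])
    let ?\<nu> = "\<lambda>z. Sc c z (gen_rep \<rho> c \<xi> z) (gen_rep \<rho> c \<eta> z)"
    have "?\<nu> differentiable (at (cmap c p))"
      by (rule differentiableI, rule form2_D[OF sigma_form2_at[OF c] C.gen_rep_derivative C.gen_rep_derivative])
    \<comment> \<open>\<open>ext_deriv\<close> differentiates \<open>\<nu>\<close> composed with
      \<open>cinv c\<close>, which is compared with the expression through \<open>gen_rep\<close>
      over the image of the chart.\<close>
    moreover have "\<forall>\<^sub>F z in nhds (cmap c p). ?\<nu> z = \<nu> (cinv c z)"
      using eventually_in_chart[OF M c]
    proof (rule eventually_mono)
      fix z assume z: "cinv c z \<in> cdom c \<and> cmap c (cinv c z) = z"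
      then show "?\<nu> z = \<nu> (cinv c z)"
        unfolding assms(11-13) multi_moment_map_def
        by (simp add: generator_chart[OF charts_atD(1)[OF c]] in_chart_def)
    qed
    ultimately have "D ?\<nu> (cmap c p) = D (\<lambda>z. \<nu> (cinv c z)) (cmap c p)"
      by (rule D_eventually_eq[rotated])
    then have "3 * Pc c (cmap c p) (gen_rep \<rho> c \<xi> (cmap c p)) (gen_rep \<rho> c \<eta> (cmap c p)) (X c) \<noteq> 0"
      using X(2) d_moment_map[OF p, of \<xi> \<eta> "X c"] unfolding ext_deriv_function c_def[symmetric] by simp
    then have "psi_re p [U p, V p, X] \<noteq> 0"
      unfolding assms(11,12) generator_chart[OF charts_atD[OF c]] in_chart_cmap[OF M c]
      by (simp add: tangent_tvec[OF X(1) c])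
    then show ?thesis using X(1) by blast
  qed
  note rev = generator_swap[OF nk, where \<xi> = \<xi> and \<eta> = \<eta>, folded assms(11,12)]
  have R: "torus_reduction M g J psi_re psi_im \<rho> N Q \<xi> \<eta> s"
    by unfold_locales
      (rule N Q inclusion points projection \<nu>[unfolded assms(11,12)] regular[unfolded assms(11,12)] \<open>s \<noteq> 0\<close> | assumption)+
  have R': "torus_reduction M g J psi_re psi_im \<rho> N Q \<eta> (- \<xi>) s"
  proof unfold_locales
    fix p assume pN: "p \<in> points N"
    then have p: "p \<in> points M" using points by blast
    show "\<sigma> p [generator M \<rho> \<eta> p, generator M \<rho> (- \<xi>) p] = s"
      using rev(1)[OF p] \<nu>[OF pN] assms(12) by simp
    show "\<exists>X\<in>tangent_space M p. psi_re p [generator M \<rho> \<eta> p, generator M \<rho> (- \<xi>) p, X] \<noteq> 0"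
      using rev(2)[OF p] regular[OF pN] assms(12) by metis
  qed (rule N Q inclusion points projection \<open>s \<noteq> 0\<close>)+
  have f: "\<And>q. f q = 4 * H q / (H q - s\<^sup>2)" using assms(22) by simp
  have d: "smooth_form Q 1 \<alpha>\<^sub>0" "form_eq N 1 (pullback N Q (orbit \<rho>) \<alpha>\<^sub>0) (pullback N M (\<lambda>p. p) (alpha0 psi_im U V))"
    "smooth_form Q 1 \<alpha>\<^sub>1" "form_eq N 1 (pullback N Q (orbit \<rho>) \<alpha>\<^sub>1) (pullback N M (\<lambda>p. p) (alpha1 g J U V s))"
    "smooth_form Q 1 \<alpha>\<^sub>2" "form_eq N 1 (pullback N Q (orbit \<rho>) \<alpha>\<^sub>2) (pullback N M (\<lambda>p. p) (alpha2 g J U V s))"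
    "smooth_form Q 0 (fun_form H)" "form_eq N 0 (pullback N Q (orbit \<rho>) (fun_form H)) (pullback N M (\<lambda>p. p) (fun_form (hsq g U V)))"
    using assms(18-21) unfolding descends_to_def by blast+
  note pb = form_eq_pullback[OF M N smooth_map_diff_map[OF inclusion]]
  let ?U' = "generator M \<rho> (- \<xi>)"
  have trans: "form_eq N k a c" if "form_eq N k a b" "form_eq N k b c" for k and a b c :: "('a, real^5) form"
    using that unfolding form_eq_def by simp
  have eq1: "form_eq M 1 \<omega> \<omega>'" if "\<And>p X. p \<in> points M \<Longrightarrow> X \<in> tangent_space M p \<Longrightarrow> \<omega> p [X] = \<omega>' p [X]" for \<omega> \<omega>'
    unfolding form_eq_def
  proof (intro ballI allI impI)
    fix p and Xs :: "('a, real^6) tangent list"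
    assume p: "p \<in> points M" and "length Xs = 1 \<and> set Xs \<subseteq> tangent_space M p"
    then obtain X where "Xs = [X]" "X \<in> tangent_space M p" by (auto simp: length_Suc_conv)
    then show "\<omega> p Xs = \<omega>' p Xs" using that[OF p] by simp
  qed
  have d0': "form_eq N 1 (pullback N Q (orbit \<rho>) \<alpha>\<^sub>0) (pullback N M (\<lambda>p. p) (alpha0 psi_im V ?U'))"
    by (rule trans[OF d(2) pb[OF eq1]]) (rule rev(3)[symmetric])
  \<comment> \<open>For the swapped pair \<open>alpha1\<close> agrees with the original
    \<open>alpha2\<close> on tangent vectors, so \<open>\<alpha>\<^sub>2\<close> can take the place
    of \<open>\<alpha>\<^sub>1\<close> in \<open>d_alpha1\<close>.\<close>
  have d1': "form_eq N 1 (pullback N Q (orbit \<rho>) \<alpha>\<^sub>2) (pullback N M (\<lambda>p. p) (alpha1 g J V ?U' s))"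
    by (rule trans[OF d(6) pb[OF eq1]]) (rule rev(4)[symmetric])
  have dH': "form_eq N 0 (pullback N Q (orbit \<rho>) (fun_form H)) (pullback N M (\<lambda>p. p) (fun_form (hsq g V ?U')))"
    by (rule trans[OF d(8) pb]) (use rev(5) in \<open>simp add: form_eq_def fun_form_def\<close>)
  have point: "reduction_point M g J psi_re psi_im \<rho> N Q \<xi> \<eta> s p"
    "reduction_point M g J psi_re psi_im \<rho> N Q \<eta> (- \<xi>) s p" if "p \<in> points N" for p
    by (rule reduction_point.intro[OF R reduction_point_axioms.intro[OF that]]
        reduction_point.intro[OF R' reduction_point_axioms.intro[OF that]])+
  show ?thesis
  proof (intro conjI)
    show "form_eq Q 2 (ext_deriv Q \<alpha>\<^sub>0) (\<lambda>q Xs. f q * form_wedge 1 1 \<alpha>\<^sub>1 \<alpha>\<^sub>2 q Xs)"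
      unfolding form_eq_def
    proof (intro ballI allI impI)
      fix q Xs assume q: "q \<in> points Q" and "length Xs = 2 \<and> set Xs \<subseteq> tangent_space Q q"
      then obtain X Y where X: "Xs = [X, Y]" "X \<in> tangent_space Q q" "Y \<in> tangent_space Q q"
        by (auto simp: length_Suc_conv numeral_2_eq_2)
      obtain p where p: "p \<in> points N" "q = orbit \<rho> p" using q surj by blast
      show "ext_deriv Q \<alpha>\<^sub>0 q Xs = f q * form_wedge 1 1 \<alpha>\<^sub>1 \<alpha>\<^sub>2 q Xs"
        unfolding X(1) form_wedge_def wedge_1_1 p(2)
        by (rule reduction_point.d_alpha0[OF point(1)[OF p(1)] d(1) d(2,4,6)[unfolded assms(11,12)]
              d(7) d(8)[unfolded assms(11,12)] f X(2,3)[unfolded p(2)]])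
    qed
    show "form_eq Q 3 (form_wedge 2 1 (ext_deriv Q \<alpha>\<^sub>1) \<alpha>\<^sub>0)
      (form_wedge 2 1 (form_wedge 1 1 (\<lambda>q Xs. - ext_deriv Q (fun_form f) q Xs / f q) \<alpha>\<^sub>1) \<alpha>\<^sub>0)"
      unfolding form_eq_def
    proof (intro ballI allI impI)
      fix q Xs assume q: "q \<in> points Q" and "length Xs = 3 \<and> set Xs \<subseteq> tangent_space Q q"
      then obtain X Y Z where X: "Xs = [X, Y, Z]" "X \<in> tangent_space Q q" "Y \<in> tangent_space Q q" "Z \<in> tangent_space Q q"
        by (auto simp: length_Suc_conv numeral_3_eq_3)
      obtain p where p: "p \<in> points N" "q = orbit \<rho> p" using q surj by blast
      show "form_wedge 2 1 (ext_deriv Q \<alpha>\<^sub>1) \<alpha>\<^sub>0 q Xs =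
        form_wedge 2 1 (form_wedge 1 1 (\<lambda>q Xs. - ext_deriv Q (fun_form f) q Xs / f q) \<alpha>\<^sub>1) \<alpha>\<^sub>0 q Xs"
        unfolding X(1) p(2)
        by (rule reduction_point.d_alpha1[OF point(1)[OF p(1)] d(2)[unfolded assms(11,12)] d(3)
              d(4)[unfolded assms(11,12)] d(7) d(8)[unfolded assms(11,12)] f X(2-4)[unfolded p(2)]])
    qed
    show "form_eq Q 3 (form_wedge 2 1 (ext_deriv Q \<alpha>\<^sub>2) \<alpha>\<^sub>0)
      (form_wedge 2 1 (form_wedge 1 1 (\<lambda>q Xs. - ext_deriv Q (fun_form f) q Xs / f q) \<alpha>\<^sub>2) \<alpha>\<^sub>0)"
      unfolding form_eq_def
    proof (intro ballI allI impI)
      fix q Xs assume q: "q \<in> points Q" and "length Xs = 3 \<and> set Xs \<subseteq> tangent_space Q q"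
      then obtain X Y Z where X: "Xs = [X, Y, Z]" "X \<in> tangent_space Q q" "Y \<in> tangent_space Q q" "Z \<in> tangent_space Q q"
        by (auto simp: length_Suc_conv numeral_3_eq_3)
      obtain p where p: "p \<in> points N" "q = orbit \<rho> p" using q surj by blast
      show "form_wedge 2 1 (ext_deriv Q \<alpha>\<^sub>2) \<alpha>\<^sub>0 q Xs =
        form_wedge 2 1 (form_wedge 1 1 (\<lambda>q Xs. - ext_deriv Q (fun_form f) q Xs / f q) \<alpha>\<^sub>2) \<alpha>\<^sub>0 q Xs"
        unfolding X(1) p(2)
        by (rule reduction_point.d_alpha1[OF point(2)[OF p(1)] d0'[unfolded assms(12)] d(5)
              d1'[unfolded assms(12)] d(7) dH'[unfolded assms(12)] f X(2-4)[unfolded p(2)]])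
    qed
  qed
qed

end
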